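(* Let $G$ be an AQ-graph with vertex set $V$ and let $B\in P_G$ be such that $B$ is a positive, self-adjoint operator on $L^2(V)$. Suppose that $B(x,y)\in\mathbb{Q}$ for all $x,y\in V$. Then for any F\o lner sequence $\{Q_n\}_{n=1}^\infty$ in $G$, the spectral distribution functions $N_{B_n}$ of the finite-dimensional operators $B_n=p_{Q_n}B\,i_{Q_n}$ converge uniformly (in $\lambda\ge 0$) to the integrated density of states $\sigma_B$, where $\sigma_B$ is the von Neumann spectral function of the positive, self-adjoint element $\psi_G(B)\in N_G$.
   Context: Graphs. $G=G(V,E)$ is an infinite, connected graph with bounded vertex degrees; $d_G$ is the shortest path distance, and $B_r(x)$ is the ball of radius $r$ around $x$, a finite graph (the induced subgraph) rooted at $x$. A F\o lner sequence in $G$ is a sequence $\{Q_n\}_{n=1}^\infty$ of non-empty finite subsets of $V$ with $\lim_{n\to\infty}|\partial Q_n|/|Q_n|=0$, where $\partial Q_n=\{p\in Q_n : \exists q\notin Q_n,\ (p,q)\in E\}$. $G$ is amenable if it has a F\o lner sequence. Vertices $x,y$ have the same $r$-pattern if there is a graph isomorphism $\phi:B_r(x)\to B_r(y)$ with $\phi(x)=y$; $P_r(G)$ is the finite set of $r$-patterns occurring in $G$. $G$ is an AQ-graph (abstract quasicrystal graph) if it is infinite, connected, of bounded degree, amenable, and for every $r$ and every $\alpha\in P_r(G)$ there is a number $P(\alpha)$ (the frequency) such that for any F\o lner sequence $\{Q_n\}$, $\lim_{n\to\infty}|Q_n^\alpha|/|Q_n|=P(\alpha)$, where $Q_n^\alpha\subseteq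 Q_n$ is the set of vertices of $Q_n$ having $r$-pattern $\alpha$. Pattern-invariant matrices. $P_G$ is the set of functions $A:V\times V\to\mathbb{C}$ for which there is $r_A$ (the propagation) such that $A(x,y)=0$ whenever $d_G(x,y)>r_A$, and $A(x,y)=A(\phi(x),\phi(y))$ for every graph isomorphism $\phi$ from the $r_A$-ball around $x$ to the $r_A$-ball around $\phi(x)$ mapping $x$ to $\phi(x)$, and every $y$ in the $r_A$-ball around $x$. $P_G$ is a unital $*$-algebra with matrix addition, matrix multiplication $AB(x,y)=\sum_z A(x,z)B(z,y)$ and $A^*(x,y)=\overline{A(y,x)}$, acting on $L^2(V)$ (square-summable functions) by $A(f)(x)=\sum_y A(x,y)f(y)$. Trace and von Neumann algebra. For $A\in P_G$, $\mathrm{Tr}_G(A)=\lim_{n\to\infty}\frac1{|Q_n|}\sum_{x\in Q_n}A(x,x)$ for a F\o lner sequence $\{Q_n\}$; the limit exists and is independent of the sequence. Let $H$ be the Hilbert space completion of $P_G$ for $\langle A,B\rangle=\mathrm{Tr}_G(B^*A)$ (after dividing by null vectors, if any). Left multiplication $L_A(B)=AB$ extends to a bounded operator on $H$; $N_G\subseteq B(H)$ is the weak operator closure of $\{L_A: A\in P_G\}$, $\psi_G:P_G\to N_G$ is $A\mapsto L_A$, and $\mathrm{Tr}_G$ extends to $N_G$ by $\mathrm{Tr}_G(T)=\langle T\mathbf 1,\mathbf 1\rangle$, with $\mathbf 1$ the class of the identity matrix. Spectral functions. For positive self-adjoint $B\in P_G$, $\sigma_B(\lambda)=\mathrm{Tr}_G(\chi_{[0,\lambda]}(\psi_G(B)))$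 (spectral projection by functional calculus). For finite $Q_n\subset V$, $p_{Q_n}:L^2(V)\to L^2(Q_n)$ is the orthogonal projection, $i_{Q_n}$ its adjoint (the inclusion), and $N_{B_n}(\lambda)=s(\lambda,B_n)/|Q_n|$, where $s(\lambda,B_n)$ is the number of eigenvalues of $B_n$, counted with multiplicity, not greater than $\lambda$. *)

theory Defs
  imports
    "HOL-Analysis.Analysis"
    "HOL-Computational_Algebra.Polynomial"
    "Jordan_Normal_Form.Char_Poly"
begin

section \<open>Graphs, patterns and Foelner sequences\<close>

text \<open>A graph is given by its adjacency relation; the vertex set is the whole type \<open>'v\<close>.\<close>

definition simple_graph :: "'v rel \<Rightarrow> bool" where
  "simple_graph E \<longleftrightarrow> sym E \<and> irrefl E"

definition connected_graph :: "'v rel \<Rightarrow> bool" where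
  "connected_graph E \<longleftrightarrow> (\<forall>x y. (x, y) \<in> E\<^sup>*)"

definition bounded_degree :: "'v rel \<Rightarrow> bool" where
  "bounded_degree E \<longleftrightarrow> (\<exists>d::nat. \<forall>x. finite {y. (x, y) \<in> E} \<and> card {y. (x, y) \<in> E} \<le> d)"

text \<open>Only used for connected graphs, where the set of path lengths is non-empty.\<close>

definition graph_dist :: "'v rel \<Rightarrow> 'v \<Rightarrow> 'v \<Rightarrow> nat" where
  "graph_dist E x y = (LEAST n. (x, y) \<in> E ^^ n)"

definition graph_ball :: "'v rel \<Rightarrow> nat \<Rightarrow> 'v \<Rightarrow> 'v set" where
  "graph_ball E r x = {y. graph_dist E x y \<le> r}"

definition ball_iso :: "'v rel \<Rightarrow> nat \<Rightarrow> 'v \<Rightarrow> 'v \<Rightarrow> ('v \<Rightarrow> 'v) \<Rightarrow> bool" where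
  "ball_iso E r x y \<phi> \<longleftrightarrow>
     bij_betw \<phi> (graph_ball E r x) (graph_ball E r y) \<and> \<phi> x = y \<and>
     (\<forall>u\<in>graph_ball E r x. \<forall>v\<in>graph_ball E r x. (u, v) \<in> E \<longleftrightarrow> (\<phi> u, \<phi> v) \<in> E)"

definition same_pattern :: "'v rel \<Rightarrow> nat \<Rightarrow> 'v \<Rightarrow> 'v \<Rightarrow> bool" where
  "same_pattern E r x y \<longleftrightarrow> (\<exists>\<phi>. ball_iso E r x y \<phi>)"

text \<open>An \<open>r\<close>-pattern is identified with the set of all vertices having that pattern, so that the
  set of vertices of \<open>Q\<close> having pattern \<open>\<alpha>\<close> is \<open>Q \<inter> \<alpha>\<close>.\<close>

definition patterns :: "'v rel \<Rightarrow> nat \<Rightarrow> 'v set set" where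
  "patterns E r = UNIV // {(x, y). same_pattern E r x y}"

definition graph_boundary :: "'v rel \<Rightarrow> 'v set \<Rightarrow> 'v set" where
  "graph_boundary E Q = {p \<in> Q. \<exists>q. q \<notin> Q \<and> (p, q) \<in> E}"

definition folner_seq :: "'v rel \<Rightarrow> (nat \<Rightarrow> 'v set) \<Rightarrow> bool" where
  "folner_seq E Q \<longleftrightarrow>
     (\<forall>n. finite (Q n) \<and> Q n \<noteq> {}) \<and>
     (\<lambda>n. real (card (graph_boundary E (Q n))) / real (card (Q n))) \<longlonglongrightarrow> 0"

definition amenable_graph :: "'v rel \<Rightarrow> bool" where
  "amenable_graph E \<longleftrightarrow> (\<exists>Q. folner_seq E Q)"

definition AQ_graph :: "'v rel \<Rightarrow> bool" where
  "AQ_graph E \<longleftrightarrow>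
     simple_graph E \<and> infinite (UNIV :: 'v set) \<and> connected_graph E \<and> bounded_degree E \<and>
     amenable_graph E \<and>
     (\<forall>r. \<forall>\<alpha>\<in>patterns E r. \<exists>p::real. \<forall>Q. folner_seq E Q \<longrightarrow>
        (\<lambda>n. real (card (Q n \<inter> \<alpha>)) / real (card (Q n))) \<longlonglongrightarrow> p)"


section \<open>Pattern-invariant matrices\<close>

type_synonym 'v kernel = "'v \<Rightarrow> 'v \<Rightarrow> complex"

definition pattern_invariant :: "'v rel \<Rightarrow> 'v kernel set" where
  "pattern_invariant E = {A. \<exists>r.
     (\<forall>x y. graph_dist E x y > r \<longrightarrow> A x y = 0) \<and>
     (\<forall>x x' \<phi>. ball_iso E r x x' \<phi> \<longrightarrow> (\<forall>y\<in>graph_ball E r x. A x y = A (\<phi> x) (\<phi> y)))}"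

definition kernel_one :: "'v kernel" where
  "kernel_one = (\<lambda>x y. if x = y then 1 else 0)"

definition kernel_mult :: "'v kernel \<Rightarrow> 'v kernel \<Rightarrow> 'v kernel" where
  "kernel_mult A B = (\<lambda>x y. \<Sum>\<^sub>\<infinity>z. A x z * B z y)"

definition kernel_adj :: "'v kernel \<Rightarrow> 'v kernel" where
  "kernel_adj A = (\<lambda>x y. cnj (A y x))"

definition kernel_op :: "'v kernel \<Rightarrow> ('v \<Rightarrow> complex) \<Rightarrow> ('v \<Rightarrow> complex)" where
  "kernel_op A f = (\<lambda>x. \<Sum>\<^sub>\<infinity>y. A x y * f y)"

definition square_summable :: "('v \<Rightarrow> complex) set" where
  "square_summable = {f. (\<lambda>x. (cmod (f x))\<^sup>2) summable_on UNIV}"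

definition l2_inner :: "('v \<Rightarrow> complex) \<Rightarrow> ('v \<Rightarrow> complex) \<Rightarrow> complex" where
  "l2_inner f g = (\<Sum>\<^sub>\<infinity>x. f x * cnj (g x))"

definition l2_self_adjoint :: "'v kernel \<Rightarrow> bool" where
  "l2_self_adjoint A \<longleftrightarrow>
     (\<forall>f\<in>square_summable. \<forall>g\<in>square_summable.
        l2_inner (kernel_op A f) g = l2_inner f (kernel_op A g))"

definition l2_positive :: "'v kernel \<Rightarrow> bool" where
  "l2_positive A \<longleftrightarrow>
     (\<forall>f\<in>square_summable. l2_inner (kernel_op A f) f \<in> \<real> \<and> 0 \<le> Re (l2_inner (kernel_op A f) f))"

text \<open>The value common to all Foelner sequences.\<close>

definition graph_trace :: "'v rel \<Rightarrow> 'v kernel \<Rightarrow> complex" where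
  "graph_trace E A = (THE t. \<forall>Q. folner_seq E Q \<longrightarrow>
     (\<lambda>n. (\<Sum>x\<in>Q n. A x x) / of_nat (card (Q n))) \<longlonglongrightarrow> t)"


section \<open>Operators on Hilbert spaces and spectral projections\<close>

text \<open>The Hilbert space of a graph depends on the graph, so it has to be a carrier set
  rather than a type.  Inner products are linear in the first argument.\<close>

record 'h hilbert =
  carr :: "'h set"
  hzero :: 'h
  hadd :: "'h \<Rightarrow> 'h \<Rightarrow> 'h"
  hscale :: "complex \<Rightarrow> 'h \<Rightarrow> 'h"
  hinner :: "'h \<Rightarrow> 'h \<Rightarrow> complex"

definition hnorm :: "'h hilbert \<Rightarrow> 'h \<Rightarrow> real" where
  "hnorm H u = sqrt (Re (hinner H u u))"

text \<open>Operators take the value \<open>undefined\<close> outside the carrier, so that equality of operators is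
  equality on the carrier.\<close>

definition bounded_ops :: "'h hilbert \<Rightarrow> ('h \<Rightarrow> 'h) set" where
  "bounded_ops H = {T \<in> carr H \<rightarrow>\<^sub>E carr H.
     (\<forall>u\<in>carr H. \<forall>v\<in>carr H. T (hadd H u v) = hadd H (T u) (T v)) \<and>
     (\<forall>c. \<forall>u\<in>carr H. T (hscale H c u) = hscale H c (T u)) \<and>
     (\<exists>C. \<forall>u\<in>carr H. hnorm H (T u) \<le> C * hnorm H u)}"

definition self_adjoint_op :: "'h hilbert \<Rightarrow> ('h \<Rightarrow> 'h) \<Rightarrow> bool" where
  "self_adjoint_op H T \<longleftrightarrow>
     (\<forall>u\<in>carr H. \<forall>v\<in>carr H. hinner H (T u) v = hinner H u (T v))"

definition positive_op :: "'h hilbert \<Rightarrow> ('h \<Rightarrow> 'h) \<Rightarrow> bool" where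
  "positive_op H T \<longleftrightarrow>
     (\<forall>u\<in>carr H. hinner H (T u) u \<in> \<real> \<and> 0 \<le> Re (hinner H (T u) u))"

definition weak_operator_closure :: "'h hilbert \<Rightarrow> ('h \<Rightarrow> 'h) set \<Rightarrow> ('h \<Rightarrow> 'h) set" where
  "weak_operator_closure H \<A> = {T \<in> bounded_ops H.
     \<forall>F \<epsilon>. finite F \<and> F \<subseteq> carr H \<times> carr H \<and> 0 < (\<epsilon>::real) \<longrightarrow>
       (\<exists>S\<in>\<A>. \<forall>(u, v)\<in>F. cmod (hinner H (T u) v - hinner H (S u) v) < \<epsilon>)}"

text \<open>Bounded projection-valued measures on the real line; as usual, countable additivity
  is required weakly.\<close>

definition projection_valued_measure :: "'h hilbert \<Rightarrow> (real set \<Rightarrow> 'h \<Rightarrow> 'h) \<Rightarrow> bool" where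
  "projection_valued_measure H P \<longleftrightarrow>
     (\<forall>S\<in>sets borel. P S \<in> bounded_ops H \<and> self_adjoint_op H (P S) \<and>
        (\<forall>u\<in>carr H. P S (P S u) = P S u)) \<and>
     (\<forall>u\<in>carr H. P {} u = hzero H) \<and>
     (\<exists>a. \<forall>u\<in>carr H. P {-a<..<a} u = u) \<and>
     (\<forall>S\<in>sets borel. \<forall>S'\<in>sets borel. \<forall>u\<in>carr H. P (S \<inter> S') u = P S (P S' u)) \<and>
     (\<forall>S :: nat \<Rightarrow> real set. range S \<subseteq> sets borel \<and> disjoint_family S \<longrightarrow>
        (\<forall>u\<in>carr H. \<forall>v\<in>carr H.
           (\<lambda>i. hinner H (P (S i) u) v) sums hinner H (P (\<Union>i. S i) u) v))"

definition scalar_spectral_measure ::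
    "'h hilbert \<Rightarrow> (real set \<Rightarrow> 'h \<Rightarrow> 'h) \<Rightarrow> 'h \<Rightarrow> real measure" where
  "scalar_spectral_measure H P u =
     measure_of UNIV (sets borel) (\<lambda>S. ennreal (Re (hinner H (P S u) u)))"

text \<open>\<open>T = \<integral> t dP(t)\<close>, tested on the diagonal \<open>\<langle>T u, u\<rangle>\<close> (which determines \<open>T\<close> by polarization).\<close>

definition spectral_resolution :: "'h hilbert \<Rightarrow> ('h \<Rightarrow> 'h) \<Rightarrow> (real set \<Rightarrow> 'h \<Rightarrow> 'h) \<Rightarrow> bool" where
  "spectral_resolution H T P \<longleftrightarrow>
     projection_valued_measure H P \<and>
     (\<forall>u\<in>carr H. integrable (scalar_spectral_measure H P u) (\<lambda>t. t) \<and>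
        hinner H (T u) u = of_real (\<integral>t. t \<partial>scalar_spectral_measure H P u))"

text \<open>\<open>\<chi>\<^sub>S(T)\<close> for a bounded self-adjoint \<open>T\<close> and a Borel set \<open>S\<close>.\<close>

definition spectral_projection :: "'h hilbert \<Rightarrow> ('h \<Rightarrow> 'h) \<Rightarrow> real set \<Rightarrow> 'h \<Rightarrow> 'h" where
  "spectral_projection H T S = (THE R. \<exists>P. spectral_resolution H T P \<and> R = P S)"


section \<open>The von Neumann algebra of a graph\<close>

definition trace_inner :: "'v rel \<Rightarrow> 'v kernel \<Rightarrow> 'v kernel \<Rightarrow> complex" where
  "trace_inner E A B = graph_trace E (kernel_mult (kernel_adj B) A)"

definition trace_dist :: "'v rel \<Rightarrow> 'v kernel \<Rightarrow> 'v kernel \<Rightarrow> real" where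
  "trace_dist E A B =
     (let D = (\<lambda>x y. A x y - B x y) in sqrt (Re (trace_inner E D D)))"

definition trace_cauchy :: "'v rel \<Rightarrow> (nat \<Rightarrow> 'v kernel) set" where
  "trace_cauchy E = {X. (\<forall>n. X n \<in> pattern_invariant E) \<and>
     (\<forall>\<epsilon>>0. \<exists>N. \<forall>m\<ge>N. \<forall>n\<ge>N. trace_dist E (X m) (X n) < \<epsilon>)}"

definition trace_equiv :: "'v rel \<Rightarrow> (nat \<Rightarrow> 'v kernel) rel" where
  "trace_equiv E = {(X, Y). X \<in> trace_cauchy E \<and> Y \<in> trace_cauchy E \<and>
     (\<lambda>n. trace_dist E (X n) (Y n)) \<longlonglongrightarrow> 0}"

type_synonym 'v trace_class = "(nat \<Rightarrow> 'v kernel) set"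

text \<open>The completion consists of Cauchy sequences modulo sequences at distance tending to \<open>0\<close>; this
  also divides out the null vectors of \<open>trace_inner\<close>.\<close>

definition graph_class :: "'v rel \<Rightarrow> 'v kernel \<Rightarrow> 'v trace_class" where
  "graph_class E A = trace_equiv E `` {\<lambda>n. A}"

definition graph_hilbert :: "'v rel \<Rightarrow> 'v trace_class hilbert" where
  "graph_hilbert E = \<lparr>
     carr = trace_cauchy E // trace_equiv E,
     hzero = graph_class E (\<lambda>x y. 0),
     hadd = (\<lambda>\<xi> \<eta>. trace_equiv E `` {\<lambda>n x y. X n x y + Y n x y | X Y. X \<in> \<xi> \<and> Y \<in> \<eta>}),
     hscale = (\<lambda>c \<xi>. trace_equiv E `` {\<lambda>n x y. c * X n x y | X. X \<in> \<xi>}),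
     hinner = (\<lambda>\<xi> \<eta>. THE c. \<forall>X\<in>\<xi>. \<forall>Y\<in>\<eta>. (\<lambda>n. trace_inner E (X n) (Y n)) \<longlonglongrightarrow> c)\<rparr>"

text \<open>The continuous extension of \<open>B \<mapsto> A B\<close> to the completion.\<close>

definition left_mult_op :: "'v rel \<Rightarrow> 'v kernel \<Rightarrow> 'v trace_class \<Rightarrow> 'v trace_class" where
  "left_mult_op E A =
     (\<lambda>\<xi>\<in>carr (graph_hilbert E). trace_equiv E `` {\<lambda>n. kernel_mult A (X n) | X. X \<in> \<xi>})"

definition graph_vN_algebra :: "'v rel \<Rightarrow> ('v trace_class \<Rightarrow> 'v trace_class) set" where
  "graph_vN_algebra E =
     weak_operator_closure (graph_hilbert E) (left_mult_op E ` pattern_invariant E)"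

definition vN_trace :: "'v rel \<Rightarrow> ('v trace_class \<Rightarrow> 'v trace_class) \<Rightarrow> complex" where
  "vN_trace E T =
     hinner (graph_hilbert E) (T (graph_class E kernel_one)) (graph_class E kernel_one)"

text \<open>The trace of a projection is real, so \<open>Re\<close> loses nothing.\<close>

definition spectral_function :: "'v rel \<Rightarrow> 'v kernel \<Rightarrow> real \<Rightarrow> real" where
  "spectral_function E B t =
     Re (vN_trace E (spectral_projection (graph_hilbert E) (left_mult_op E B) {0..t}))"


section \<open>Finite-dimensional restrictions\<close>

text \<open>\<open>L\<^sup>2(Q)\<close> is identified with the functions vanishing outside \<open>Q\<close>, so that the inclusion into
  \<open>L\<^sup>2(V)\<close> is the identity.\<close>

definition l2_restrict :: "'v set \<Rightarrow> ('v \<Rightarrow> complex) \<Rightarrow> ('v \<Rightarrow> complex)" where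
  "l2_restrict Q f = (\<lambda>x. if x \<in> Q then f x else 0)"

definition compression :: "'v kernel \<Rightarrow> 'v set \<Rightarrow> ('v \<Rightarrow> complex) \<Rightarrow> ('v \<Rightarrow> complex)" where
  "compression B Q f = l2_restrict Q (kernel_op B f)"

text \<open>The matrix of an operator on \<open>L\<^sup>2(Q)\<close> in the basis of point masses, in some enumeration
  of \<open>Q\<close>; its characteristic polynomial does not depend on the enumeration.\<close>

definition op_matrix :: "'v set \<Rightarrow> (('v \<Rightarrow> complex) \<Rightarrow> ('v \<Rightarrow> complex)) \<Rightarrow> complex Matrix.mat" where
  "op_matrix Q T =
     (let xs = (SOME xs. distinct xs \<and> set xs = Q) in
      Matrix.mat (card Q) (card Q)
        (\<lambda>(i, j). T (\<lambda>y. if y = xs ! j then 1 else 0) (xs ! i)))"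

definition count_eigenvalues_le ::
    "'v set \<Rightarrow> (('v \<Rightarrow> complex) \<Rightarrow> ('v \<Rightarrow> complex)) \<Rightarrow> real \<Rightarrow> nat" where
  "count_eigenvalues_le Q T t =
     size {#\<mu> \<in># proots (char_poly (op_matrix Q T)). \<mu> \<in> \<real> \<and> Re \<mu> \<le> t#}"

definition spectral_distribution :: "'v kernel \<Rightarrow> 'v set \<Rightarrow> real \<Rightarrow> real" where
  "spectral_distribution B Q t =
     real (count_eigenvalues_le Q (compression B Q) t) / real (card Q)"

end

theory Submission
  imports Defs "HOL-Probability.Probability" "Jordan_Normal_Form.Schur_Decomposition"
begin

text \<open>
  Why the eigenvalue distributions converge.  The matrix of the restriction \<open>B\<^sub>n\<close> to \<open>Q\<^sub>n\<close> is the
  \<open>Q\<^sub>n \<times> Q\<^sub>n\<close> block of \<open>B\<close>.  The diagonal entries of \<open>B\<^sub>n\<^sup>k\<close> and of \<open>B\<^sup>k\<close> differ only at points within a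
  bounded distance of the boundary of \<open>Q\<^sub>n\<close> (\<open>eigs_moment_error\<close>), a negligible proportion of a Foelner
  set, so the \<open>k\<close>-th moment of the eigenvalue distribution of \<open>B\<^sub>n\<close> tends to the trace of \<open>B\<^sup>k\<close>.  This
  trace is \<open>\<langle>L\<^sub>B\<^sup>k 1, 1\<rangle> = \<integral>t\<^sup>k d\<mu>\<close>, where \<open>\<mu>\<close> is the spectral measure at the vector \<open>1\<close> of the operator
  \<open>L\<^sub>B\<close> of left multiplication, and the spectral function is the distribution function of \<open>\<mu>\<close>
  (\<open>ids_measure\<close>).  All measures live on one compact interval, so moments determine limits:
  the eigenvalue distributions converge weakly to \<open>\<mu>\<close>.

  Weak convergence does not control the distribution functions at the atoms of \<open>\<mu>\<close>, and this is where
  rationality enters.  The entries of \<open>B\<close> take finitely many values, hence have a common denominator,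
  and after scaling every \<open>B\<^sub>n\<close> is an integer matrix.  If \<open>h\<close> is an integer polynomial, the product of
  the nonzero values of \<open>h\<close> at the eigenvalues of an integer matrix is, up to sign, a nonzero integer:
  it is the lowest nonvanishing coefficient of the characteristic polynomial of \<open>h\<close> applied to the
  matrix (\<open>prod_nonzero_ge_1\<close>).  The pigeonhole principle provides for every real \<open>x\<close> and \<open>\<eta> > 0\<close> an
  \<open>h\<close> that is at most \<open>S\<close> on the spectrum and smaller than \<open>s\<close> near \<open>x\<close>, with
  \<open>log S \<le> \<eta> log (1/s)\<close> (\<open>small_integer_polynomial\<close>).  If \<open>k\<close> of \<open>N\<close> eigenvalues are close to \<open>x\<close> but
  different from \<open>x\<close>, then \<open>1 \<le> s\<^sup>k S\<^sup>N\<close>, so \<open>k \<le> \<eta> N\<close>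
  (\<open>integer_matrix_eigenvalue_gap\<close>).  Thus mass can reach an atom \<open>x\<close> of \<open>\<mu>\<close> only by sitting at \<open>x\<close>
  already.  This turns weak convergence into pointwise convergence of the distribution functions
  and, by compactness, into uniform convergence (\<open>cdf_uniform_limit\<close>).

  The spectral projections of \<open>L\<^sub>B\<close> are characterised as the values of the unique projection-valued
  measure that resolves \<open>L\<^sub>B\<close>, so existence and uniqueness for a bounded positive operator \<open>T\<close> on a
  Hilbert space are proved as well.  Hausdorff's moment theorem (\<open>representing_measure\<close>), applied to
  \<open>p \<mapsto> \<langle>p(T) u, u\<rangle>\<close>, gives a spectral measure for each vector \<open>u\<close>; the map \<open>p \<mapsto> p(T) u\<close> is isometric for
  the \<open>L\<^sup>2\<close> norm of this measure, so polynomials approximating the indicator function of \<open>S\<close> give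
  vectors converging to the projection of \<open>u\<close>.  For uniqueness, any resolution of \<open>T\<close> commutes with
  \<open>T\<close> by a variation of phases (\<open>res_orthogonal_T\<close>), hence with the projections just constructed, and
  two commuting resolutions have the same projections for half-lines, because \<open>T\<close> cannot be both at
  most \<open>a\<close> and at least \<open>b > a\<close> on a nonzero vector.
\<close>

section \<open>Measures from moments\<close>

text \<open>Both quotients are products of \<open>j\<close> factors in \<open>[0, 1]\<close>, namely \<open>(k - i) / (n - i)\<close> and \<open>k / n\<close>
  for \<open>i < j\<close>, and corresponding factors differ by at most \<open>i / (n - i)\<close>.\<close>

lemma choose_ratio_approx:
  fixes k n j :: nat
  assumes "k \<le> n" "j < n"
  shows "\<bar>real (k choose j) / real (n choose j) - (real k / real n) ^ j\<bar> \<le> real (j * j) / real (n - j)"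
proof -
  have ratio: "real (k choose j) / real (n choose j) = (\<Prod>i\<in>{0..<j}. real (k - i) / real (n - i))"
  proof (cases "j \<le> k")
    case True
    have nz: "(\<Prod>i = 0..<j. real (j - i)) \<noteq> 0" by (auto simp: prod_zero_iff)
    have 1: "real (k choose j) = (\<Prod>i = 0..<j. real (k - i)) / (\<Prod>i = 0..<j. real (j - i))"
      using binomial_altdef_of_nat[OF True, where 'a = real] by (simp add: prod_dividef)
    have 2: "real (n choose j) = (\<Prod>i = 0..<j. real (n - i)) / (\<Prod>i = 0..<j. real (j - i))"
      using binomial_altdef_of_nat[of j n, where 'a = real] assms by (simp add: prod_dividef)
    show ?thesis unfolding 1 2 prod_dividef using nz by simp
  next
    case False
    then have "(\<Prod>i\<in>{0..<j}. real (k - i) / real (n - i)) = 0"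
      by (intro prod_zero) (auto intro!: bexI[of _ k])
    with False show ?thesis by (simp only:) simp
  qed
  have "\<bar>(\<Prod>i\<in>{0..<j}. real (k - i) / real (n - i)) - (\<Prod>i\<in>{0..<j}. real k / real n)\<bar>
     \<le> (\<Sum>i\<in>{0..<j}. \<bar>real (k - i) / real (n - i) - real k / real n\<bar>)"
    unfolding real_norm_def[symmetric]
    by (rule norm_prod_diff) (use assms in \<open>auto simp: divide_le_eq_1\<close>)
  also have "\<dots> \<le> (\<Sum>i\<in>{0..<j}. real j / real (n - j))"
  proof (rule sum_mono)
    fix i assume i: "i \<in> {0..<j}"
    have n: "0 < real n" "0 < real (n - i)" "0 < real (n - j)" using assms i by auto
    have "\<bar>real (k - i) / real (n - i) - real k / real n\<bar> \<le> real i / real (n - i)"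
    proof (cases "i \<le> k")
      case True
      have "real (k - i) / real (n - i) - real k / real n = - (real i * (real n - real k)) / (real n * real (n - i))"
        using n True assms i by (simp add: field_simps of_nat_diff)
      also have "\<bar>\<dots>\<bar> = real i * (real n - real k) / (real n * real (n - i))"
        using n assms by (simp add: abs_mult)
      also have "\<dots> \<le> real i * real n / (real n * real (n - i))"
        using n by (intro divide_right_mono mult_left_mono) auto
      also have "\<dots> = real i / real (n - i)" using n by simp
      finally show ?thesis .
    next
      case False
      then have "\<bar>real (k - i) / real (n - i) - real k / real n\<bar> = real k / real n" by simp
      also have "\<dots> \<le> real i / real (n - i)"
        using n False by (intro frac_le) auto
      finally show ?thesis .
    qed
    also have "\<dots> \<le> real j / real (n - j)"
      using n i by (intro frac_le) auto
    finally show "\<bar>real (k - i) / real (n - i) - real k / real n\<bar> \<le> real j / real (n - j)" .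
  qed
  finally show ?thesis unfolding ratio by simp
qed

text \<open>Positivity is demanded for the products \<open>X\<^sup>k (1 - X)\<^sup>l\<close> only, as in Hausdorff's moment problem.
  For an operator between \<open>0\<close> and \<open>1\<close> it can be checked on them by elementary algebra, without square
  roots of operators.\<close>

locale hausdorff_functional =
  fixes L :: "real poly \<Rightarrow> real"
  assumes L_add: "L (p + q) = L p + L q"
    and L_smult: "L (Polynomial.smult c p) = c * L p"
    and L_pos: "0 \<le> L ([:0, 1:] ^ k * [:1, -1:] ^ l)"
begin

lemma L_0: "L 0 = 0"
  using L_smult[of 0 0] by simp

lemma L_sum: "L (sum f A) = (\<Sum>a\<in>A. L (f a))"
  by (induction A rule: infinite_finite_induct) (auto simp: L_0 L_add)

lemma L_diff: "L (p - q) = L p - L q"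
  using L_add[of "p - q" q] by simp

lemma L_eq_coeffs: "L p = (\<Sum>i\<le>degree p. coeff p i * L ([:0, 1:] ^ i))"
proof -
  have "L p = L (\<Sum>i\<le>degree p. monom (coeff p i) i)" by (simp add: poly_as_sum_of_monoms)
  also have "\<dots> = (\<Sum>i\<le>degree p. coeff p i * L ([:0, 1:] ^ i))"
    unfolding L_sum by (intro sum.cong refl) (simp add: monom_altdef L_smult)
  finally show ?thesis .
qed

text \<open>The value of \<open>L\<close> at the \<open>k\<close>-th Bernstein polynomial of degree \<open>n\<close>, to be used as the mass at
  \<open>k / n\<close> of an approximation to the representing measure.\<close>

definition bernstein_weight :: "nat \<Rightarrow> nat \<Rightarrow> real" where
  "bernstein_weight n k = real (n choose k) * L ([:0, 1:] ^ k * [:1, -1:] ^ (n - k))"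

lemma bernstein_weight_nonneg: "0 \<le> bernstein_weight n k"
  unfolding bernstein_weight_def by (intro mult_nonneg_nonneg L_pos) auto

text \<open>Multiplication of \<open>X\<^sup>j\<close> by \<open>(X + (1 - X))\<^bsup>n - j\<^esup> = 1\<close> expands it in the Bernstein polynomials of
  degree \<open>n\<close>.\<close>

lemma moment_eq_bernstein:
  assumes "j \<le> n"
  shows "L ([:0, 1:] ^ j) = (\<Sum>k\<le>n. real (k choose j) / real (n choose j) * bernstein_weight n k)"
proof -
  let ?X = "[:0, 1:] :: real poly" and ?Y = "[:1, -1:] :: real poly"
  have XY: "?X + ?Y = 1" by simp
  have "?X ^ j = ?X ^ j * (?X + ?Y) ^ (n - j)" unfolding XY by simp
  also have "\<dots> = (\<Sum>i\<le>n - j. of_nat ((n - j) choose i) * (?X ^ (i + j) * ?Y ^ (n - j - i)))"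
    unfolding binomial_ring sum_distrib_left by (intro sum.cong refl) (simp add: power_add algebra_simps)
  also have "L \<dots> = (\<Sum>i\<le>n - j. real ((n - j) choose i) * L (?X ^ (i + j) * ?Y ^ (n - j - i)))"
    unfolding L_sum
  proof (intro sum.cong refl)
    fix i
    have "(of_nat ((n - j) choose i) :: real poly) * (?X ^ (i + j) * ?Y ^ (n - j - i)) =
      Polynomial.smult (real ((n - j) choose i)) (?X ^ (i + j) * ?Y ^ (n - j - i))"
      by (simp add: of_nat_poly)
    then show "L (of_nat ((n - j) choose i) * (?X ^ (i + j) * ?Y ^ (n - j - i))) =
      real ((n - j) choose i) * L (?X ^ (i + j) * ?Y ^ (n - j - i))"
      by (simp only: L_smult)
  qed
  also have "\<dots> = (\<Sum>k\<in>{j..n}. real ((n - j) choose (k - j)) * L (?X ^ k * ?Y ^ (n - k)))"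
    by (rule sum.reindex_bij_witness[of _ "\<lambda>k. k - j" "\<lambda>i. i + j"]) (use assms in \<open>auto simp: add.commute\<close>)
  also have "\<dots> = (\<Sum>k\<in>{j..n}. real (k choose j) / real (n choose j) * bernstein_weight n k)"
  proof (intro sum.cong refl)
    fix k assume k: "k \<in> {j..n}"
    have "(n choose k) * (k choose j) = (n choose j) * ((n - j) choose (k - j))"
      using k by (intro choose_mult) auto
    then have "real (n choose k) * real (k choose j) = real (n choose j) * real ((n - j) choose (k - j))"
      by (metis of_nat_mult)
    moreover have "real (n choose j) > 0" using assms by simp
    ultimately have "real ((n - j) choose (k - j)) = real (k choose j) / real (n choose j) * real (n choose k)"
      by (simp add: field_simps)
    then show "real ((n - j) choose (k - j)) * L (?X ^ k * ?Y ^ (n - k)) =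
      real (k choose j) / real (n choose j) * bernstein_weight n k"
      by (simp add: bernstein_weight_def)
  qed
  also have "\<dots> = (\<Sum>k\<le>n. real (k choose j) / real (n choose j) * bernstein_weight n k)"
    by (rule sum.mono_neutral_left) auto
  finally show ?thesis .
qed

definition bernstein_measure :: "nat \<Rightarrow> real measure" where
  "bernstein_measure n =
     distr (point_measure {..n} (\<lambda>k. ennreal (bernstein_weight n k))) borel (\<lambda>k. real k / real n)"

lemma integral_bernstein_measure:
  fixes f :: "real \<Rightarrow> real"
  assumes "f \<in> borel_measurable borel"
  shows "(\<integral>t. f t \<partial>bernstein_measure n) = (\<Sum>k\<le>n. bernstein_weight n k * f (real k / real n))"
proof -
  have m: "(\<lambda>k. real k / real n) \<in> point_measure {..n} (\<lambda>k. ennreal (bernstein_weight n k)) \<rightarrow>\<^sub>M borel"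
    by simp
  show ?thesis
    unfolding bernstein_measure_def integral_distr[OF m assms]
    by (subst lebesgue_integral_point_measure_finite) (auto simp: bernstein_weight_nonneg)
qed

lemma real_distribution_bernstein:
  assumes "L 1 = 1"
  shows "real_distribution (bernstein_measure n)"
proof -
  have "(\<Sum>k\<le>n. bernstein_weight n k) = 1"
    using moment_eq_bernstein[of 0 n] assms by simp
  then have "emeasure (point_measure {..n} (\<lambda>k. ennreal (bernstein_weight n k))) {..n} = 1"
    by (subst emeasure_point_measure_finite) (auto simp: sum_ennreal bernstein_weight_nonneg)
  then have "prob_space (point_measure {..n} (\<lambda>k. ennreal (bernstein_weight n k)))"
    by (intro prob_spaceI) (simp add: space_point_measure)
  then have "prob_space (bernstein_measure n)"
    unfolding bernstein_measure_def by (rule prob_space.prob_space_distr) simp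
  then show ?thesis
    unfolding real_distribution_def real_distribution_axioms_def by (simp add: bernstein_measure_def)
qed

lemma AE_bernstein: "AE t in bernstein_measure n. t \<in> {0..1}"
  unfolding bernstein_measure_def
  by (subst AE_distr_iff) (auto simp: AE_point_measure divide_le_eq_1)

text \<open>The exact expansion of the moment and the moment of the discrete measure differ by replacing
  the ratio of binomial coefficients by a power of \<open>k / n\<close>.\<close>

lemma bernstein_moment_tendsto:
  assumes "L 1 = 1"
  shows "(\<lambda>n. \<Sum>k\<le>n. bernstein_weight n k * (real k / real n) ^ j) \<longlonglongrightarrow> L ([:0, 1:] ^ j)"
proof -
  have 1: "\<forall>\<^sub>F n in sequentially. \<bar>(\<Sum>k\<le>n. bernstein_weight n k * (real k / real n) ^ j) - L ([:0, 1:] ^ j)\<bar>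
      \<le> real (j * j) / real (n - j)"
    using eventually_gt_at_top[of j]
  proof eventually_elim
    case (elim n)
    have tot: "(\<Sum>k\<le>n. bernstein_weight n k) = 1"
      using moment_eq_bernstein[of 0 n] assms by simp
    have "\<bar>(\<Sum>k\<le>n. bernstein_weight n k * (real k / real n) ^ j) - L ([:0, 1:] ^ j)\<bar>
       = \<bar>\<Sum>k\<le>n. bernstein_weight n k * ((real k / real n) ^ j - real (k choose j) / real (n choose j))\<bar>"
      using elim by (subst moment_eq_bernstein[of j n])
        (auto simp: sum_subtractf right_diff_distrib mult.commute)
    also have "\<dots> \<le> (\<Sum>k\<le>n. bernstein_weight n k * (real (j * j) / real (n - j)))"
    proof (rule order.trans[OF sum_abs], rule sum_mono)
      fix k assume "k \<in> {..n}"
      then show "\<bar>bernstein_weight n k * ((real k / real n) ^ j - real (k choose j) / real (n choose j))\<bar>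
         \<le> bernstein_weight n k * (real (j * j) / real (n - j))"
        using choose_ratio_approx[of k n j] elim bernstein_weight_nonneg[of n k]
        by (simp only: abs_mult abs_of_nonneg abs_minus_commute) (intro mult_left_mono, auto)
    qed
    also have "\<dots> = real (j * j) / real (n - j)"
      unfolding sum_distrib_right[symmetric] tot by simp
    finally show ?case .
  qed
  have "filterlim (\<lambda>n. n - j) at_top sequentially"
    unfolding filterlim_at_top
  proof
    fix Z show "\<forall>\<^sub>F n in sequentially. Z \<le> n - j"
      using eventually_ge_at_top[of "Z + j"] by eventually_elim auto
  qed
  then have "filterlim (\<lambda>n. real (n - j)) at_top sequentially"
    by (rule filterlim_compose[OF filterlim_real_sequentially])
  then have 2: "(\<lambda>n. real (j * j) / real (n - j)) \<longlonglongrightarrow> 0"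
    by (intro tendsto_divide_0[OF tendsto_const] filterlim_at_top_imp_at_infinity)
  have "(\<lambda>n. (\<Sum>k\<le>n. bernstein_weight n k * (real k / real n) ^ j) - L ([:0, 1:] ^ j)) \<longlonglongrightarrow> 0"
    by (rule Lim_null_comparison[OF _ 2]) (use 1 in simp)
  then show ?thesis by (simp add: LIM_zero_iff)
qed

text \<open>The discrete measures live on \<open>[0, 1]\<close>, hence are tight, and Helly's theorem provides a weakly
  convergent subsequence.  Weak convergence only tests bounded continuous functions, so powers are
  composed with the retraction \<open>clamp\<close> onto \<open>[0, 1]\<close>; that the limit lives on \<open>[0, 1]\<close> follows by testing
  with \<open>gap\<close>, which vanishes exactly there.\<close>

lemma representing_measure_normalized:
  assumes "L 1 = 1"
  obtains \<nu> :: "real measure" where "finite_measure \<nu>" "sets \<nu> = sets borel"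
    "AE t in \<nu>. t \<in> {0..1}" "\<And>j. (\<integral>t. t ^ j \<partial>\<nu>) = L ([:0, 1:] ^ j)"
proof -
  define clamp :: "real \<Rightarrow> real" where "clamp t = max 0 (min 1 t)" for t
  define gap :: "real \<Rightarrow> real" where "gap t = min 1 \<bar>t - clamp t\<bar>" for t
  have clamp: "0 \<le> clamp t" "clamp t \<le> 1" "t \<in> {0..1} \<Longrightarrow> clamp t = t" for t
    by (auto simp: clamp_def)
  have rd: "real_distribution (bernstein_measure n)" for n
    by (rule real_distribution_bernstein[OF assms])
  have "tight bernstein_measure"
    unfolding tight_def
  proof (intro conjI allI impI rd)
    fix e :: real assume "e > 0"
    have "measure (bernstein_measure n) {-1<..1} = 1" for n
    proof -
      interpret real_distribution "bernstein_measure n" by (rule rd)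
      show ?thesis
        by (rule prob_eq_1[THEN iffD2]) (use AE_bernstein[of n] in \<open>auto elim!: eventually_mono\<close>)
    qed
    then show "\<exists>a b. a < b \<and> (\<forall>n. 1 - e < measure (bernstein_measure n) {a<..b})"
      using \<open>e > 0\<close> by (intro exI[of _ "-1"] exI[of _ 1]) auto
  qed
  from tight_imp_convergent_subsubsequence[OF this strict_mono_id]
  obtain r \<nu> where r: "strict_mono r" and \<nu>: "real_distribution \<nu>"
    and wc: "weak_conv_m (\<lambda>n. bernstein_measure (r n)) \<nu>"
    by (auto simp: o_def)
  interpret \<nu>: real_distribution \<nu> by (rule \<nu>)
  have lim: "(\<lambda>n. \<integral>t. f t \<partial>bernstein_measure (r n)) \<longlonglongrightarrow> (\<integral>t. f t \<partial>\<nu>)"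
    if "\<And>t. isCont f t" "\<And>t. \<bar>f t\<bar> \<le> 1" for f :: "real \<Rightarrow> real"
    by (rule weak_conv_imp_integral_bdd_continuous_conv[OF rd \<nu> wc, of f 1]) (use that in auto)
  have contg: "isCont gap t" for t
    unfolding gap_def clamp_def by (intro continuous_intros)
  have gap0: "0 \<le> gap t" for t
    by (simp add: gap_def)
  have gapb: "\<bar>gap t\<bar> \<le> 1" for t
    by (simp add: gap_def)
  have "(\<integral>t. gap t \<partial>bernstein_measure n) = 0" for n
    by (rule integral_eq_zero_AE) (use AE_bernstein[of n] in eventually_elim, simp add: gap_def clamp)
  then have "(\<integral>t. gap t \<partial>\<nu>) = 0"
    using lim[of gap, OF contg gapb] by (simp add: LIMSEQ_const_iff)
  moreover have gm: "gap \<in> borel_measurable borel"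
    unfolding gap_def clamp_def by measurable
  moreover have "integrable \<nu> gap"
    by (rule \<nu>.integrable_const_bound[of _ 1]) (use gm in \<open>auto simp: gap_def\<close>)
  ultimately have "AE t in \<nu>. gap t = 0"
    using integral_nonneg_eq_0_iff_AE[of \<nu> gap, OF _ AE_I2] gap0 by simp
  then have AE: "AE t in \<nu>. t \<in> {0..1}"
    by eventually_elim (auto simp: gap_def clamp_def min_def max_def split: if_splits)
  have mom: "(\<integral>t. t ^ j \<partial>\<nu>) = L ([:0, 1:] ^ j)" for j
  proof -
    have c: "isCont (\<lambda>t. clamp t ^ j) t" for t
      unfolding clamp_def by (intro continuous_intros)
    have m: "(\<lambda>t. clamp t ^ j) \<in> borel_measurable borel"
      unfolding clamp_def by measurable
    have "(\<lambda>n. \<integral>t. clamp t ^ j \<partial>bernstein_measure (r n)) \<longlonglongrightarrow> (\<integral>t. clamp t ^ j \<partial>\<nu>)"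
      by (rule lim[OF c]) (use clamp in \<open>auto simp: power_le_one\<close>)
    moreover have "(\<integral>t. clamp t ^ j \<partial>bernstein_measure n) = (\<Sum>k\<le>n. bernstein_weight n k * (real k / real n) ^ j)" for n
      unfolding integral_bernstein_measure[OF m]
      by (intro sum.cong refl, subst clamp(3)) (auto simp: divide_le_eq_1)
    ultimately have "(\<lambda>n. \<Sum>k\<le>r n. bernstein_weight (r n) k * (real k / real (r n)) ^ j) \<longlonglongrightarrow> (\<integral>t. clamp t ^ j \<partial>\<nu>)"
      by simp
    moreover have "(\<lambda>n. \<Sum>k\<le>r n. bernstein_weight (r n) k * (real k / real (r n)) ^ j) \<longlonglongrightarrow> L ([:0, 1:] ^ j)"
      using LIMSEQ_subseq_LIMSEQ[OF bernstein_moment_tendsto[OF assms, of j] r] by (simp add: o_def)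
    ultimately have "(\<integral>t. clamp t ^ j \<partial>\<nu>) = L ([:0, 1:] ^ j)" by (rule LIMSEQ_unique)
    moreover have "(\<integral>t. clamp t ^ j \<partial>\<nu>) = (\<integral>t. t ^ j \<partial>\<nu>)"
    proof (rule integral_cong_AE)
      show "AE t in \<nu>. clamp t ^ j = t ^ j"
        using AE by eventually_elim (simp add: clamp)
    qed (use m in auto)
    ultimately show ?thesis by simp
  qed
  show ?thesis
    by (rule that[OF _ _ AE mom]) (auto intro: \<nu>.finite_measure_axioms)
qed

text \<open>If \<open>L 1 = 0\<close>, this forces all moments to vanish, a case that cannot be normalized.\<close>

lemma moment_le_total: "L ([:0, 1:] ^ j) \<le> L 1"
proof (induction j)
  case (Suc j)
  have "L ([:0, 1:] ^ j) - L ([:0, 1:] ^ Suc j) = L ([:0, 1:] ^ j * [:1, -1:] ^ 1)"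
    unfolding L_diff[symmetric] by (rule arg_cong[where f = L]) (simp add: algebra_simps)
  also have "\<dots> \<ge> 0" by (rule L_pos)
  finally show ?case using Suc by simp
qed simp

end

lemma integrable_poly_bounded:
  fixes \<nu> :: "real measure"
  assumes "finite_measure \<nu>" "sets \<nu> = sets borel" "AE t in \<nu>. t \<in> {a..b}"
  shows "integrable \<nu> (\<lambda>t. poly p t)"
proof -
  have "compact (poly p ` {a..b})"
    by (intro compact_continuous_image continuous_intros) auto
  then obtain C where C: "\<And>t. t \<in> {a..b} \<Longrightarrow> \<bar>poly p t\<bar> \<le> C"
    using bounded_real[THEN iffD1, OF compact_imp_bounded] by (metis imageI)
  show ?thesis
    by (rule finite_measure.integrable_const_bound[OF assms(1), of _ C])
      (use assms(3) C in \<open>force elim!: eventually_mono simp: measurable_cong_sets[OF assms(2) refl]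
        intro: borel_measurable_continuous_onI continuous_intros\<close>)+
qed

text \<open>Hausdorff's moment theorem; the case \<open>L 1 \<noteq> 0\<close> is reduced to a probability measure by scaling.\<close>

theorem (in hausdorff_functional) representing_measure:
  obtains \<nu> :: "real measure" where "finite_measure \<nu>" "sets \<nu> = sets borel"
    "AE t in \<nu>. t \<in> {0..1}" "\<And>p. (\<integral>t. poly p t \<partial>\<nu>) = L p"
proof -
  have L1: "L 1 \<ge> 0" using L_pos[of 0 0] by simp
  obtain \<nu> :: "real measure" where \<nu>: "finite_measure \<nu>" "sets \<nu> = sets borel"
    "AE t in \<nu>. t \<in> {0..1}" and mom: "\<And>j. (\<integral>t. t ^ j \<partial>\<nu>) = L ([:0, 1:] ^ j)"
  proof (cases "L 1 = 0")
    case True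
    have z: "L ([:0, 1:] ^ j) = 0" for j
      using moment_le_total[of j] L_pos[of j 0] True by simp
    show ?thesis
      by (rule that[of "null_measure borel"]) (auto simp: z finite_measure_def finite_measure_axioms_def sigma_finite_measure_def AE_iff_null intro!: exI[of _ "{UNIV}"] finite_measureI)
  next
    case False
    interpret N: hausdorff_functional "\<lambda>p. L p / L 1"
      by unfold_locales (use L1 L_pos in \<open>auto simp: L_add L_smult add_divide_distrib\<close>)
    from False have "L 1 / L 1 = 1" by simp
    from N.representing_measure_normalized[OF this] obtain \<nu> :: "real measure"
      where n: "finite_measure \<nu>" "sets \<nu> = sets borel" "AE t in \<nu>. t \<in> {0..1}"
        and mom: "\<And>j. (\<integral>t. t ^ j \<partial>\<nu>) = L ([:0, 1:] ^ j) / L 1" by blast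
    interpret n: finite_measure \<nu> by (rule n)
    show ?thesis
    proof (rule that[of "density \<nu> (\<lambda>_. ennreal (L 1))"])
      show "finite_measure (density \<nu> (\<lambda>_. ennreal (L 1)))"
        by (rule finite_measureI) (auto simp: emeasure_density nn_integral_cmult ennreal_mult_eq_top_iff)
      show "AE t in density \<nu> (\<lambda>_. ennreal (L 1)). t \<in> {0..1}"
        using n(3) by (subst AE_density) auto
      show "(\<integral>t. t ^ j \<partial>density \<nu> (\<lambda>_. ennreal (L 1))) = L ([:0, 1:] ^ j)" for j
        using mom[of j] False L1 n(2)
        by (subst integral_density) (auto simp: measurable_cong_sets[OF n(2) refl])
    qed (use n in simp)
  qed
  have "(\<integral>t. poly p t \<partial>\<nu>) = L p" for p
  proof -
    have "(\<integral>t. poly p t \<partial>\<nu>) = (\<integral>t. (\<Sum>i\<le>degree p. coeff p i * t ^ i) \<partial>\<nu>)"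
      by (simp add: poly_altdef)
    also have "\<dots> = (\<Sum>i\<le>degree p. coeff p i * L ([:0, 1:] ^ i))"
      using integrable_poly_bounded[OF \<nu>, of "monom 1 _"]
      by (subst Bochner_Integration.integral_sum) (auto simp: mom poly_monom)
    also have "\<dots> = L p" by (simp add: L_eq_coeffs[symmetric])
    finally show ?thesis .
  qed
  then show ?thesis by (rule that[OF \<nu>])
qed

section \<open>Semi-inner products on a carrier set\<close>

text \<open>Vectors form a carrier set rather than a type, and vectors of norm zero are allowed.  Only the
  inner product is constrained: equations between vectors are replaced by equality of their inner
  products with all vectors.  In this way matrices with the trace inner product and their completion
  are instances without a proof of the vector space laws.\<close>

locale semi_inner =
  fixes V :: "'a set" and vz :: 'a and va :: "'a \<Rightarrow> 'a \<Rightarrow> 'a" and vs :: "complex \<Rightarrow> 'a \<Rightarrow> 'a"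
    and ip :: "'a \<Rightarrow> 'a \<Rightarrow> complex"
  assumes vz [simp, intro]: "vz \<in> V"
    and va [simp, intro]: "u \<in> V \<Longrightarrow> v \<in> V \<Longrightarrow> va u v \<in> V"
    and vs [simp, intro]: "u \<in> V \<Longrightarrow> vs c u \<in> V"
    and ip_zero: "w \<in> V \<Longrightarrow> ip vz w = 0"
    and ip_add: "u \<in> V \<Longrightarrow> v \<in> V \<Longrightarrow> w \<in> V \<Longrightarrow> ip (va u v) w = ip u w + ip v w"
    and ip_scale: "u \<in> V \<Longrightarrow> w \<in> V \<Longrightarrow> ip (vs c u) w = c * ip u w"
    and ip_cnj: "u \<in> V \<Longrightarrow> v \<in> V \<Longrightarrow> ip v u = cnj (ip u v)"
    and ip_nonneg: "u \<in> V \<Longrightarrow> 0 \<le> Re (ip u u)"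
begin

lemma ip_add_right: "u \<in> V \<Longrightarrow> v \<in> V \<Longrightarrow> w \<in> V \<Longrightarrow> ip w (va u v) = ip w u + ip w v"
  using ip_add[of u v w] ip_cnj[of "va u v" w] ip_cnj[of u w] ip_cnj[of v w] by simp

lemma ip_scale_right: "u \<in> V \<Longrightarrow> w \<in> V \<Longrightarrow> ip w (vs c u) = cnj c * ip w u"
  using ip_scale[of u w c] ip_cnj[of "vs c u" w] ip_cnj[of u w] by simp

lemma ip_zero_right: "w \<in> V \<Longrightarrow> ip w vz = 0"
  using ip_zero[of w] ip_cnj[of vz w] by simp

lemmas ip_simps = ip_add ip_scale ip_zero ip_add_right ip_scale_right ip_zero_right

lemma ip_self_real: "u \<in> V \<Longrightarrow> ip u u = of_real (Re (ip u u))"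
  using ip_cnj[of u u] by (simp add: complex_eq_iff)

definition nrm :: "'a \<Rightarrow> real" where "nrm u = sqrt (Re (ip u u))"

definition dif :: "'a \<Rightarrow> 'a \<Rightarrow> 'a" where "dif u v = va u (vs (-1) v)"

lemma dif_closed [simp, intro]: "u \<in> V \<Longrightarrow> v \<in> V \<Longrightarrow> dif u v \<in> V"
  by (simp add: dif_def)

lemma ip_dif: "u \<in> V \<Longrightarrow> v \<in> V \<Longrightarrow> w \<in> V \<Longrightarrow> ip (dif u v) w = ip u w - ip v w"
  and ip_dif_right: "u \<in> V \<Longrightarrow> v \<in> V \<Longrightarrow> w \<in> V \<Longrightarrow> ip w (dif u v) = ip w u - ip w v"
  by (simp_all add: dif_def ip_simps)

lemma nrm_nonneg [simp]: "u \<in> V \<Longrightarrow> 0 \<le> nrm u"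
  by (simp add: nrm_def ip_nonneg)

lemma nrm_sq: "u \<in> V \<Longrightarrow> (nrm u)\<^sup>2 = Re (ip u u)"
  by (simp add: nrm_def ip_nonneg)

lemma Re_ip_commute: "u \<in> V \<Longrightarrow> v \<in> V \<Longrightarrow> Re (ip v u) = Re (ip u v)"
  using ip_cnj[of u v] by simp

lemma Cauchy_Schwarz:
  assumes u: "u \<in> V" and v: "v \<in> V"
  shows "cmod (ip u v) \<le> nrm u * nrm v"
proof -
  have quad: "0 \<le> Re (ip u u) - 2 * t * (cmod (ip u v))\<^sup>2 + t\<^sup>2 * (cmod (ip u v))\<^sup>2 * Re (ip v v)" for t :: real
  proof -
    \<comment> \<open>The phase of \<open>ip u v\<close> makes the mixed terms real.\<close>
    let ?k = "- (of_real t * ip u v)"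
    have "0 \<le> Re (ip (va u (vs ?k v)) (va u (vs ?k v)))"
      using u v by (intro ip_nonneg) auto
    also have "ip (va u (vs ?k v)) (va u (vs ?k v)) =
      ip u u - 2 * of_real t * (ip u v * cnj (ip u v)) + of_real (t\<^sup>2) * (ip u v * cnj (ip u v)) * ip v v"
      using u v by (simp add: ip_simps ip_cnj[OF u v] algebra_simps power2_eq_square)
    also have "Re \<dots> = Re (ip u u) - 2 * t * (cmod (ip u v))\<^sup>2 + t\<^sup>2 * (cmod (ip u v))\<^sup>2 * Re (ip v v)"
      unfolding complex_norm_square[symmetric] by (simp flip: of_real_mult of_real_power)
    finally show ?thesis .
  qed
  let ?a = "(cmod (ip u v))\<^sup>2"
  have "?a \<le> Re (ip u u) * Re (ip v v)"
  proof (cases "Re (ip v v) = 0")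
    case False
    then have pos: "Re (ip v v) > 0" using ip_nonneg[OF v] by simp
    have "0 \<le> Re (ip u u) - 2 * (1 / Re (ip v v)) * ?a + (1 / Re (ip v v))\<^sup>2 * ?a * Re (ip v v)"
      by (rule quad)
    also have "\<dots> = Re (ip u u) - ?a / Re (ip v v)"
      using pos by (simp add: power2_eq_square field_simps)
    finally show ?thesis using pos by (simp add: field_simps)
  next
    case True
    \<comment> \<open>For a null vector \<open>v\<close> the quadratic bound is affine in \<open>t\<close> and fails for large \<open>t\<close> unless \<open>?a = 0\<close>.\<close>
    have "?a = 0"
    proof (rule ccontr)
      assume "?a \<noteq> 0"
      then have a: "?a > 0" by simp
      have "0 \<le> Re (ip u u) - 2 * ((Re (ip u u) + 1) / ?a) * ?a"
        using quad[of "(Re (ip u u) + 1) / ?a"] True by simp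
      also have "\<dots> = - Re (ip u u) - 2" using a by simp
      finally show False using ip_nonneg[OF u] by simp
    qed
    with True show ?thesis by simp
  qed
  also have "\<dots> = (nrm u * nrm v)\<^sup>2"
    using u v by (simp add: power_mult_distrib nrm_sq)
  finally show ?thesis using u v by (simp add: power2_le_iff_abs_le)
qed

lemma nrm_add_le:
  assumes u: "u \<in> V" and v: "v \<in> V"
  shows "nrm (va u v) \<le> nrm u + nrm v"
proof -
  have "(nrm (va u v))\<^sup>2 = (nrm u)\<^sup>2 + (nrm v)\<^sup>2 + 2 * Re (ip u v)"
    using u v by (simp add: nrm_sq ip_simps Re_ip_commute)
  also have "\<dots> \<le> (nrm u)\<^sup>2 + (nrm v)\<^sup>2 + 2 * (nrm u * nrm v)"
    using complex_Re_le_cmod[of "ip u v"] Cauchy_Schwarz[OF u v] by simp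
  also have "\<dots> = (nrm u + nrm v)\<^sup>2" by (simp add: power2_eq_square algebra_simps)
  finally show ?thesis using u v by (simp add: power2_le_iff_abs_le)
qed

lemma nrm_cong: "u \<in> V \<Longrightarrow> v \<in> V \<Longrightarrow> (\<And>w. w \<in> V \<Longrightarrow> ip u w = ip v w) \<Longrightarrow> nrm u = nrm v"
  unfolding nrm_def by (metis Re_ip_commute)

lemma nrm_scale: "u \<in> V \<Longrightarrow> nrm (vs c u) = cmod c * nrm u"
proof -
  assume u: "u \<in> V"
  have "Re (ip (vs c u) (vs c u)) = (cmod c)\<^sup>2 * Re (ip u u)"
    using u by (simp add: ip_simps cmod_def power2_eq_square algebra_simps)
  then show ?thesis by (simp add: nrm_def real_sqrt_mult)
qed

lemma nrm_dif_commute: "u \<in> V \<Longrightarrow> v \<in> V \<Longrightarrow> nrm (dif u v) = nrm (dif v u)"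
  by (simp add: nrm_def ip_dif ip_dif_right Re_ip_commute)

lemma nrm_dif_triangle:
  assumes "u \<in> V" "v \<in> V" "w \<in> V"
  shows "nrm (dif u w) \<le> nrm (dif u v) + nrm (dif v w)"
proof -
  have "nrm (dif u w) = nrm (va (dif u v) (dif v w))"
    by (rule nrm_cong) (use assms in \<open>auto simp: ip_dif ip_add\<close>)
  then show ?thesis using nrm_add_le assms by simp
qed

lemma nrm_le_dif: "u \<in> V \<Longrightarrow> v \<in> V \<Longrightarrow> nrm u \<le> nrm (dif u v) + nrm v"
  using nrm_add_le[of "dif u v" v] nrm_cong[of u "va (dif u v) v"] by (simp add: ip_dif ip_add)

lemma nrm_dif_add:
  assumes "u \<in> V" "v \<in> V" "u' \<in> V" "v' \<in> V"
  shows "nrm (dif (va u v) (va u' v')) \<le> nrm (dif u u') + nrm (dif v v')"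
proof -
  have "nrm (dif (va u v) (va u' v')) = nrm (va (dif u u') (dif v v'))"
    by (rule nrm_cong) (use assms in \<open>auto simp: ip_dif ip_add\<close>)
  then show ?thesis using nrm_add_le assms by simp
qed

lemma nrm_dif_scale:
  assumes "u \<in> V" "v \<in> V"
  shows "nrm (dif (vs c u) (vs c v)) = cmod c * nrm (dif u v)"
proof -
  have "nrm (dif (vs c u) (vs c v)) = nrm (vs c (dif u v))"
    by (rule nrm_cong) (use assms in \<open>auto simp: ip_dif ip_scale algebra_simps\<close>)
  then show ?thesis using nrm_scale assms by simp
qed

lemma ip_dif_bound:
  assumes "u \<in> V" "v \<in> V" "u' \<in> V" "v' \<in> V"
  shows "cmod (ip u v - ip u' v') \<le> nrm (dif u u') * nrm v + nrm u' * nrm (dif v v')"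
proof -
  have "ip u v - ip u' v' = ip (dif u u') v + ip u' (dif v v')"
    using assms by (simp add: ip_dif ip_dif_right)
  also have "cmod \<dots> \<le> cmod (ip (dif u u') v) + cmod (ip u' (dif v v'))" by (rule norm_triangle_ineq)
  also have "\<dots> \<le> nrm (dif u u') * nrm v + nrm u' * nrm (dif v v')"
    using assms by (intro add_mono Cauchy_Schwarz) auto
  finally show ?thesis .
qed

text \<open>Spectral measures describe operators through their quadratic forms; this recovers the
  sesquilinear form, both for identities and for limits.\<close>

lemma polarization:
  assumes "\<And>u. u \<in> V \<Longrightarrow> A u \<in> V"
    and "\<And>u v. u \<in> V \<Longrightarrow> v \<in> V \<Longrightarrow> A (va u v) = va (A u) (A v)"
    and "\<And>c u. u \<in> V \<Longrightarrow> A (vs c u) = vs c (A u)"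
    and "u \<in> V" "v \<in> V"
  defines "q \<equiv> \<lambda>c. ip (A (va u (vs c v))) (va u (vs c v))"
  shows "ip (A u) v = (q 1 - q (-1) + \<i> * q \<i> - \<i> * q (-\<i>)) / 4"
  using assms(1,4,5) unfolding q_def by (simp add: assms(2,3) ip_simps algebra_simps)

lemma sesquilinear_eqI:
  assumes "\<And>u. u \<in> V \<Longrightarrow> A u \<in> V"
    and "\<And>u v. u \<in> V \<Longrightarrow> v \<in> V \<Longrightarrow> A (va u v) = va (A u) (A v)"
    and "\<And>c u. u \<in> V \<Longrightarrow> A (vs c u) = vs c (A u)"
    and "\<And>u. u \<in> V \<Longrightarrow> B u \<in> V"
    and "\<And>u v. u \<in> V \<Longrightarrow> v \<in> V \<Longrightarrow> B (va u v) = va (B u) (B v)"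
    and "\<And>c u. u \<in> V \<Longrightarrow> B (vs c u) = vs c (B u)"
    and "\<And>u. u \<in> V \<Longrightarrow> ip (A u) u = ip (B u) u"
    and "u \<in> V" "v \<in> V"
  shows "ip (A u) v = ip (B u) v"
  using polarization[OF assms(1-3) assms(8,9)] polarization[OF assms(4-6) assms(8,9)]
  unfolding assms(7)[OF va[OF assms(8) vs[OF assms(9)]]] by (rule trans[OF _ sym])

definition cvg :: "(nat \<Rightarrow> 'a) \<Rightarrow> 'a \<Rightarrow> bool" where
  "cvg X u \<longleftrightarrow> (\<lambda>n. nrm (dif (X n) u)) \<longlonglongrightarrow> 0"

lemma cvg_ip:
  assumes X: "cvg X u" "\<And>n. X n \<in> V" "u \<in> V" and Y: "cvg Y v" "\<And>n. Y n \<in> V" "v \<in> V"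
  shows "(\<lambda>n. ip (X n) (Y n)) \<longlonglongrightarrow> ip u v"
proof -
  have "(\<lambda>n. nrm (dif (X n) u) * (nrm (dif (Y n) v) + nrm v) + nrm u * nrm (dif (Y n) v)) \<longlonglongrightarrow> 0 * (0 + nrm v) + nrm u * 0"
    using X(1) Y(1) unfolding cvg_def by (intro tendsto_intros)
  then have "(\<lambda>n. nrm (dif (X n) u) * (nrm (dif (Y n) v) + nrm v) + nrm u * nrm (dif (Y n) v)) \<longlonglongrightarrow> 0"
    by simp
  moreover have "cmod (ip (X n) (Y n) - ip u v) \<le>
      nrm (dif (X n) u) * (nrm (dif (Y n) v) + nrm v) + nrm u * nrm (dif (Y n) v)" for n
  proof -
    have "cmod (ip (X n) (Y n) - ip u v) \<le> nrm (dif (X n) u) * nrm (Y n) + nrm u * nrm (dif (Y n) v)"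
      using X Y by (intro ip_dif_bound) auto
    also have "\<dots> \<le> nrm (dif (X n) u) * (nrm (dif (Y n) v) + nrm v) + nrm u * nrm (dif (Y n) v)"
      using X Y by (intro add_mono mult_left_mono nrm_le_dif) auto
    finally show ?thesis .
  qed
  ultimately have "(\<lambda>n. ip (X n) (Y n) - ip u v) \<longlonglongrightarrow> 0"
    by (intro Lim_null_comparison[of "\<lambda>n. ip (X n) (Y n) - ip u v"] always_eventually allI)
  then show ?thesis by (simp add: LIM_zero_iff)
qed

lemma cvg_const: "u \<in> V \<Longrightarrow> cvg (\<lambda>_. u) u"
  by (simp add: cvg_def nrm_def ip_dif ip_dif_right)

lemma cvg_ip_left:
  assumes "cvg X u" "\<And>n. X n \<in> V" "u \<in> V" "w \<in> V"
  shows "(\<lambda>n. ip (X n) w) \<longlonglongrightarrow> ip u w"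
  by (rule cvg_ip[OF assms(1-3) cvg_const]) (use assms in auto)

end

text \<open>Separation is stated in the form in which equations between vectors are derived: by comparing
  inner products.\<close>

locale chilbert = semi_inner "carr H" "hzero H" "hadd H" "hscale H" "hinner H" for H :: "'h hilbert" +
  assumes separated: "u \<in> carr H \<Longrightarrow> v \<in> carr H \<Longrightarrow> (\<And>w. w \<in> carr H \<Longrightarrow> hinner H u w = hinner H v w) \<Longrightarrow> u = v"
    and complete: "(\<And>n. X n \<in> carr H) \<Longrightarrow> (\<And>e. 0 < e \<Longrightarrow> \<exists>N. \<forall>m\<ge>N. \<forall>n\<ge>N. nrm (dif (X m) (X n)) < e) \<Longrightarrow>
       \<exists>u\<in>carr H. cvg X u"
begin

abbreviation "V \<equiv> carr H"
abbreviation "ip \<equiv> hinner H"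

lemma hnorm_eq: "hnorm H = nrm"
  by (rule ext) (simp add: hnorm_def nrm_def)

end

section \<open>Approximating indicator functions by polynomials\<close>

lemma poly_approx_continuous:
  fixes f :: "real \<Rightarrow> real"
  assumes "continuous_on {a..b} f" "0 < e"
  shows "\<exists>p. \<forall>t\<in>{a..b}. \<bar>poly p t - f t\<bar> < e"
proof -
  obtain g where g: "real_polynomial_function g" "\<And>t. t \<in> {a..b} \<Longrightarrow> \<bar>f t - g t\<bar> < e"
    using Stone_Weierstrass_real_polynomial_function[OF _ assms] by auto
  from g(1) obtain c n where gc: "g = (\<lambda>x. \<Sum>i\<le>n. c i * x ^ i)"
    by (auto simp: real_polynomial_function_iff_sum)
  have "poly (\<Sum>i\<le>n. monom (c i) i) t = g t" for t
    by (simp add: gc poly_sum poly_monom)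
  with g(2) show ?thesis by (metis abs_minus_commute)
qed

text \<open>Outer regularity for \<open>S\<close> and for its complement.\<close>

lemma squeeze_open_closed:
  fixes \<nu> :: "real measure"
  assumes "finite_measure \<nu>" "sets \<nu> = sets borel" "S \<in> sets borel" "0 < e"
  obtains U K where "open U" "closed K" "K \<subseteq> S" "S \<subseteq> U" "measure \<nu> (U - K) < e"
proof -
  interpret finite_measure \<nu> by fact
  have outer: "\<exists>U. open U \<and> S \<subseteq> U \<and> measure \<nu> U < measure \<nu> S + e / 2" if "S \<in> sets borel" for S
  proof -
    have "emeasure \<nu> S < ennreal (measure \<nu> S + e / 2)"
      using \<open>0 < e\<close> by (simp add: emeasure_eq_measure ennreal_less_iff)
    then have "(INF U\<in>{U. S \<subseteq> U \<and> open U}. emeasure \<nu> U) < ennreal (measure \<nu> S + e / 2)"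
      using outer_regular[OF assms(2) _ that] by (simp add: emeasure_eq_measure)
    then obtain U where "S \<subseteq> U" "open U" "emeasure \<nu> U < ennreal (measure \<nu> S + e / 2)"
      by (auto simp: INF_less_iff)
    then show ?thesis using \<open>0 < e\<close> by (auto simp: emeasure_eq_measure ennreal_less_iff simp del: ennreal_plus)
  qed
  obtain U where U: "open U" "S \<subseteq> U" "measure \<nu> U < measure \<nu> S + e / 2"
    using outer assms(3) by blast
  obtain W where W: "open W" "- S \<subseteq> W" "measure \<nu> W < measure \<nu> (- S) + e / 2"
    using outer[of "- S"] assms(3) by (auto simp: borel_comp)
  have "measure \<nu> (U - (- W)) \<le> measure \<nu> (U - S) + measure \<nu> (W - (- S))"
    by (rule order.trans[OF finite_measure_mono measure_subadditive])
      (use U(1) W(1) assms(2,3) in \<open>auto simp: emeasure_eq_measure\<close>)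
  also have "measure \<nu> (U - S) = measure \<nu> U - measure \<nu> S"
    using U assms(2,3) by (intro finite_measure_Diff) auto
  also have "measure \<nu> (W - (- S)) = measure \<nu> W - measure \<nu> (- S)"
    using W assms(2,3) by (intro finite_measure_Diff) auto
  finally have "measure \<nu> (U - (- W)) < e" using U(3) W(3) by simp
  then show ?thesis
    using U W by (intro that[of U "- W"]) auto
qed

text \<open>The set \<open>S\<close> lies between a closed and an open set whose difference has small mass; a Urysohn
  function of this pair is close to the indicator of \<open>S\<close>, and a polynomial is close to that function.
  A single polynomial for finitely many measures is what makes it possible to treat several vectors
  with the same sequence of polynomials of an operator.\<close>

lemma poly_approx_indicator:
  fixes \<nu> :: "'i \<Rightarrow> real measure"
  assumes F: "finite F"
    and \<nu>: "\<And>i. i \<in> F \<Longrightarrow> finite_measure (\<nu> i)" "\<And>i. i \<in> F \<Longrightarrow> sets (\<nu> i) = sets borel"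
      "\<And>i. i \<in> F \<Longrightarrow> AE t in \<nu> i. t \<in> {a..b}"
    and S: "S \<in> sets borel" and e: "0 < e"
  shows "\<exists>p. \<forall>i\<in>F. (\<integral>t. (poly p t - indicator S t)\<^sup>2 \<partial>\<nu> i) < e"
proof -
  have "\<exists>U K. open U \<and> closed K \<and> K \<subseteq> S \<and> S \<subseteq> U \<and> measure (\<nu> i) (U - K) < e / 4" if "i \<in> F" for i
    using squeeze_open_closed[OF \<nu>(1,2)[OF that] S, of "e / 4"] e by (metis zero_less_divide_iff zero_less_numeral)
  then obtain U K where UK: "\<And>i. i \<in> F \<Longrightarrow> open (U i) \<and> closed (K i) \<and> K i \<subseteq> S \<and> S \<subseteq> U i
      \<and> measure (\<nu> i) (U i - K i) < e / 4" by metis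
  define U' K' where "U' = (\<Inter>i\<in>F. U i)" and "K' = (\<Union>i\<in>F. K i)"
  have U': "open U'" "S \<subseteq> U'" and K': "closed K'" "K' \<subseteq> S"
    using UK F by (auto simp: U'_def K'_def intro!: open_INT closed_UN)
  obtain f :: "real \<Rightarrow> real" where f: "continuous_on UNIV f" "\<And>x. f x \<in> closed_segment 0 1"
    "\<And>x. x \<in> - U' \<Longrightarrow> f x = 0" "\<And>x. x \<in> K' \<Longrightarrow> f x = 1"
    by (rule Urysohn[of "- U'" K' 0 "1::real"]) (use U' K' in auto)
  have f01: "0 \<le> f x" "f x \<le> 1" for x
    using f(2)[of x] by (auto simp: closed_segment_eq_real_ivl)
  \<comment> \<open>The uniform approximation will contribute at most \<open>2 * (e / (4 * m)) * m = e / 2\<close> to the integral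
    and the set \<open>U i - K i\<close> less than \<open>2 * (e / 4) = e / 2\<close>.\<close>
  define m where "m = (\<Sum>i\<in>F. measure (\<nu> i) UNIV) + 1"
  have m: "m > 0" unfolding m_def by (intro add_nonneg_pos sum_nonneg) auto
  have "\<exists>p. \<forall>t\<in>{a..b}. \<bar>poly p t - f t\<bar> < sqrt (e / (4 * m))"
    using continuous_on_subset[OF f(1)] e m by (intro poly_approx_continuous) auto
  then obtain p where p: "\<And>t. t \<in> {a..b} \<Longrightarrow> \<bar>poly p t - f t\<bar> < sqrt (e / (4 * m))"
    by blast
  have "(\<integral>t. (poly p t - indicator S t)\<^sup>2 \<partial>\<nu> i) < e" if i: "i \<in> F" for i
  proof -
    interpret finite_measure "\<nu> i" by (rule \<nu>(1)[OF i])
    have [measurable]: "U i \<in> sets borel" "K i \<in> sets borel" using UK[OF i] by auto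
    have sp: "space (\<nu> i) = UNIV" using \<nu>(2)[OF i] by (metis sets_eq_imp_space_eq space_borel)
    have bound: "(poly p t - indicator S t)\<^sup>2 \<le> 2 * (e / (4 * m)) + 2 * indicator (U i - K i) t" if t: "t \<in> {a..b}" for t
    proof -
      have "(poly p t - indicator S t)\<^sup>2 \<le> 2 * (poly p t - f t)\<^sup>2 + 2 * (f t - indicator S t)\<^sup>2"
        using zero_le_power2[of "(poly p t - f t) - (f t - indicator S t)"]
        by (simp add: power2_eq_square algebra_simps)
      moreover have "(poly p t - f t)\<^sup>2 \<le> (sqrt (e / (4 * m)))\<^sup>2"
        using p[OF t] by (simp add: abs_le_square_iff[symmetric])
      moreover have "(sqrt (e / (4 * m)))\<^sup>2 = e / (4 * m)" using e m by simp
      moreover have "(f t - indicator S t)\<^sup>2 \<le> indicator (U i - K i) t"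
      proof (cases "t \<in> U i - K i")
        case True
        then show ?thesis using f01[of t] by (auto simp: indicator_def power_le_one abs_square_le_1)
      next
        case False
        then have "f t = indicator S t"
          using f(3)[of t] f(4)[of t] UK[OF i] i by (auto simp: U'_def K'_def indicator_def)
        with False show ?thesis by simp
      qed
      ultimately show ?thesis by linarith
    qed
    have "(\<integral>t. (poly p t - indicator S t)\<^sup>2 \<partial>\<nu> i) \<le> (\<integral>t. 2 * (e / (4 * m)) + 2 * indicator (U i - K i) t \<partial>\<nu> i)"
    proof (rule integral_mono_AE')
      show "AE t in \<nu> i. (poly p t - indicator S t)\<^sup>2 \<le> 2 * (e / (4 * m)) + 2 * indicator (U i - K i) t"
        using \<nu>(3)[OF i] by eventually_elim (rule bound)
      show "integrable (\<nu> i) (\<lambda>t. 2 * (e / (4 * m)) + 2 * indicator (U i - K i) t)"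
        using \<nu>(2)[OF i] by (intro Bochner_Integration.integrable_add integrable_const integrable_mult_right integrable_real_indicator)
          (auto simp: emeasure_eq_measure)
    qed (use e m in \<open>auto intro!: AE_I2 add_nonneg_nonneg mult_nonneg_nonneg\<close>)
    also have "\<dots> = 2 * (e / (4 * m)) * measure (\<nu> i) UNIV + 2 * measure (\<nu> i) (U i - K i)"
      using \<nu>(2)[OF i] by (subst Bochner_Integration.integral_add)
        (auto simp: sp emeasure_eq_measure intro!: integrable_mult_right integrable_real_indicator)
    also have "\<dots> < e / 2 + 2 * (e / 4)"
    proof (rule add_le_less_mono)
      have "measure (\<nu> i) UNIV \<le> (\<Sum>i\<in>F. measure (\<nu> i) UNIV)"
        using F i by (intro member_le_sum) auto
      then have "measure (\<nu> i) UNIV \<le> m" by (simp add: m_def)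
      then have "2 * (e / (4 * m)) * measure (\<nu> i) UNIV \<le> 2 * (e / (4 * m)) * m"
        using e m by (intro mult_left_mono) auto
      then show "2 * (e / (4 * m)) * measure (\<nu> i) UNIV \<le> e / 2" using m by simp
    qed (use UK[OF i] in auto)
    finally show ?thesis by simp
  qed
  then show ?thesis by blast
qed

text \<open>Convergence in \<open>L\<^sup>2\<close> implies convergence in \<open>L\<^sup>1\<close> for a finite measure, because of
  \<open>\<bar>x\<bar> \<le> d + x\<^sup>2 / d\<close> for every \<open>d > 0\<close>.\<close>

lemma (in finite_measure) integral_abs_tendsto_0:
  fixes f :: "nat \<Rightarrow> 'a \<Rightarrow> real"
  assumes f: "\<And>n. integrable M (f n)" "\<And>n. integrable M (\<lambda>t. (f n t)\<^sup>2)"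
    and lim: "(\<lambda>n. \<integral>t. (f n t)\<^sup>2 \<partial>M) \<longlonglongrightarrow> 0"
  shows "(\<lambda>n. \<integral>t. \<bar>f n t\<bar> \<partial>M) \<longlonglongrightarrow> 0"
proof (rule LIMSEQ_I)
  fix e :: real assume e: "0 < e"
  define d where "d = e / (2 * (measure M (space M) + 1))"
  have mpos: "measure M (space M) + 1 > 0" by (intro add_nonneg_pos) auto
  then have d: "d > 0" using e by (simp add: d_def)
  have dm: "d * measure M (space M) < e / 2 + 0"
  proof -
    have "d * measure M (space M) < d * (measure M (space M) + 1)" using d by simp
    also have "\<dots> = e / 2" using mpos by (simp add: d_def field_simps)
    finally show ?thesis by simp
  qed
  obtain N where N: "\<And>n. n \<ge> N \<Longrightarrow> \<bar>\<integral>t. (f n t)\<^sup>2 \<partial>M\<bar> < d * (e / 2)"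
    using LIMSEQ_D[OF lim, of "d * (e / 2)"] d e by auto
  have "norm ((\<integral>t. \<bar>f n t\<bar> \<partial>M) - 0) < e" if n: "n \<ge> N" for n
  proof -
    have "\<bar>x\<bar> \<le> d + x\<^sup>2 / d" for x :: real
    proof (cases "\<bar>x\<bar> \<le> d")
      case False
      then have "\<bar>x\<bar> * d \<le> \<bar>x\<bar> * \<bar>x\<bar>" by (intro mult_left_mono) auto
      then have "\<bar>x\<bar> \<le> x\<^sup>2 / d" using d by (simp add: field_simps power2_eq_square)
      then show ?thesis using d by simp
    qed (use d in \<open>simp add: add_increasing2\<close>)
    then have "(\<integral>t. \<bar>f n t\<bar> \<partial>M) \<le> (\<integral>t. d + (f n t)\<^sup>2 / d \<partial>M)"
      using f by (intro integral_mono) auto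
    also have "\<dots> = d * measure M (space M) + (\<integral>t. (f n t)\<^sup>2 \<partial>M) / d"
      using f by (subst Bochner_Integration.integral_add) auto
    also have "(\<integral>t. (f n t)\<^sup>2 \<partial>M) / d < e / 2"
      using N[OF n] d by (simp add: field_simps)
    finally have "(\<integral>t. \<bar>f n t\<bar> \<partial>M) < e" using dm by simp
    moreover have "0 \<le> (\<integral>t. \<bar>f n t\<bar> \<partial>M)" by simp
    ultimately show ?thesis by simp
  qed
  then show "\<exists>no. \<forall>n\<ge>no. norm ((\<integral>t. \<bar>f n t\<bar> \<partial>M) - 0) < e" by blast
qed

section \<open>The spectral theorem for bounded positive operators\<close>

text \<open>For \<open>a = p - \<chi>\<^sub>S\<close> and \<open>b = q - \<chi>\<^sub>R\<close> one has \<open>p q - \<chi>\<^bsub>S \<inter> R\<^esub> = a b + \<chi>\<^sub>R a + \<chi>\<^sub>S b\<close>; the bound is then small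
  in mean if \<open>a\<close> and \<open>b\<close> are.\<close>

lemma abs_product_bound:
  fixes a b r s :: real
  assumes "\<bar>r\<bar> \<le> 1" "\<bar>s\<bar> \<le> 1"
  shows "\<bar>a * b + r * a + s * b\<bar> \<le> (a\<^sup>2 + b\<^sup>2) + (\<bar>a\<bar> + \<bar>b\<bar>)"
proof -
  have "\<bar>a * b\<bar> \<le> a\<^sup>2 + b\<^sup>2"
    using zero_le_power2[of "\<bar>a\<bar> - \<bar>b\<bar>"] mult_nonneg_nonneg[of "\<bar>a\<bar>" "\<bar>b\<bar>"]
    unfolding power2_diff power2_abs abs_mult by linarith
  moreover have "\<bar>r * a\<bar> \<le> \<bar>a\<bar>" "\<bar>s * b\<bar> \<le> \<bar>b\<bar>"
    using assms by (simp_all add: abs_mult mult_left_le_one_le)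
  ultimately show ?thesis by linarith
qed

locale bounded_positive = chilbert H for H :: "'h hilbert" +
  fixes T :: "'h \<Rightarrow> 'h" and c :: real
  assumes T_closed [simp, intro]: "u \<in> V \<Longrightarrow> T u \<in> V"
    and T_sa: "u \<in> V \<Longrightarrow> v \<in> V \<Longrightarrow> ip (T u) v = ip u (T v)"
    and T_pos: "u \<in> V \<Longrightarrow> 0 \<le> Re (ip (T u) u)"
    and T_le: "u \<in> V \<Longrightarrow> Re (ip (T u) u) \<le> c * Re (ip u u)"
    and c_pos: "0 < c"
begin

text \<open>Linearity is a consequence of symmetry, as the inner product separates vectors.\<close>

lemma T_add: "u \<in> V \<Longrightarrow> v \<in> V \<Longrightarrow> T (hadd H u v) = hadd H (T u) (T v)"
  and T_scale: "u \<in> V \<Longrightarrow> T (hscale H k u) = hscale H k (T u)"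
  by (rule separated; simp add: T_sa ip_simps)+

lemma Tpow_closed [simp, intro]: "u \<in> V \<Longrightarrow> (T ^^ i) u \<in> V"
  by (induction i) auto

lemma Tpow_sa: "u \<in> V \<Longrightarrow> v \<in> V \<Longrightarrow> ip ((T ^^ i) u) v = ip u ((T ^^ i) v)"
proof (induction i arbitrary: u v)
  case (Suc i)
  have "ip ((T ^^ Suc i) u) v = ip ((T ^^ i) u) (T v)" using Suc.prems by (simp add: T_sa)
  also have "\<dots> = ip u ((T ^^ i) (T v))" using Suc by simp
  finally show ?case by (simp add: funpow_swap1)
qed simp

subsection \<open>Polynomials in the operator\<close>

text \<open>The vector \<open>p(T) u\<close> is defined by recursion, since a carrier set has no finite sums.  Computations
  are done with the number \<open>pform u w p = \<langle>p(T) u, w\<rangle>\<close> instead, which is an ordinary finite sum.\<close>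

primrec part_sum :: "real poly \<Rightarrow> 'h \<Rightarrow> nat \<Rightarrow> 'h" where
  "part_sum p u 0 = hzero H"
| "part_sum p u (Suc n) = hadd H (part_sum p u n) (hscale H (of_real (coeff p n)) ((T ^^ n) u))"

definition papp :: "real poly \<Rightarrow> 'h \<Rightarrow> 'h" where
  "papp p u = part_sum p u (Suc (degree p))"

definition pform :: "'h \<Rightarrow> 'h \<Rightarrow> real poly \<Rightarrow> complex" where
  "pform u w p = (\<Sum>i\<le>degree p. of_real (coeff p i) * ip ((T ^^ i) u) w)"

lemma part_sum_closed [simp, intro]: "u \<in> V \<Longrightarrow> part_sum p u n \<in> V"
  by (induction n) auto

lemma papp_closed [simp, intro]: "u \<in> V \<Longrightarrow> papp p u \<in> V"
  by (simp add: papp_def del: part_sum.simps)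

lemma ip_papp: 
  assumes "u \<in> V" "w \<in> V" 
  shows "ip (papp p u) w = pform u w p"
proof -
  have "ip (part_sum p u n) w = (\<Sum>i<n. of_real (coeff p i) * ip ((T ^^ i) u) w)" for n
    by (induction n) (use assms in \<open>auto simp: ip_simps\<close>)
  then show ?thesis by (simp add: papp_def pform_def lessThan_Suc_atMost del: part_sum.simps)
qed

lemma pform_eq:
  assumes "degree p \<le> n"
  shows "pform u w p = (\<Sum>i\<le>n. of_real (coeff p i) * ip ((T ^^ i) u) w)"
  unfolding pform_def by (rule sum.mono_neutral_left) (use assms in \<open>auto simp: coeff_eq_0\<close>)

lemma pform_add: "pform u w (p + q) = pform u w p + pform u w q"
  unfolding pform_eq[OF degree_add_le_max] pform_eq[OF max.cobounded1[of "degree p" "degree q"]]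
    pform_eq[OF max.cobounded2[of "degree q" "degree p"]]
  by (simp add: sum.distrib distrib_right)

lemma pform_smult: "pform u w (Polynomial.smult k p) = of_real k * pform u w p"
  by (simp add: pform_eq[OF degree_smult_le] pform_def sum_distrib_left mult.assoc)

lemma pform_0 [simp]: "pform u w 0 = 0"
  by (simp add: pform_def)

lemma pform_pCons: "pform u w (pCons a p) = of_real a * ip u w + pform (T u) w p"
proof -
  have "pform u w (pCons a p) = (\<Sum>i\<le>Suc (degree p). of_real (coeff (pCons a p) i) * ip ((T ^^ i) u) w)"
    by (rule pform_eq[OF degree_pCons_le])
  also have "\<dots> = of_real a * ip u w + pform (T u) w p"
    by (subst sum.atMost_Suc_shift) (simp add: pform_def funpow_swap1)
  finally show ?thesis .
qed

lemma pform_1 [simp]: "pform u w 1 = ip u w"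
  using pform_pCons[of u w 1 0] by (simp add: one_pCons)

lemma pform_diff: "pform u w (p - q) = pform u w p - pform u w q"
  using pform_add[of u w "p - q" q] by simp

lemma pform_cnj: 
  assumes "u \<in> V" "w \<in> V"
  shows "pform w u p = cnj (pform u w p)"
  unfolding pform_def cnj_sum
proof (intro sum.cong refl)
  fix i
  have "ip ((T ^^ i) w) u = ip w ((T ^^ i) u)" using assms by (simp add: Tpow_sa)
  also have "\<dots> = cnj (ip ((T ^^ i) u) w)" using assms by (intro ip_cnj) auto
  finally show "of_real (coeff p i) * ip ((T ^^ i) w) u = cnj (of_real (coeff p i) * ip ((T ^^ i) u) w)"
    by simp
qed

lemma ip_papp_papp:
  assumes "u \<in> V" "w \<in> V"
  shows "ip (papp p u) (papp q w) = pform u w (p * q)"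
proof -
  have right: "ip u (papp q w) = pform u w q" if "u \<in> V" for u
    using ip_cnj[of "papp q w" u] pform_cnj[of w u q] ip_papp[of w u q] that assms(2) by simp
  have "pform u (papp q w) p = pform u w (p * q)"
    using assms(1)
  proof (induction p arbitrary: u)
    case (pCons a p)
    then show ?case
      by (simp add: pform_pCons right pform_add pform_smult mult_pCons_left)
  qed simp
  then show ?thesis using assms by (simp add: ip_papp)
qed

lemma papp_papp: "u \<in> V \<Longrightarrow> papp q (papp p u) = papp (p * q) u"
proof (rule separated)
  fix w assume u: "u \<in> V" and w: "w \<in> V"
  have "ip (papp q (papp p u)) w = cnj (ip (papp q w) (papp p u))"
    using u w by (simp add: ip_papp pform_cnj[of w "papp p u" q])
  also have "ip (papp q w) (papp p u) = pform w u (q * p)"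
    using w u by (rule ip_papp_papp)
  also have "cnj \<dots> = ip (papp (p * q) u) w"
    using u w by (simp add: ip_papp pform_cnj[of u w] mult.commute[of q p])
  finally show "ip (papp q (papp p u)) w = ip (papp (p * q) u) w" .
qed auto

lemma pform_square: "u \<in> V \<Longrightarrow> pform (papp p u) (papp p u) g = pform u u (p * p * g)"
  using ip_papp[of "papp p u" "papp p u" g] ip_papp_papp[of u u "p * g" p]
  by (simp add: papp_papp mult_ac)

lemma pcompose_pow: "pcompose (p ^ n) q = pcompose p q ^ n" for p q :: "real poly"
  by (induction n) (simp_all add: pcompose_mult pcompose_1)

subsection \<open>Spectral measures of vectors\<close>

lemma pform_real: "u \<in> V \<Longrightarrow> pform u u p = of_real (Re (pform u u p))"
  using Reals_cnj_iff[THEN iffD2, OF pform_cnj[of u u p, symmetric]] by (simp add: of_real_Re)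

text \<open>Put \<open>x = T / c\<close> and \<open>y = 1 - T / c\<close>, both positive.  Even powers are squares of self-adjoint
  operators and can be moved to the vectors, so only \<open>1\<close>, \<open>x\<close>, \<open>y\<close> and \<open>x y\<close> remain.  The last one is
  positive because \<open>x + y = 1\<close> gives \<open>x y = x y x + y x y\<close>.\<close>

lemma pform_bernstein_nonneg:
  assumes u: "u \<in> V"
  defines "x \<equiv> [:0, 1 / c:]" and "y \<equiv> [:1, - 1 / c:]"
  shows "0 \<le> Re (pform u u (x ^ k * y ^ l))"
proof -
  have x: "0 \<le> Re (pform v v x)" and y: "0 \<le> Re (pform v v y)" if v: "v \<in> V" for v
    using T_pos[OF v] T_le[OF v] c_pos by (simp_all add: x_def y_def pform_pCons field_simps)
  have xy: "x + y = 1" by (simp add: x_def y_def one_pCons)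
  have "x * y = x * x * y + y * y * x"
  proof -
    have "x * y = (x * y) * (x + y)" by (simp add: xy)
    then show ?thesis by (simp add: algebra_simps)
  qed
  then have xy2: "0 \<le> Re (pform v v (x * y))" if v: "v \<in> V" for v
    using v x[of "papp y v"] y[of "papp x v"] by (simp add: pform_add pform_square)
  define p where "p = x ^ (k div 2) * y ^ (l div 2)"
  define g where "g = x ^ (k mod 2) * y ^ (l mod 2)"
  have "x ^ k * y ^ l = p * p * g"
  proof -
    have "x ^ k = x ^ (k div 2) * x ^ (k div 2) * x ^ (k mod 2)" "y ^ l = y ^ (l div 2) * y ^ (l div 2) * y ^ (l mod 2)"
      by (simp_all flip: power_add add: mult_2[symmetric])
    then show ?thesis by (simp add: p_def g_def mult_ac)
  qed
  moreover have g: "0 \<le> Re (pform v v g)" if "v \<in> V" for v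
  proof -
    have "k mod 2 = 0 \<or> k mod 2 = 1" "l mod 2 = 0 \<or> l mod 2 = 1" by auto
    then show ?thesis
      using x[OF that] y[OF that] xy2[OF that] ip_nonneg[OF that] by (elim disjE) (simp_all add: g_def)
  qed
  ultimately show ?thesis
    using g[OF papp_closed[OF u, of p]] unfolding pform_square[OF u] by simp
qed

text \<open>Hausdorff's theorem represents \<open>p \<mapsto> \<langle>p(T / c) u, u\<rangle>\<close> by a measure on \<open>[0, 1]\<close>, which is stretched to
  \<open>[0, c]\<close>.\<close>

lemma spectral_measure_exists:
  assumes u: "u \<in> V"
  shows "\<exists>\<nu>::real measure. finite_measure \<nu> \<and> sets \<nu> = sets borel \<and> (AE t in \<nu>. t \<in> {0..c}) \<and>
    (\<forall>p. (\<integral>t. poly p t \<partial>\<nu>) = Re (pform u u p))"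
proof -
  interpret L: hausdorff_functional "\<lambda>p. Re (pform u u (pcompose p [:0, 1 / c:]))"
  proof
    fix k l
    have "pcompose [:1, -1:] [:0, 1 / c:] = [:1, - 1 / c:]" "pcompose [:0, 1:] [:0, 1 / c:] = [:0, 1 / c:]"
      by (simp_all add: pcompose_pCons)
    then show "0 \<le> Re (pform u u (pcompose ([:0, 1:] ^ k * [:1, -1:] ^ l) [:0, 1 / c:]))"
      using pform_bernstein_nonneg[OF u, of k l] by (simp only: pcompose_mult pcompose_pow)
  qed (simp_all add: pcompose_add pcompose_smult pform_add pform_smult)
  obtain \<nu> :: "real measure" where \<nu>: "finite_measure \<nu>" "sets \<nu> = sets borel" "AE t in \<nu>. t \<in> {0..1}"
    and mom: "\<And>p. (\<integral>t. poly p t \<partial>\<nu>) = Re (pform u u (pcompose p [:0, 1 / c:]))"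
    by (rule L.representing_measure) (rule that, auto)
  have meas: "(\<lambda>t. c * t) \<in> \<nu> \<rightarrow>\<^sub>M borel"
    by (simp add: measurable_cong_sets[OF \<nu>(2) refl])
  let ?\<mu> = "distr \<nu> borel (\<lambda>t. c * t)"
  have "finite_measure ?\<mu>" by (rule finite_measure.finite_measure_distr[OF \<nu>(1) meas])
  moreover have "AE t in ?\<mu>. t \<in> {0..c}"
    using \<nu>(3) c_pos by (subst AE_distr_iff[OF meas]) (auto elim!: eventually_mono)
  moreover have "(\<integral>t. poly p t \<partial>?\<mu>) = Re (pform u u p)" for p
  proof -
    have "(\<integral>t. poly p t \<partial>?\<mu>) = (\<integral>t. poly p (c * t) \<partial>\<nu>)"
      by (rule integral_distr[OF meas]) (intro borel_measurable_continuous_onI continuous_intros)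
    also have "\<dots> = (\<integral>t. poly (pcompose p [:0, c:]) t \<partial>\<nu>)" by (simp add: poly_pcompose mult.commute)
    also have "\<dots> = Re (pform u u (pcompose (pcompose p [:0, c:]) [:0, 1 / c:]))" by (rule mom)
    also have "pcompose (pcompose p [:0, c:]) [:0, 1 / c:] = p"
      using c_pos by (simp add: pcompose_assoc[symmetric] pcompose_pCons)
    finally show ?thesis .
  qed
  ultimately show ?thesis by (intro exI[of _ ?\<mu>]) simp
qed

definition smeas :: "'h \<Rightarrow> real measure" where
  "smeas u = (SOME \<nu>. finite_measure \<nu> \<and> sets \<nu> = sets borel \<and> (AE t in \<nu>. t \<in> {0..c}) \<and>
    (\<forall>p. (\<integral>t. poly p t \<partial>\<nu>) = Re (pform u u p)))"

context
  fixes u assumes u: "u \<in> V"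
begin

lemma smeas:
  "finite_measure (smeas u)" "sets (smeas u) = sets borel" "AE t in smeas u. t \<in> {0..c}"
  "(\<integral>t. poly p t \<partial>smeas u) = Re (pform u u p)"
  using someI_ex[OF spectral_measure_exists[OF u]] unfolding smeas_def by blast+

lemma space_smeas: "space (smeas u) = UNIV"
  using sets_eq_imp_space_eq[OF smeas(2)] by simp

lemma integral_smeas: "of_real (\<integral>t. poly p t \<partial>smeas u) = pform u u p"
  by (simp add: smeas(4) pform_real[OF u, symmetric])

lemma measure_smeas_UNIV: "measure (smeas u) UNIV = Re (ip u u)"
  using smeas(4)[of 1] finite_measure.emeasure_eq_measure[OF smeas(1)] by (simp add: space_smeas)

end

subsection \<open>Spectral projections as limits of polynomials\<close>

text \<open>Convergence of the polynomials to the indicator of \<open>S\<close> in \<open>L\<^sup>2\<close> of the spectral measure of \<open>u\<close>.\<close>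

definition approx :: "real set \<Rightarrow> (nat \<Rightarrow> real poly) \<Rightarrow> 'h \<Rightarrow> bool" where
  "approx S p u \<longleftrightarrow> (\<lambda>n. \<integral>t. (poly (p n) t - indicator S t)\<^sup>2 \<partial>smeas u) \<longlonglongrightarrow> 0"

lemma approx_exists:
  assumes "finite F" "F \<subseteq> V" "S \<in> sets borel"
  shows "\<exists>p. \<forall>u\<in>F. approx S p u"
proof -
  have "\<exists>p. \<forall>u\<in>F. (\<integral>t. (poly p t - indicator S t)\<^sup>2 \<partial>smeas u) < 1 / real (Suc n)" for n
    using assms by (intro poly_approx_indicator[where a = 0 and b = c] smeas) auto
  then obtain p where p: "\<And>n u. u \<in> F \<Longrightarrow> (\<integral>t. (poly (p n) t - indicator S t)\<^sup>2 \<partial>smeas u) < 1 / real (Suc n)"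
    by metis
  have "approx S p u" if "u \<in> F" for u
    unfolding approx_def
    by (rule Lim_null_comparison[OF _ LIMSEQ_Suc[OF lim_1_over_n]])
      (use p[OF that] in \<open>auto intro!: always_eventually less_imp_le\<close>)
  then show ?thesis by blast
qed

lemma integrable_sq_diff:
  assumes u: "u \<in> V" and S: "S \<in> sets borel"
  shows "integrable (smeas u) (\<lambda>t. (poly p t - indicator S t)\<^sup>2)" "integrable (smeas u) (\<lambda>t. poly p t - indicator S t)"
    "integrable (smeas u) (indicator S :: real \<Rightarrow> real)" "integrable (smeas u) (\<lambda>t. poly p t * indicator S t)"
    "integrable (smeas u) (\<lambda>t. poly p t)"
proof -
  interpret finite_measure "smeas u" by (rule smeas[OF u])
  have S': "S \<in> sets (smeas u)" using S smeas(2)[OF u] by simp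
  have p: "integrable (smeas u) (poly p)" for p
    by (rule integrable_poly_bounded[OF smeas(1-3)[OF u]])
  show i: "integrable (smeas u) (indicator S :: real \<Rightarrow> real)"
    using S' by (intro integrable_real_indicator) (auto simp: emeasure_eq_measure)
  show pS: "integrable (smeas u) (\<lambda>t. poly p t * indicator S t)"
    using integrable_mult_indicator[OF S' p, of p] by (simp add: mult.commute)
  show "integrable (smeas u) (\<lambda>t. poly p t)" by (rule p)
  show "integrable (smeas u) (\<lambda>t. poly p t - indicator S t)"
    using p i by (rule Bochner_Integration.integrable_diff)
  have "integrable (smeas u) (\<lambda>t. poly (p * p) t - 2 * (poly p t * indicator S t) + indicator S t)"
    by (intro Bochner_Integration.integrable_add Bochner_Integration.integrable_diff p i integrable_mult_right pS)
  moreover have "(\<lambda>t. poly (p * p) t - 2 * (poly p t * indicator S t) + indicator S t) = (\<lambda>t. (poly p t - indicator S t)\<^sup>2)"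
    by (rule ext) (auto simp: indicator_def power2_eq_square algebra_simps)
  ultimately show "integrable (smeas u) (\<lambda>t. (poly p t - indicator S t)\<^sup>2)" by simp
qed

text \<open>The map \<open>p \<mapsto> p(T) u\<close> is isometric from \<open>L\<^sup>2\<close> of the spectral measure of \<open>u\<close>; hence approximating
  polynomials give Cauchy sequences of vectors with a common limit.\<close>

lemma nrm_papp_diff:
  assumes u: "u \<in> V" and S: "S \<in> sets borel"
  shows "(nrm (dif (papp p u) (papp q u)))\<^sup>2 \<le>
    2 * (\<integral>t. (poly p t - indicator S t)\<^sup>2 \<partial>smeas u) + 2 * (\<integral>t. (poly q t - indicator S t)\<^sup>2 \<partial>smeas u)"
proof -
  have "(nrm (dif (papp p u) (papp q u)))\<^sup>2 = Re (pform u u (p * p - q * p - (p * q - q * q)))"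
    unfolding pform_diff ip_papp_papp[OF u u, symmetric] using u by (simp add: nrm_sq ip_dif ip_dif_right)
  also have "\<dots> = Re (pform u u ((p - q) * (p - q)))"
    by (rule arg_cong[where f = "\<lambda>r. Re (pform u u r)"]) (simp add: algebra_simps)
  also have "\<dots> = (\<integral>t. poly ((p - q) * (p - q)) t \<partial>smeas u)" by (rule smeas(4)[OF u, symmetric])
  also have "\<dots> \<le> (\<integral>t. 2 * (poly p t - indicator S t)\<^sup>2 + 2 * (poly q t - indicator S t)\<^sup>2 \<partial>smeas u)"
  proof (rule integral_mono)
    fix t
    show "poly ((p - q) * (p - q)) t \<le> 2 * (poly p t - indicator S t)\<^sup>2 + 2 * (poly q t - indicator S t)\<^sup>2"
      using zero_le_power2[of "(poly p t - indicator S t) + (poly q t - indicator S t)"]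
      by (simp add: power2_eq_square algebra_simps)
    show "integrable (smeas u) (\<lambda>t. poly ((p - q) * (p - q)) t)" by (rule integrable_sq_diff(5)[OF u S])
  qed (use integrable_sq_diff[OF u S] in auto)
  also have "\<dots> = 2 * (\<integral>t. (poly p t - indicator S t)\<^sup>2 \<partial>smeas u) + 2 * (\<integral>t. (poly q t - indicator S t)\<^sup>2 \<partial>smeas u)"
    using integrable_sq_diff[OF u S] by simp
  finally show ?thesis .
qed

lemma approx_cvg:
  assumes u: "u \<in> V" and S: "S \<in> sets borel" and p: "approx S p u"
  shows "\<exists>v\<in>V. cvg (\<lambda>n. papp (p n) u) v"
proof (rule complete)
  fix e :: real assume e: "0 < e"
  let ?I = "\<lambda>n. \<integral>t. (poly (p n) t - indicator S t)\<^sup>2 \<partial>smeas u"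
  obtain N where N: "\<And>n. n \<ge> N \<Longrightarrow> \<bar>?I n\<bar> < e\<^sup>2 / 4"
    using LIMSEQ_D[OF p[unfolded approx_def], of "e\<^sup>2 / 4"] e by auto
  have "nrm (dif (papp (p m) u) (papp (p n) u)) < e" if "m \<ge> N" "n \<ge> N" for m n
  proof -
    have "(nrm (dif (papp (p m) u) (papp (p n) u)))\<^sup>2 < e\<^sup>2"
      using nrm_papp_diff[OF u S, of "p m" "p n"] N[OF that(1)] N[OF that(2)] by linarith
    then show ?thesis using e by (simp add: power_less_imp_less_base)
  qed
  then show "\<exists>N. \<forall>m\<ge>N. \<forall>n\<ge>N. nrm (dif (papp (p m) u) (papp (p n) u)) < e" by blast
qed (use u in auto)

text \<open>The choice of approximating polynomials does not affect the limit, see \<open>approx_cvg_proj\<close>.\<close>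

definition proj :: "real set \<Rightarrow> 'h \<Rightarrow> 'h" where
  "proj S u = (SOME v. v \<in> V \<and> (\<exists>p. approx S p u \<and> cvg (\<lambda>n. papp (p n) u) v))"

context
  fixes S :: "real set" assumes S: "S \<in> sets borel"
begin

lemma proj_ex:
  assumes u: "u \<in> V"
  shows "proj S u \<in> V" "\<exists>p. approx S p u \<and> cvg (\<lambda>n. papp (p n) u) (proj S u)"
proof -
  obtain p where "approx S p u" using approx_exists[of "{u}" S] u S by auto
  with approx_cvg[OF u S this] have "\<exists>v. v \<in> V \<and> (\<exists>p. approx S p u \<and> cvg (\<lambda>n. papp (p n) u) v)" by blast
  from someI_ex[OF this] show "proj S u \<in> V" "\<exists>p. approx S p u \<and> cvg (\<lambda>n. papp (p n) u) (proj S u)"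
    unfolding proj_def by blast+
qed

lemma approx_cvg_proj:
  assumes u: "u \<in> V" and q: "approx S q u"
  shows "cvg (\<lambda>n. papp (q n) u) (proj S u)"
proof -
  obtain p where p: "approx S p u" "cvg (\<lambda>n. papp (p n) u) (proj S u)"
    using proj_ex[OF u] by blast
  let ?I = "\<lambda>p n. \<integral>t. (poly (p n) t - indicator S t)\<^sup>2 \<partial>smeas u"
  have "(\<lambda>n. sqrt (2 * ?I q n + 2 * ?I p n)) \<longlonglongrightarrow> sqrt (2 * 0 + 2 * 0)"
    using p(1) q unfolding approx_def by (intro tendsto_intros)
  then have 1: "(\<lambda>n. sqrt (2 * ?I q n + 2 * ?I p n) + nrm (dif (papp (p n) u) (proj S u))) \<longlonglongrightarrow> 0"
    using p(2) unfolding cvg_def by (auto intro: tendsto_add_zero)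
  have "nrm (dif (papp (q n) u) (proj S u)) \<le> sqrt (2 * ?I q n + 2 * ?I p n) + nrm (dif (papp (p n) u) (proj S u))" for n
  proof -
    have "nrm (dif (papp (q n) u) (proj S u)) \<le> nrm (dif (papp (q n) u) (papp (p n) u)) + nrm (dif (papp (p n) u) (proj S u))"
      by (rule nrm_dif_triangle) (use u proj_ex in auto)
    moreover have "nrm (dif (papp (q n) u) (papp (p n) u)) \<le> sqrt (2 * ?I q n + 2 * ?I p n)"
      using nrm_papp_diff[OF u S] by (rule real_le_rsqrt)
    ultimately show ?thesis by simp
  qed
  then show ?thesis
    unfolding cvg_def by (intro Lim_null_comparison[OF always_eventually 1]) (use u proj_ex in auto)
qed

lemma proj_closed [simp, intro]: "u \<in> V \<Longrightarrow> proj S u \<in> V"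
  by (rule proj_ex)

text \<open>Polynomials in \<open>T\<close> are symmetric, and one sequence of polynomials approximates for both vectors.\<close>

lemma proj_sa:
  assumes u: "u \<in> V" and v: "v \<in> V"
  shows "ip (proj S u) v = ip u (proj S v)"
proof -
  obtain p where p: "approx S p u" "approx S p v"
    using approx_exists[of "{u, v}" S] u v S by auto
  have "(\<lambda>n. ip (papp (p n) u) v) \<longlonglongrightarrow> ip (proj S u) v"
    by (rule cvg_ip_left[OF approx_cvg_proj]) (use u v p in auto)
  moreover have "(\<lambda>n. cnj (ip (papp (p n) v) u)) \<longlonglongrightarrow> cnj (ip (proj S v) u)"
    by (intro tendsto_cnj cvg_ip_left[OF approx_cvg_proj]) (use u v p in auto)
  moreover have "cnj (ip (papp (p n) v) u) = ip (papp (p n) u) v" for n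
    using u v by (simp add: ip_papp pform_cnj[of v u])
  ultimately have "ip (proj S u) v = cnj (ip (proj S v) u)"
    by (auto intro: LIMSEQ_unique)
  then show ?thesis using ip_cnj[of "proj S v" u] u v by simp
qed

lemma proj_add: "u \<in> V \<Longrightarrow> v \<in> V \<Longrightarrow> proj S (hadd H u v) = hadd H (proj S u) (proj S v)"
  and proj_scale: "u \<in> V \<Longrightarrow> proj S (hscale H k u) = hscale H k (proj S u)"
  by (rule separated; simp add: proj_sa ip_simps)+

end

text \<open>By isometry, the inner product is the integral of the product of two indicators.  This one
  formula contains the norm, the idempotence and the multiplicativity of the projections.\<close>

lemma ip_proj_proj:
  assumes u: "u \<in> V" and S: "S \<in> sets borel" and R: "R \<in> sets borel"
  shows "ip (proj S u) (proj R u) = of_real (measure (smeas u) (S \<inter> R))"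
proof -
  interpret finite_measure "smeas u" by (rule smeas[OF u])
  obtain p where p: "approx S p u" using approx_exists[of "{u}" S] u S by auto
  obtain q where q: "approx R q u" using approx_exists[of "{u}" R] u R by auto
  let ?P = "\<lambda>n t. poly (p n) t - indicator S t" and ?Q = "\<lambda>n t. poly (q n) t - indicator R t"
  note iS = integrable_sq_diff[OF u S] and iR = integrable_sq_diff[OF u R]
  have P: "(\<lambda>n. \<integral>t. \<bar>?P n t\<bar> \<partial>smeas u) \<longlonglongrightarrow> 0"
    by (rule integral_abs_tendsto_0) (use iS p in \<open>auto simp: approx_def\<close>)
  have Q: "(\<lambda>n. \<integral>t. \<bar>?Q n t\<bar> \<partial>smeas u) \<longlonglongrightarrow> 0"
    by (rule integral_abs_tendsto_0) (use iR q in \<open>auto simp: approx_def\<close>)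
  have SR: "S \<inter> R \<in> sets (smeas u)" using S R smeas(2)[OF u] by simp
  have intSR: "integrable (smeas u) (indicator (S \<inter> R) :: real \<Rightarrow> real)"
    using S R by (intro integrable_sq_diff(3)[OF u]) auto
  have "(\<lambda>n. \<integral>t. poly (p n * q n) t \<partial>smeas u) \<longlonglongrightarrow> measure (smeas u) (S \<inter> R)"
  proof (rule LIM_zero_cancel, rule Lim_null_comparison[OF always_eventually[OF allI]])
    have "(\<lambda>n. ((\<integral>t. (?P n t)\<^sup>2 \<partial>smeas u) + (\<integral>t. (?Q n t)\<^sup>2 \<partial>smeas u)) + ((\<integral>t. \<bar>?P n t\<bar> \<partial>smeas u) + (\<integral>t. \<bar>?Q n t\<bar> \<partial>smeas u)))
        \<longlonglongrightarrow> (0 + 0) + (0 + 0)"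
      using p q P Q unfolding approx_def by (intro tendsto_add)
    then show "(\<lambda>n. ((\<integral>t. (?P n t)\<^sup>2 \<partial>smeas u) + (\<integral>t. (?Q n t)\<^sup>2 \<partial>smeas u)) + ((\<integral>t. \<bar>?P n t\<bar> \<partial>smeas u) + (\<integral>t. \<bar>?Q n t\<bar> \<partial>smeas u)))
        \<longlonglongrightarrow> 0" by simp
    fix n
    have "(\<integral>t. poly (p n * q n) t \<partial>smeas u) - measure (smeas u) (S \<inter> R) =
      (\<integral>t. poly (p n * q n) t - indicator (S \<inter> R) t \<partial>smeas u)"
      using SR by (subst Bochner_Integration.integral_diff[OF iS(5) intSR]) (simp_all add: space_smeas[OF u])
    also have "norm \<dots> \<le> (\<integral>t. norm (poly (p n * q n) t - indicator (S \<inter> R) t) \<partial>smeas u)"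
      by (rule integral_norm_bound)
    also have "\<dots> \<le> (\<integral>t. ((?P n t)\<^sup>2 + (?Q n t)\<^sup>2) + (\<bar>?P n t\<bar> + \<bar>?Q n t\<bar>) \<partial>smeas u)"
    proof (rule integral_mono)
      fix t
      have "poly (p n * q n) t - indicator (S \<inter> R) t = ?P n t * ?Q n t + indicator R t * ?P n t + indicator S t * ?Q n t"
        by (simp add: indicator_inter_arith algebra_simps)
      also have "\<bar>\<dots>\<bar> \<le> ((?P n t)\<^sup>2 + (?Q n t)\<^sup>2) + (\<bar>?P n t\<bar> + \<bar>?Q n t\<bar>)"
        by (rule abs_product_bound) (auto simp: indicator_def)
      finally show "norm (poly (p n * q n) t - indicator (S \<inter> R) t) \<le> ((?P n t)\<^sup>2 + (?Q n t)\<^sup>2) + (\<bar>?P n t\<bar> + \<bar>?Q n t\<bar>)"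
        by simp
      show "integrable (smeas u) (\<lambda>t. norm (poly (p n * q n) t - indicator (S \<inter> R) t))"
        by (intro integrable_norm Bochner_Integration.integrable_diff iS(5) intSR)
    qed (use iS iR in auto)
    also have "\<dots> = ((\<integral>t. (?P n t)\<^sup>2 \<partial>smeas u) + (\<integral>t. (?Q n t)\<^sup>2 \<partial>smeas u)) + ((\<integral>t. \<bar>?P n t\<bar> \<partial>smeas u) + (\<integral>t. \<bar>?Q n t\<bar> \<partial>smeas u))"
      using iS iR by simp
    finally show "norm ((\<integral>t. poly (p n * q n) t \<partial>smeas u) - measure (smeas u) (S \<inter> R)) \<le>
      ((\<integral>t. (?P n t)\<^sup>2 \<partial>smeas u) + (\<integral>t. (?Q n t)\<^sup>2 \<partial>smeas u)) + ((\<integral>t. \<bar>?P n t\<bar> \<partial>smeas u) + (\<integral>t. \<bar>?Q n t\<bar> \<partial>smeas u))" .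
  qed
  then have "(\<lambda>n. of_real (\<integral>t. poly (p n * q n) t \<partial>smeas u)) \<longlonglongrightarrow> complex_of_real (measure (smeas u) (S \<inter> R))"
    by (rule tendsto_of_real)
  then have "(\<lambda>n. ip (papp (p n) u) (papp (q n) u)) \<longlonglongrightarrow> complex_of_real (measure (smeas u) (S \<inter> R))"
    by (simp only: integral_smeas[OF u] ip_papp_papp[OF u u])
  moreover have "(\<lambda>n. ip (papp (p n) u) (papp (q n) u)) \<longlonglongrightarrow> ip (proj S u) (proj R u)"
    by (rule cvg_ip) (use u S R p q in \<open>auto intro: approx_cvg_proj\<close>)
  ultimately show ?thesis by (rule LIMSEQ_unique[symmetric])
qed

lemma proj_UNIV:
  assumes u: "u \<in> V"
  shows "proj UNIV u = u"
proof (rule separated)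
  fix w assume w: "w \<in> V"
  have "approx UNIV (\<lambda>_. 1) u" by (simp add: approx_def)
  from approx_cvg_proj[OF _ u this] have "cvg (\<lambda>n. papp 1 u) (proj UNIV u)" by simp
  from cvg_ip_left[OF this _ _ w] have "(\<lambda>n. ip (papp 1 u) w) \<longlonglongrightarrow> ip (proj UNIV u) w" using u by auto
  then show "ip (proj UNIV u) w = ip u w"
    using u w by (simp add: ip_papp LIMSEQ_const_iff)
qed (use u in auto)

lemma ip_proj_self:
  assumes u: "u \<in> V" and S: "S \<in> sets borel"
  shows "ip (proj S u) u = of_real (measure (smeas u) S)"
  using ip_proj_proj[OF u S, of UNIV] by (simp add: proj_UNIV u)

text \<open>On the diagonal, both sides are the spectral mass of \<open>S \<inter> R\<close>.\<close>

lemma proj_Int: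
  assumes u: "u \<in> V" and S: "S \<in> sets borel" and R: "R \<in> sets borel"
  shows "proj (S \<inter> R) u = proj S (proj R u)"
proof (rule separated)
  fix w assume w: "w \<in> V"
  have SR: "S \<inter> R \<in> sets borel" using S R by auto
  show "ip (proj (S \<inter> R) u) w = ip (proj S (proj R u)) w"
  proof (rule sesquilinear_eqI[OF _ _ _ _ _ _ _ u w])
    fix v assume v: "v \<in> V"
    have "ip (proj S (proj R v)) v = ip (proj R v) (proj S v)"
      using v S R by (simp add: proj_sa)
    then show "ip (proj (S \<inter> R) v) v = ip (proj S (proj R v)) v"
      using ip_proj_self[OF v SR] ip_proj_proj[OF v R S] by (simp add: Int_commute)
  qed (use S R SR in \<open>auto simp: proj_add proj_scale\<close>)
qed (use u S R in auto)

end

subsection \<open>Existence of the spectral resolution\<close>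

context bounded_positive
begin

lemma nrm_proj_le:
  assumes u: "u \<in> V" and S: "S \<in> sets borel"
  shows "nrm (proj S u) \<le> nrm u"
proof -
  interpret finite_measure "smeas u" by (rule smeas[OF u])
  have "(nrm (proj S u))\<^sup>2 = measure (smeas u) S"
    using u S ip_proj_proj[OF u S S] by (simp add: nrm_sq)
  also have "\<dots> \<le> measure (smeas u) UNIV"
    using smeas(2)[OF u] by (intro finite_measure_mono) auto
  also have "\<dots> = (nrm u)\<^sup>2" by (simp add: measure_smeas_UNIV u nrm_sq)
  finally show ?thesis using u S by (simp add: power2_le_iff_abs_le)
qed

text \<open>On the diagonal this is countable additivity of spectral measures; polarization extends it.\<close>

lemma proj_sums:
  fixes S :: "nat \<Rightarrow> real set"
  assumes S: "range S \<subseteq> sets borel" "disjoint_family S" and u: "u \<in> V" and v: "v \<in> V"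
  shows "(\<lambda>i. ip (proj (S i) u) v) sums ip (proj (\<Union>i. S i) u) v"
proof -
  have Si: "S i \<in> sets borel" for i using S by auto
  have SU: "(\<Union>i. S i) \<in> sets borel" using Si by auto
  have diag: "(\<lambda>i. ip (proj (S i) w) w) sums ip (proj (\<Union>i. S i) w) w" if w: "w \<in> V" for w
  proof -
    interpret finite_measure "smeas w" by (rule smeas[OF w])
    have "(\<lambda>i. measure (smeas w) (S i)) sums measure (smeas w) (\<Union>i. S i)"
      using S smeas(2)[OF w] by (intro finite_measure_UNION) auto
    then show ?thesis by (simp add: ip_proj_self[OF w] Si SU sums_of_real)
  qed
  have pol: "ip (proj R u) v =
    (ip (proj R (hadd H u (hscale H 1 v))) (hadd H u (hscale H 1 v)) - ip (proj R (hadd H u (hscale H (-1) v))) (hadd H u (hscale H (-1) v))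
     + \<i> * ip (proj R (hadd H u (hscale H \<i> v))) (hadd H u (hscale H \<i> v)) - \<i> * ip (proj R (hadd H u (hscale H (-\<i>) v))) (hadd H u (hscale H (-\<i>) v))) / 4"
    if "R \<in> sets borel" for R
    by (rule polarization[where A = "proj R"]) (use that u v in \<open>auto simp: proj_add proj_scale\<close>)
  show ?thesis
    unfolding pol[OF Si] pol[OF SU] using u v
    by (intro sums_divide sums_diff sums_add sums_mult diag) auto
qed

lemma scalar_spectral_measure_proj:
  assumes u: "u \<in> V"
  shows "scalar_spectral_measure H (\<lambda>S. restrict (proj S) V) u = smeas u"
proof -
  interpret finite_measure "smeas u" by (rule smeas[OF u])
  have "scalar_spectral_measure H (\<lambda>S. restrict (proj S) V) u = measure_of UNIV (sets borel) (emeasure (smeas u))"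
    unfolding scalar_spectral_measure_def
    by (rule measure_of_eq) (use u in \<open>auto simp: ip_proj_self emeasure_eq_measure sets.sigma_sets_eq[of borel, simplified]\<close>)
  also have "\<dots> = smeas u"
    using measure_of_of_measure[of "smeas u"] by (simp add: smeas(2)[OF u] space_smeas[OF u])
  finally show ?thesis .
qed

lemma spectral_resolution_proj: "spectral_resolution H T (\<lambda>S. restrict (proj S) V)"
proof -
  have bops: "restrict (proj S) V \<in> bounded_ops H" if "S \<in> sets borel" for S
    unfolding bounded_ops_def using that nrm_proj_le
    by (auto simp: proj_add proj_scale hnorm_eq intro!: exI[of _ 1])
  have sa: "self_adjoint_op H (restrict (proj S) V)" if "S \<in> sets borel" for S
    using that by (simp add: self_adjoint_op_def proj_sa)
  have idem: "proj S (proj S u) = proj S u" if "S \<in> sets borel" "u \<in> V" for S u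
    using proj_Int[of u S S] that by simp
  have emp: "proj {} u = hzero H" if u: "u \<in> V" for u
  proof (rule separated)
    fix w assume w: "w \<in> V"
    have "ip (proj {} u) (proj {} u) = 0" using ip_proj_proj[OF u, of "{}" "{}"] by simp
    then have "cmod (ip (proj {} u) w) \<le> 0"
      using Cauchy_Schwarz[of "proj {} u" w] u w by (simp add: nrm_def)
    then show "ip (proj {} u) w = ip (hzero H) w" using w by (simp add: ip_zero)
  qed (use u in auto)
  \<comment> \<open>The open interval has to contain \<open>[0, c]\<close>, which carries the spectral measures.\<close>
  have supp: "proj {-(c+1)<..<c+1} u = u" if u: "u \<in> V" for u
  proof (rule separated)
    fix w assume w: "w \<in> V"
    show "ip (proj {-(c+1)<..<c+1} u) w = ip u w"
    proof (rule sesquilinear_eqI[where B = "\<lambda>u. u", OF _ _ _ _ _ _ _ u w])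
      fix v assume v: "v \<in> V"
      interpret finite_measure "smeas v" by (rule smeas[OF v])
      have "measure (smeas v) {-(c+1)<..<c+1} = measure (smeas v) UNIV"
      proof (rule finite_measure_eq_AE)
        show "AE t in smeas v. (t \<in> {-(c+1)<..<c+1}) = (t \<in> UNIV)"
          using smeas(3)[OF v] by eventually_elim (use c_pos in auto)
      qed (use smeas(2)[OF v] in auto)
      then show "ip (proj {-(c+1)<..<c+1} v) v = ip v v"
        using v by (simp add: ip_proj_self measure_smeas_UNIV ip_self_real[symmetric])
    qed (auto simp: proj_add proj_scale)
  qed (use u in auto)
  have mom: "integrable (smeas u) (\<lambda>t. t) \<and> ip (T u) u = of_real (\<integral>t. t \<partial>smeas u)" if u: "u \<in> V" for u
    using integrable_sq_diff(5)[OF u, of UNIV "[:0, 1:]"] integral_smeas[OF u, of "[:0, 1:]"] by (simp add: pform_pCons)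
  have mult: "proj (S \<inter> R) u = proj S (proj R u)" if "S \<in> sets borel" "R \<in> sets borel" "u \<in> V" for S R u
    by (rule proj_Int) (use that in auto)
  have sums: "(\<lambda>i. ip (proj (S i) u) v) sums ip (proj (\<Union>i. S i) u) v"
    if "range S \<subseteq> sets borel" "disjoint_family S" "u \<in> V" "v \<in> V" for S u v
    by (rule proj_sums) (use that in auto)
  show ?thesis
    unfolding spectral_resolution_def projection_valued_measure_def
  proof (intro conjI ballI allI impI)
    show "\<exists>a. \<forall>u\<in>V. restrict (proj {-a<..<a}) V u = u"
      by (intro exI[of _ "c + 1"]) (simp add: supp del: minus_add_distrib)
  qed (simp_all add: bops sa idem emp mom mult sums scalar_spectral_measure_proj)
qed

subsection \<open>Uniqueness of the spectral resolution\<close>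

context
  fixes P assumes P: "spectral_resolution H T P"
begin

lemma res_bounded_ops: "S \<in> sets borel \<Longrightarrow> P S \<in> bounded_ops H"
  using P by (auto simp: spectral_resolution_def projection_valued_measure_def)

lemma res_closed [simp, intro]: "S \<in> sets borel \<Longrightarrow> u \<in> V \<Longrightarrow> P S u \<in> V"
  using res_bounded_ops[of S] by (auto simp: bounded_ops_def)

lemma res_add: "S \<in> sets borel \<Longrightarrow> u \<in> V \<Longrightarrow> v \<in> V \<Longrightarrow> P S (hadd H u v) = hadd H (P S u) (P S v)"
  and res_scale: "S \<in> sets borel \<Longrightarrow> u \<in> V \<Longrightarrow> P S (hscale H k u) = hscale H k (P S u)"
  using res_bounded_ops[of S] by (auto simp: bounded_ops_def)

lemma res_sa: "S \<in> sets borel \<Longrightarrow> u \<in> V \<Longrightarrow> v \<in> V \<Longrightarrow> ip (P S u) v = ip u (P S v)"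
  using P by (auto simp: spectral_resolution_def projection_valued_measure_def self_adjoint_op_def)

lemma res_empty: "u \<in> V \<Longrightarrow> P {} u = hzero H"
  and res_Int: "S \<in> sets borel \<Longrightarrow> R \<in> sets borel \<Longrightarrow> u \<in> V \<Longrightarrow> P S (P R u) = P (S \<inter> R) u"
  and res_sums: "range A \<subseteq> sets borel \<Longrightarrow> disjoint_family A \<Longrightarrow> u \<in> V \<Longrightarrow> v \<in> V \<Longrightarrow>
    (\<lambda>i. ip (P (A i) u) v) sums ip (P (\<Union>i. A i) u) v"
  using P by (auto simp: spectral_resolution_def projection_valued_measure_def)

lemma res_UNIV: 
  assumes u: "u \<in> V"
  shows "P UNIV u = u"
proof -
  have "\<exists>a. \<forall>u\<in>V. P {-a<..<a} u = u"
    using P unfolding spectral_resolution_def projection_valued_measure_def by blast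
  then obtain a where a: "\<And>u. u \<in> V \<Longrightarrow> P {-a<..<a} u = u" by blast
  have "P UNIV (P {-a<..<a} u) = P {-a<..<a} u" using u by (subst res_Int) auto
  then show ?thesis using a[OF u] by simp
qed

text \<open>Finite additivity for \<open>S\<close> and its complement, extracted from countable additivity.\<close>

lemma res_compl: "S \<in> sets borel \<Longrightarrow> u \<in> V \<Longrightarrow> v \<in> V \<Longrightarrow> ip (P S u) v + ip (P (- S) u) v = ip u v"
proof -
  assume a: "S \<in> sets borel" "u \<in> V" "v \<in> V"
  have S: "- S \<in> sets borel" using a by (auto simp: borel_comp)
  have "(\<lambda>i. ip (P (binaryset S (- S) i) u) v) sums ip (P (\<Union>i. binaryset S (- S) i) u) v"
    by (rule res_sums) (use a S in \<open>auto simp: disjoint_family_on_def binaryset_def\<close>)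
  moreover have "(\<lambda>i. ip (P (binaryset S (- S) i) u) v) sums (ip (P S u) v + ip (P (- S) u) v)"
    by (rule binaryset_sums[of "\<lambda>A. ip (P A u) v"]) (use a in \<open>simp add: res_empty ip_zero\<close>)
  ultimately show ?thesis
    using a by (simp add: UN_binaryset_eq res_UNIV sums_unique2)
qed

lemma res_self:
  assumes S: "S \<in> sets borel" and u: "u \<in> V"
  shows "ip (P S u) u = of_real ((nrm (P S u))\<^sup>2)"
proof -
  have x: "P S u \<in> V" using S u by auto
  have "ip (P S u) u = ip (P S (P S u)) u" using S u by (simp add: res_Int)
  also have "\<dots> = ip (P S u) (P S u)" by (rule res_sa[OF S x u])
  also have "\<dots> = of_real ((nrm (P S u))\<^sup>2)" unfolding nrm_sq[OF x] by (rule ip_self_real[OF x])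
  finally show ?thesis .
qed

lemma res_measure:
  assumes u: "u \<in> V"
  shows "sets (scalar_spectral_measure H P u) = sets borel"
    "finite_measure (scalar_spectral_measure H P u)"
    "S \<in> sets borel \<Longrightarrow> measure (scalar_spectral_measure H P u) S = (nrm (P S u))\<^sup>2"
proof -
  let ?M = "scalar_spectral_measure H P u"
  show sets: "sets ?M = sets borel"
    unfolding scalar_spectral_measure_def using sets.sigma_sets_eq[of "borel::real measure"] by simp
  have em: "emeasure ?M S = ennreal ((nrm (P S u))\<^sup>2)" if S: "S \<in> sets borel" for S
  proof -
    have "emeasure ?M S = ennreal (Re (ip (P S u) u))"
      unfolding scalar_spectral_measure_def
    proof (rule emeasure_measure_of_sigma[OF _ _ _ S])
      show "sigma_algebra UNIV (sets (borel::real measure))"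
        using sets.sigma_algebra_axioms[of "borel::real measure"] by simp
      show "positive (sets borel) (\<lambda>S. ennreal (Re (ip (P S u) u)))"
        using u by (simp add: positive_def res_empty ip_zero)
      show "countably_additive (sets borel) (\<lambda>S. ennreal (Re (ip (P S u) u)))"
      proof (rule countably_additiveI)
        fix A :: "nat \<Rightarrow> real set"
        assume A: "range A \<subseteq> sets borel" "disjoint_family A" "\<Union> (range A) \<in> sets borel"
        have "(\<lambda>i. Re (ip (P (A i) u) u)) sums Re (ip (P (\<Union> (range A)) u) u)"
          using res_sums[OF A(1,2) u u] by (rule sums_Re)
        moreover have "0 \<le> Re (ip (P (A i) u) u)" for i
          using A(1) u by (subst res_self) auto
        ultimately show "(\<Sum>i. ennreal (Re (ip (P (A i) u) u))) = ennreal (Re (ip (P (\<Union> (range A)) u) u))"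
          by (intro suminf_ennreal_eq) auto
      qed
    qed
    then show ?thesis by (simp add: res_self[OF S u])
  qed
  show "finite_measure ?M"
    by (rule finite_measureI) (use em[of UNIV] sets_eq_imp_space_eq[OF sets] in simp)
  show "S \<in> sets borel \<Longrightarrow> measure ?M S = (nrm (P S u))\<^sup>2"
    by (simp add: measure_def em)
qed

lemma res_integral:
  assumes u: "u \<in> V"
  shows "integrable (scalar_spectral_measure H P u) (\<lambda>t. t)"
    "ip (T u) u = of_real (\<integral>t. t \<partial>scalar_spectral_measure H P u)"
  using P u by (auto simp: spectral_resolution_def)

lemma space_res: "u \<in> V \<Longrightarrow> space (scalar_spectral_measure H P u) = UNIV"
  using sets_eq_imp_space_eq[OF res_measure(1)] by simp

lemma res_AE:
  assumes u: "u \<in> V" and S: "S \<in> sets borel" and "P S u = u"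
  shows "AE t in scalar_spectral_measure H P u. t \<in> S"
proof -
  let ?M = "scalar_spectral_measure H P u"
  interpret finite_measure ?M by (rule res_measure[OF u])
  have S': "- S \<in> sets borel" using S by (auto simp: borel_comp)
  have "P (- S) u = hzero H"
    using res_Int[OF S' S u] assms(3) by (simp add: res_empty u)
  then have "- S \<in> null_sets ?M"
    using S' res_measure(1,3)[OF u] by (simp add: null_sets_def emeasure_eq_measure nrm_def ip_zero)
  then show ?thesis
    by (rule AE_I') (auto simp: space_res[OF u])
qed

text \<open>The spectral measure of a vector in the range of \<open>P {..a}\<close> lives on \<open>{..a}\<close>, and its mean is the
  value of the form of \<open>T\<close>.\<close>

lemma res_upper:
  assumes u: "u \<in> V" and "P {..a} u = u"
  shows "Re (ip (T u) u) \<le> a * (nrm u)\<^sup>2"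
proof -
  let ?M = "scalar_spectral_measure H P u"
  interpret finite_measure ?M by (rule res_measure[OF u])
  have "Re (ip (T u) u) = (\<integral>t. t \<partial>?M)" using res_integral[OF u] by simp
  also have "\<dots> \<le> (\<integral>t. a \<partial>?M)"
    using res_AE[OF u _ assms(2)] res_integral(1)[OF u] by (intro integral_mono_AE) auto
  also have "\<dots> = a * (nrm u)\<^sup>2"
    using res_measure(3)[OF u, of UNIV] by (simp add: space_res[OF u] res_UNIV[OF u] mult.commute)
  finally show ?thesis .
qed

lemma res_lower:
  assumes u: "u \<in> V" and "P {b<..} u = u"
  shows "b * (nrm u)\<^sup>2 \<le> Re (ip (T u) u)"
proof -
  let ?M = "scalar_spectral_measure H P u"
  interpret finite_measure ?M by (rule res_measure[OF u])
  have "b * (nrm u)\<^sup>2 = (\<integral>t. b \<partial>?M)"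
    using res_measure(3)[OF u, of UNIV] by (simp add: space_res[OF u] res_UNIV[OF u] mult.commute)
  also have "\<dots> \<le> (\<integral>t. t \<partial>?M)"
    using res_AE[OF u _ assms(2)] res_integral(1)[OF u] by (intro integral_mono_AE) auto
  also have "\<dots> = Re (ip (T u) u)" using res_integral[OF u] by simp
  finally show ?thesis .
qed

text \<open>For \<open>a\<close> in the range of \<open>P S\<close> and \<open>b\<close> in the range of \<open>P (- S)\<close>, the spectral measure of \<open>a + k b\<close> is
  that of \<open>a\<close> plus \<open>\<bar>k\<bar>\<^sup>2\<close> times that of \<open>b\<close>.  The form of \<open>T\<close> at \<open>a + k b\<close> is its mean, so it does not
  depend on the phase of \<open>k\<close>; comparing the phases \<open>1\<close>, \<open>-1\<close> and \<open>\<i>\<close> kills the cross terms.\<close>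

lemma res_orthogonal_T:
  assumes S: "S \<in> sets borel" and u: "u \<in> V" and v: "v \<in> V"
  shows "ip (T (P S u)) (P (- S) v) = 0"
proof -
  have S': "- S \<in> sets borel" using S by (auto simp: borel_comp)
  define a where "a = P S u"
  define b where "b = P (- S) v"
  have ab: "a \<in> V" "b \<in> V" using S S' u v by (auto simp: a_def b_def)
  have cross: "ip (P R a) b = 0" if R: "R \<in> sets borel" for R
  proof -
    have "ip (P R a) b = ip (P (- S) (P R (P S u))) v"
      unfolding a_def b_def using R S S' u v by (simp add: res_sa)
    also have "P (- S) (P R (P S u)) = P (- S \<inter> (R \<inter> S)) u"
      using R S S' u by (simp add: res_Int)
    also have "- S \<inter> (R \<inter> S) = {}" by auto
    finally show ?thesis using u v by (simp add: res_empty ip_zero)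
  qed
  have cross': "ip (P R b) a = 0" if R: "R \<in> sets borel" for R
    using cross[OF R] ip_cnj[of a "P R b"] res_sa[OF R] R ab by simp
  let ?w = "\<lambda>k. hadd H a (hscale H k b)"
  have meas: "ip (P R (?w k)) (?w k) = ip (P R a) a + k * cnj k * ip (P R b) b" if "R \<in> sets borel" for R k
    using that ab by (simp add: res_add res_scale ip_simps cross cross' algebra_simps)
  have indep: "ip (T (?w k)) (?w k) = ip (T (?w 1)) (?w 1)" if k: "k * cnj k = 1" for k
  proof -
    have "scalar_spectral_measure H P (?w k) = scalar_spectral_measure H P (?w 1)"
      unfolding scalar_spectral_measure_def
      by (rule measure_of_eq) (auto simp: meas k sets.sigma_sets_eq[of "borel::real measure", simplified])
    then show ?thesis using ab by (simp add: res_integral(2))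
  qed
  have expand: "ip (T (?w k)) (?w k) = ip (T a) a + cnj k * ip (T a) b + k * ip (T b) a + k * cnj k * ip (T b) b" for k
    using ab by (simp add: T_add T_scale ip_simps algebra_simps)
  have "2 * (ip (T a) b + ip (T b) a) = 0"
    using indep[of "-1"] unfolding expand by (simp add: algebra_simps)
  then have 1: "ip (T a) b + ip (T b) a = 0" by (simp only: mult_eq_0_iff) simp
  have 2: "- \<i> * ip (T a) b + \<i> * ip (T b) a = ip (T a) b + ip (T b) a"
    using indep[of \<i>] unfolding expand by simp
  from 1 2 have "\<i> * (ip (T b) a - ip (T a) b) = 0" by (simp add: algebra_simps)
  with 1 have "ip (T a) b = 0" by simp
  then show ?thesis by (simp add: a_def b_def)
qed

text \<open>By the previous lemma, \<open>T\<close> is block diagonal for the ranges of \<open>P S\<close> and \<open>P (- S)\<close>.\<close>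

lemma res_commutes_T:
  assumes S: "S \<in> sets borel" and u: "u \<in> V"
  shows "P S (T u) = T (P S u)"
proof (rule separated)
  fix v assume v: "v \<in> V"
  have S': "- S \<in> sets borel" using S by (auto simp: borel_comp)
  have "ip (P S (T u)) v = ip u (T (P S v))"
    using S u v by (simp add: res_sa T_sa)
  also have "\<dots> = ip (P S u) (T (P S v)) + ip (P (- S) u) (T (P S v))"
    using S u v by (simp add: res_compl)
  also have "ip (P (- S) u) (T (P S v)) = 0"
    using res_orthogonal_T[OF S v u] ip_cnj[of "T (P S v)" "P (- S) u"] S S' u v by simp
  finally have 1: "ip (P S (T u)) v = ip (T (P S u)) (P S v)"
    using S u v by (simp add: T_sa)
  have "ip (T (P S u)) v = cnj (ip v (T (P S u)))" using S u v by (intro ip_cnj) auto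
  also have "ip v (T (P S u)) = ip (P S v) (T (P S u)) + ip (P (- S) v) (T (P S u))"
    using S u v by (simp add: res_compl)
  also have "cnj \<dots> = ip (T (P S u)) (P S v) + ip (T (P S u)) (P (- S) v)"
    using S S' u v ip_cnj[of "P S v" "T (P S u)"] ip_cnj[of "P (- S) v" "T (P S u)"] by simp
  also have "ip (T (P S u)) (P (- S) v) = 0" by (rule res_orthogonal_T[OF S u v])
  finally show "ip (P S (T u)) v = ip (T (P S u)) v" using 1 by simp
qed (use S u in auto)

text \<open>Commutation with \<open>T\<close> passes to polynomials in \<open>T\<close> and to their limits.\<close>

lemma res_commutes_proj:
  assumes S: "S \<in> sets borel" and R: "R \<in> sets borel" and u: "u \<in> V"
  shows "P S (proj R u) = proj R (P S u)"
proof (rule separated)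
  fix v assume v: "v \<in> V"
  have Tpow: "P S ((T ^^ i) w) = (T ^^ i) (P S w)" if "w \<in> V" for i w
    using that by (induction i) (auto simp: res_commutes_T[OF S])
  obtain p where p: "approx R p u" "approx R p (P S u)"
    using approx_exists[of "{u, P S u}" R] u S R by auto
  have "(\<lambda>n. ip (papp (p n) u) (P S v)) \<longlonglongrightarrow> ip (proj R u) (P S v)"
    by (rule cvg_ip_left[OF approx_cvg_proj]) (use u v S R p in auto)
  moreover have "(\<lambda>n. ip (papp (p n) (P S u)) v) \<longlonglongrightarrow> ip (proj R (P S u)) v"
    by (rule cvg_ip_left[OF approx_cvg_proj]) (use u v S R p in auto)
  moreover have "ip (papp (p n) u) (P S v) = ip (papp (p n) (P S u)) v" for n
    using u v S by (simp add: ip_papp pform_def Tpow[symmetric] res_sa)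
  ultimately have "ip (proj R u) (P S v) = ip (proj R (P S u)) v"
    by (auto intro: LIMSEQ_unique)
  then show "ip (P S (proj R u)) v = ip (proj R (P S u)) v" using u v S R by (simp add: res_sa)
qed (use S R u in auto)

end

text \<open>A vector \<open>w\<close> in the ranges of both \<open>P {..a}\<close> and \<open>R {b<..}\<close> satisfies
  \<open>b \<parallel>w\<parallel>\<^sup>2 \<le> \<langle>T w, w\<rangle> \<le> a \<parallel>w\<parallel>\<^sup>2\<close>, hence is null.  So \<open>P {..a}\<close> only sees the part of a vector in the range
  of \<open>R {..b}\<close>.\<close>

lemma commuting_resolutions_le:
  assumes P: "spectral_resolution H T P" and R: "spectral_resolution H T R"
    and comm: "\<And>S S' u. S \<in> sets borel \<Longrightarrow> S' \<in> sets borel \<Longrightarrow> u \<in> V \<Longrightarrow> P S (R S' u) = R S' (P S u)"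
    and ab: "a < b" and u: "u \<in> V"
  shows "nrm (P {..a} u) \<le> nrm (R {..b} u)"
proof -
  note Pc = res_closed[OF P] and Rc = res_closed[OF R]
  define w where "w = P {..a} (R {b<..} u)"
  have w: "w \<in> V" using Pc Rc u by (auto simp: w_def)
  have "P {..a} w = w" unfolding w_def using Rc u by (simp add: res_Int[OF P])
  then have 1: "Re (ip (T w) w) \<le> a * (nrm w)\<^sup>2" by (rule res_upper[OF P w])
  have "R {b<..} w = w"
    unfolding w_def using u Pc Rc by (simp add: comm res_Int[OF R])
  then have 2: "b * (nrm w)\<^sup>2 \<le> Re (ip (T w) w)" by (rule res_lower[OF R w])
  have "(b - a) * (nrm w)\<^sup>2 \<le> 0" using 1 2 by (simp add: algebra_simps)
  then have nw: "nrm w = 0" using ab by (simp add: mult_le_0_iff)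
  have compl: "- {..b} = {b<..}" by auto
  have "nrm (P {..a} u) = nrm (P {..a} (R {..b} u))"
  proof (rule nrm_cong)
    fix v assume v: "v \<in> V"
    have "ip (P {..a} u) v = ip u (P {..a} v)" using u v by (simp add: res_sa[OF P])
    also have "\<dots> = ip (R {..b} u) (P {..a} v) + ip (R {b<..} u) (P {..a} v)"
      using res_compl[OF R, of "{..b}" u "P {..a} v"] u v Pc by (simp add: compl)
    also have "ip (R {b<..} u) (P {..a} v) = ip w v"
      using u v Rc by (simp add: w_def res_sa[OF P])
    also have "ip w v = 0" using Cauchy_Schwarz[OF w v] nw by simp
    finally show "ip (P {..a} u) v = ip (P {..a} (R {..b} u)) v"
      using u v Rc by (simp add: res_sa[OF P])
  qed (use u Pc Rc in auto)
  also have "\<dots> \<le> nrm (R {..b} u)"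
  proof -
    let ?x = "R {..b} u"
    have x: "?x \<in> V" using u Rc by auto
    interpret finite_measure "scalar_spectral_measure H P ?x" by (rule res_measure[OF P x])
    have "(nrm (P {..a} ?x))\<^sup>2 \<le> (nrm (P UNIV ?x))\<^sup>2"
      using finite_measure_mono[of "{..a}" UNIV] by (simp add: res_measure[OF P x])
    then show ?thesis using x Pc by (simp add: res_UNIV[OF P] power2_le_iff_abs_le)
  qed
  finally show ?thesis .
qed

text \<open>Applied in both directions, the comparison of half-lines shows that the distribution functions
  of the two spectral measures of a vector agree up to an arbitrarily small shift, hence agree by
  right continuity.\<close>

lemma spectral_resolution_unique:
  assumes P: "spectral_resolution H T P" and S: "S \<in> sets borel" and u: "u \<in> V"
  shows "P S u = proj S u"
proof -
  let ?R = "\<lambda>S. restrict (proj S) V"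
  note R = spectral_resolution_proj
  have comm: "P S (?R S' u) = ?R S' (P S u)" if "S \<in> sets borel" "S' \<in> sets borel" "u \<in> V" for S S' u
    using that res_commutes_proj[OF P] res_closed[OF P] by simp
  have eq: "scalar_spectral_measure H P v = scalar_spectral_measure H ?R v" if v: "v \<in> V" for v
  proof -
    let ?A = "scalar_spectral_measure H P v" and ?B = "scalar_spectral_measure H ?R v"
    interpret A: finite_borel_measure ?A
      using res_measure(1,2)[OF P v] by (simp add: finite_borel_measure_def finite_borel_measure_axioms_def)
    interpret B: finite_borel_measure ?B
      using res_measure(1,2)[OF R v] by (simp add: finite_borel_measure_def finite_borel_measure_axioms_def)
    have cdfA: "cdf ?A a = (nrm (P {..a} v))\<^sup>2" and cdfB: "cdf ?B a = (nrm (?R {..a} v))\<^sup>2" for a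
      by (simp_all only: cdf_def res_measure(3)[OF P v] res_measure(3)[OF R v] atMost_borel)
    have right: "f a \<le> g a" if "\<And>b. a < b \<Longrightarrow> f a \<le> g b" "continuous (at_right a) g" for f g :: "real \<Rightarrow> real" and a
    proof (rule tendsto_lowerbound)
      show "(g \<longlongrightarrow> g a) (at_right a)" using that(2) by (simp add: continuous_within)
      show "\<forall>\<^sub>F b in at_right a. f a \<le> g b" using that(1) by (auto simp: eventually_at_right_field intro!: exI[of _ "a + 1"])
    qed simp
    have "cdf ?A a \<le> cdf ?B a" for a
    proof (rule right[of a "cdf ?A" "cdf ?B"])
      fix b assume "a < b"
      have "nrm (P {..a} v) \<le> nrm (?R {..b} v)"
        by (rule commuting_resolutions_le[OF P R comm \<open>a < b\<close> v])
      then show "cdf ?A a \<le> cdf ?B b"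
        unfolding cdfA cdfB using res_closed[OF P] v by (intro power_mono) auto
    qed (rule B.cdf_is_right_cont)
    moreover have "cdf ?B a \<le> cdf ?A a" for a
    proof (rule right[of a "cdf ?B" "cdf ?A"])
      fix b assume "a < b"
      have "nrm (?R {..a} v) \<le> nrm (P {..b} v)"
        by (rule commuting_resolutions_le[OF R P comm[symmetric] \<open>a < b\<close> v])
      then show "cdf ?B a \<le> cdf ?A b"
        unfolding cdfA cdfB using v by (intro power_mono) auto
    qed (rule A.cdf_is_right_cont)
    ultimately have "cdf ?A = cdf ?B" by (intro ext antisym)
    then show ?thesis
      by (rule cdf_unique'[OF A.finite_borel_measure_axioms B.finite_borel_measure_axioms])
  qed
  show ?thesis
  proof (rule separated)
    fix w assume w: "w \<in> V"
    show "ip (P S u) w = ip (proj S u) w"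
    proof (rule sesquilinear_eqI[OF _ _ _ _ _ _ _ u w])
      fix v assume v: "v \<in> V"
      have "(nrm (P S v))\<^sup>2 = (nrm (?R S v))\<^sup>2"
        using eq[OF v] res_measure(3)[OF P v S] res_measure(3)[OF R v S] by simp
      then show "ip (P S v) v = ip (proj S v) v"
        using res_self[OF P S v] res_self[OF R S v] v by simp
    qed (use S in \<open>auto simp: res_closed[OF P] res_add[OF P] res_scale[OF P] proj_add proj_scale\<close>)
  qed (use S u res_closed[OF P] in auto)
qed

theorem spectral_projection_eq:
  assumes S: "S \<in> sets borel"
  shows "spectral_projection H T S = restrict (proj S) V"
  unfolding spectral_projection_def
proof (rule the_equality)
  show "\<exists>P. spectral_resolution H T P \<and> restrict (proj S) V = P S"
    by (intro exI[of _ "\<lambda>S. restrict (proj S) V"]) (simp add: spectral_resolution_proj)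
  fix R assume "\<exists>P. spectral_resolution H T P \<and> R = P S"
  then obtain P where P: "spectral_resolution H T P" and R: "R = P S" by blast
  have "P S \<in> V \<rightarrow>\<^sub>E V" using res_bounded_ops[OF P S] by (simp add: bounded_ops_def)
  then have "P S \<in> extensional V" by (simp add: PiE_def)
  then show "R = restrict (proj S) V"
    unfolding R by (rule extensionalityI) (simp_all add: spectral_resolution_unique[OF P S])
qed

end

section \<open>Completion of a semi-inner product space\<close>

context semi_inner
begin

text \<open>The following formulas are those of the Hilbert space of a graph, for an arbitrary semi-inner
  product space; in this way the Hilbert space of a graph becomes an instance by unfolding.\<close>

definition cauchy :: "(nat \<Rightarrow> 'a) set" where
  "cauchy = {X. (\<forall>n. X n \<in> V) \<and> (\<forall>e>0. \<exists>N. \<forall>m\<ge>N. \<forall>n\<ge>N. nrm (dif (X m) (X n)) < e)}"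

definition equi :: "(nat \<Rightarrow> 'a) rel" where
  "equi = {(X, Y). X \<in> cauchy \<and> Y \<in> cauchy \<and> (\<lambda>n. nrm (dif (X n) (Y n))) \<longlonglongrightarrow> 0}"

definition cls :: "(nat \<Rightarrow> 'a) \<Rightarrow> (nat \<Rightarrow> 'a) set" where
  "cls X = equi `` {X}"

definition completion :: "(nat \<Rightarrow> 'a) set hilbert" where
  "completion = \<lparr>
     carr = cauchy // equi,
     hzero = cls (\<lambda>n. vz),
     hadd = (\<lambda>\<xi> \<eta>. equi `` {\<lambda>n. va (X n) (Y n) | X Y. X \<in> \<xi> \<and> Y \<in> \<eta>}),
     hscale = (\<lambda>c \<xi>. equi `` {\<lambda>n. vs c (X n) | X. X \<in> \<xi>}),
     hinner = (\<lambda>\<xi> \<eta>. THE c. \<forall>X\<in>\<xi>. \<forall>Y\<in>\<eta>. (\<lambda>n. ip (X n) (Y n)) \<longlonglongrightarrow> c)\<rparr>"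

definition extend_op :: "('a \<Rightarrow> 'a) \<Rightarrow> (nat \<Rightarrow> 'a) set \<Rightarrow> (nat \<Rightarrow> 'a) set" where
  "extend_op A = (\<lambda>\<xi>\<in>carr completion. equi `` {\<lambda>n. A (X n) | X. X \<in> \<xi>})"

lemma cauchy_closed: "X \<in> cauchy \<Longrightarrow> X n \<in> V"
  by (simp add: cauchy_def)

lemma cauchy_iff: "X \<in> cauchy \<longleftrightarrow> (\<forall>n. X n \<in> V) \<and> (\<forall>e>0. \<exists>N. \<forall>m\<ge>N. \<forall>n\<ge>N. nrm (dif (X m) (X n)) < e)"
  by (simp add: cauchy_def)

lemma cauchyD: "X \<in> cauchy \<Longrightarrow> 0 < e \<Longrightarrow> \<exists>N. \<forall>m\<ge>N. \<forall>n\<ge>N. nrm (dif (X m) (X n)) < e"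
  by (simp add: cauchy_iff)

lemma nrm_dif_self: "u \<in> V \<Longrightarrow> nrm (dif u u) = 0"
  by (simp add: nrm_def ip_dif ip_dif_right)

lemma nrm_tendsto_0:
  assumes "\<And>n. X n \<in> V" "\<And>n. nrm (X n) \<le> f n" "f \<longlonglongrightarrow> 0"
  shows "(\<lambda>n. nrm (X n)) \<longlonglongrightarrow> 0"
  by (rule Lim_null_comparison[OF _ assms(3)]) (use assms(1,2) in simp)

lemma cauchy_const: "u \<in> V \<Longrightarrow> (\<lambda>_. u) \<in> cauchy"
  by (simp add: cauchy_iff nrm_dif_self)

text \<open>The common source of closure under sums, multiples and Lipschitz maps.\<close>

lemma cauchy_lipschitz2:
  assumes X: "X \<in> cauchy" and Y: "Y \<in> cauchy"
    and Z: "\<And>n. Z n \<in> V" and C: "\<And>m n. nrm (dif (Z m) (Z n)) \<le> C * nrm (dif (X m) (X n)) + C * nrm (dif (Y m) (Y n))"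
  shows "Z \<in> cauchy"
proof -
  have "\<exists>N. \<forall>m\<ge>N. \<forall>n\<ge>N. nrm (dif (Z m) (Z n)) < e" if e: "0 < e" for e
  proof -
    let ?d = "e / (2 * (\<bar>C\<bar> + 1))"
    have d: "0 < ?d" using e by (intro divide_pos_pos) auto
    obtain N where N: "\<And>m n. m \<ge> N \<Longrightarrow> n \<ge> N \<Longrightarrow> nrm (dif (X m) (X n)) < ?d"
      using cauchyD[OF X d] by auto
    obtain M where M: "\<And>m n. m \<ge> M \<Longrightarrow> n \<ge> M \<Longrightarrow> nrm (dif (Y m) (Y n)) < ?d"
      using cauchyD[OF Y d] by auto
    have "nrm (dif (Z m) (Z n)) < e" if "m \<ge> max M N" "n \<ge> max M N" for m n
    proof -
      have nn: "0 \<le> nrm (dif (X m) (X n))" "0 \<le> nrm (dif (Y m) (Y n))"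
        using cauchy_closed[OF X] cauchy_closed[OF Y] by auto
      have "C * nrm (dif (X m) (X n)) \<le> \<bar>C\<bar> * ?d"
        using nn N[of m n] that by (intro mult_mono) auto
      moreover have "C * nrm (dif (Y m) (Y n)) \<le> \<bar>C\<bar> * ?d"
        using nn M[of m n] that by (intro mult_mono) auto
      moreover have "\<bar>C\<bar> * ?d + \<bar>C\<bar> * ?d < e"
      proof -
        have "\<bar>C\<bar> + 1 \<noteq> 0" by linarith
        then have "2 * (\<bar>C\<bar> + 1) \<noteq> 0" by simp
        moreover have "x * (e / x) = e" if "x \<noteq> 0" for x :: real using that by simp
        ultimately have "2 * (\<bar>C\<bar> + 1) * ?d = e" by blast
        then have "2 * (\<bar>C\<bar> * ?d) + 2 * ?d = e" by (simp only: distrib_right distrib_left mult_1 mult.assoc mult_1_right)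
        then show ?thesis using d by linarith
      qed
      ultimately show ?thesis using C[of m n] by linarith
    qed
    then show ?thesis by blast
  qed
  with Z show ?thesis by (simp add: cauchy_iff)
qed

lemma cauchy_add: "X \<in> cauchy \<Longrightarrow> Y \<in> cauchy \<Longrightarrow> (\<lambda>n. va (X n) (Y n)) \<in> cauchy"
  by (rule cauchy_lipschitz2[of X Y _ 1]) (auto simp: cauchy_closed nrm_dif_add)

lemma cauchy_lipschitz:
  assumes X: "X \<in> cauchy" and A: "\<And>u. u \<in> V \<Longrightarrow> A u \<in> V"
    and C: "\<And>u v. u \<in> V \<Longrightarrow> v \<in> V \<Longrightarrow> nrm (dif (A u) (A v)) \<le> C * nrm (dif u v)"
  shows "(\<lambda>n. A (X n)) \<in> cauchy"
  by (rule cauchy_lipschitz2[OF X cauchy_const[OF vz], of _ C]) (use cauchy_closed[OF X] A C in \<open>auto simp: nrm_dif_self\<close>)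

lemma cauchy_scale: "X \<in> cauchy \<Longrightarrow> (\<lambda>n. vs c (X n)) \<in> cauchy"
  by (rule cauchy_lipschitz[where A = "vs c" and C = "cmod c"]) (auto simp: nrm_dif_scale)

lemma equiD: "(X, Y) \<in> equi \<Longrightarrow> X \<in> cauchy" "(X, Y) \<in> equi \<Longrightarrow> Y \<in> cauchy"
  "(X, Y) \<in> equi \<Longrightarrow> (\<lambda>n. nrm (dif (X n) (Y n))) \<longlonglongrightarrow> 0"
  by (auto simp: equi_def)

lemma equiv_equi: "equiv cauchy equi"
proof (rule equivI)
  show "equi \<subseteq> cauchy \<times> cauchy" by (auto simp: equi_def)
  show "refl_on cauchy equi"
    by (auto simp: refl_on_def equi_def nrm_dif_self cauchy_closed)
  show "sym equi"
  proof (rule symI)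
    fix X Y assume a: "(X, Y) \<in> equi"
    then have "nrm (dif (Y n) (X n)) = nrm (dif (X n) (Y n))" for n
      by (intro nrm_dif_commute cauchy_closed) (auto dest: equiD)
    with a show "(Y, X) \<in> equi" by (simp add: equi_def)
  qed
  show "trans equi"
  proof (rule transI)
    fix X Y Z assume a: "(X, Y) \<in> equi" "(Y, Z) \<in> equi"
    have "(\<lambda>n. nrm (dif (X n) (Y n)) + nrm (dif (Y n) (Z n))) \<longlonglongrightarrow> 0"
      using equiD(3)[OF a(1)] equiD(3)[OF a(2)] by (rule tendsto_add_zero)
    then have "(\<lambda>n. nrm (dif (X n) (Z n))) \<longlonglongrightarrow> 0"
      by (rule nrm_tendsto_0[rotated 2])
        (use cauchy_closed[OF equiD(1)[OF a(1)]] cauchy_closed[OF equiD(2)[OF a(1)]] cauchy_closed[OF equiD(2)[OF a(2)]]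
          in \<open>auto intro: nrm_dif_triangle\<close>)
    with a show "(X, Z) \<in> equi" by (simp add: equi_def)
  qed
qed

lemma cls_eq_iff: "X \<in> cauchy \<Longrightarrow> Y \<in> cauchy \<Longrightarrow> cls X = cls Y \<longleftrightarrow> (X, Y) \<in> equi"
  unfolding cls_def by (rule eq_equiv_class_iff[OF equiv_equi])

lemma mem_cls: "Y \<in> cls X \<longleftrightarrow> (X, Y) \<in> equi"
  by (simp add: cls_def)

lemma carr_completion: "carr completion = {cls X | X. X \<in> cauchy}"
  by (auto simp: completion_def quotient_def cls_def)

lemma cls_in_carr [simp, intro]: "X \<in> cauchy \<Longrightarrow> cls X \<in> carr completion"
  by (auto simp: carr_completion)

lemma carr_cases:
  assumes "\<xi> \<in> carr completion"
  obtains X where "X \<in> cauchy" "\<xi> = cls X"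
  using assms by (auto simp: carr_completion)

lemma self_mem_cls: "X \<in> cauchy \<Longrightarrow> X \<in> cls X"
  unfolding cls_def by (rule equiv_class_self[OF equiv_equi])

text \<open>Operations on classes are unions over all representatives; if the operation respects the
  equivalence, all of them give the same class.\<close>

lemma Image_image_cls:
  assumes X: "X \<in> cauchy" and f: "\<And>Y. (X, Y) \<in> equi \<Longrightarrow> (f X, f Y) \<in> equi"
  shows "equi `` {f Y | Y. Y \<in> cls X} = cls (f X)"
proof -
  have eq: "equi `` {f Y} = cls (f X)" if "Y \<in> cls X" for Y
    unfolding cls_def by (rule equiv_class_eq[OF equiv_equi f, symmetric]) (use that in \<open>simp add: mem_cls\<close>)
  show ?thesis
  proof
    show "equi `` {f Y | Y. Y \<in> cls X} \<subseteq> cls (f X)" using eq by blast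
    show "cls (f X) \<subseteq> equi `` {f Y | Y. Y \<in> cls X}"
      using eq[OF self_mem_cls[OF X]] self_mem_cls[OF X] by blast
  qed
qed

lemma equi_lipschitz:
  assumes X: "(X, Y) \<in> equi" and A: "\<And>u. u \<in> V \<Longrightarrow> A u \<in> V"
    and C: "\<And>u v. u \<in> V \<Longrightarrow> v \<in> V \<Longrightarrow> nrm (dif (A u) (A v)) \<le> C * nrm (dif u v)"
  shows "(\<lambda>n. A (X n), \<lambda>n. A (Y n)) \<in> equi"
proof -
  have "(\<lambda>n. C * nrm (dif (X n) (Y n))) \<longlonglongrightarrow> 0"
    using equiD(3)[OF X] by (rule tendsto_mult_right_zero)
  then have "(\<lambda>n. nrm (dif (A (X n)) (A (Y n)))) \<longlonglongrightarrow> 0"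
    by (rule nrm_tendsto_0[rotated 2])
      (use A C cauchy_closed[OF equiD(1)[OF X]] cauchy_closed[OF equiD(2)[OF X]] in auto)
  then show ?thesis
    using cauchy_lipschitz[OF equiD(1)[OF X] A C] cauchy_lipschitz[OF equiD(2)[OF X] A C]
    by (simp add: equi_def)
qed

lemma extend_op_cls:
  assumes X: "X \<in> cauchy" and A: "\<And>u. u \<in> V \<Longrightarrow> A u \<in> V"
    and C: "\<And>u v. u \<in> V \<Longrightarrow> v \<in> V \<Longrightarrow> nrm (dif (A u) (A v)) \<le> C * nrm (dif u v)"
  shows "extend_op A (cls X) = cls (\<lambda>n. A (X n))"
proof -
  have "equi `` {\<lambda>n. A (Y n) | Y. Y \<in> cls X} = cls (\<lambda>n. A (X n))"
    by (rule Image_image_cls[OF X]) (rule equi_lipschitz[OF _ A C])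
  then show ?thesis using X by (simp add: extend_op_def)
qed

lemma hzero_completion: "hzero completion = cls (\<lambda>_. vz)"
  by (simp add: completion_def)

lemma hscale_cls:
  assumes X: "X \<in> cauchy"
  shows "hscale completion c (cls X) = cls (\<lambda>n. vs c (X n))"
proof -
  have "equi `` {\<lambda>n. vs c (Y n) | Y. Y \<in> cls X} = cls (\<lambda>n. vs c (X n))"
    by (rule Image_image_cls[OF X], rule equi_lipschitz[where A = "vs c" and C = "cmod c"]) (auto simp: nrm_dif_scale)
  then show ?thesis by (simp add: completion_def)
qed

lemma equi_add:
  assumes "(X, X') \<in> equi" "(Y, Y') \<in> equi"
  shows "(\<lambda>n. va (X n) (Y n), \<lambda>n. va (X' n) (Y' n)) \<in> equi"
proof -
  have "(\<lambda>n. nrm (dif (X n) (X' n)) + nrm (dif (Y n) (Y' n))) \<longlonglongrightarrow> 0"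
    using equiD(3)[OF assms(1)] equiD(3)[OF assms(2)] by (rule tendsto_add_zero)
  then have "(\<lambda>n. nrm (dif (va (X n) (Y n)) (va (X' n) (Y' n)))) \<longlonglongrightarrow> 0"
    by (rule nrm_tendsto_0[rotated 2])
      (use cauchy_closed[OF equiD(1)[OF assms(1)]] cauchy_closed[OF equiD(2)[OF assms(1)]]
        cauchy_closed[OF equiD(1)[OF assms(2)]] cauchy_closed[OF equiD(2)[OF assms(2)]] in \<open>auto intro: nrm_dif_add\<close>)
  then show ?thesis using assms by (auto simp: equi_def intro: cauchy_add)
qed

lemma hadd_cls:
  assumes X: "X \<in> cauchy" and Y: "Y \<in> cauchy"
  shows "hadd completion (cls X) (cls Y) = cls (\<lambda>n. va (X n) (Y n))"
proof -
  let ?Z = "\<lambda>n. va (X n) (Y n)"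
  have eq: "equi `` {\<lambda>n. va (X' n) (Y' n)} = cls ?Z" if "X' \<in> cls X" "Y' \<in> cls Y" for X' Y'
    unfolding cls_def by (rule equiv_class_eq[OF equiv_equi equi_add, symmetric]) (use that in \<open>simp_all add: mem_cls\<close>)
  have "equi `` {\<lambda>n. va (X' n) (Y' n) | X' Y'. X' \<in> cls X \<and> Y' \<in> cls Y} = cls ?Z"
  proof
    show "equi `` {\<lambda>n. va (X' n) (Y' n) | X' Y'. X' \<in> cls X \<and> Y' \<in> cls Y} \<subseteq> cls ?Z"
      using eq by blast
    show "cls ?Z \<subseteq> equi `` {\<lambda>n. va (X' n) (Y' n) | X' Y'. X' \<in> cls X \<and> Y' \<in> cls Y}"
      using self_mem_cls[OF X] self_mem_cls[OF Y] unfolding cls_def by blast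
  qed
  then show ?thesis by (simp add: completion_def)
qed

lemma cauchy_bounded:
  assumes X: "X \<in> cauchy"
  obtains C where "0 \<le> C" "\<And>n. nrm (X n) \<le> C"
proof -
  obtain N where N: "\<And>m n. m \<ge> N \<Longrightarrow> n \<ge> N \<Longrightarrow> nrm (dif (X m) (X n)) < 1"
    using cauchyD[OF X, of 1] by auto
  define C where "C = (\<Sum>n\<le>N. nrm (X n)) + 1"
  have le: "nrm (X n) \<le> (\<Sum>n\<le>N. nrm (X n))" if "n \<le> N" for n
    using that X by (intro member_le_sum) (auto simp: cauchy_closed)
  have "nrm (X n) \<le> C" for n
  proof (cases "n \<le> N")
    case True then show ?thesis using le[of n] by (simp add: C_def)
  next
    case False
    then have "nrm (X n) \<le> nrm (dif (X n) (X N)) + nrm (X N)"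
      using X by (intro nrm_le_dif) (auto simp: cauchy_closed)
    also have "\<dots> \<le> 1 + (\<Sum>n\<le>N. nrm (X n))"
      using False N[of n N] le[of N] by simp
    finally show ?thesis by (simp add: C_def)
  qed
  moreover have "0 \<le> C" unfolding C_def using X by (intro add_nonneg_nonneg sum_nonneg) (auto simp: cauchy_closed)
  ultimately show ?thesis by (rule that[rotated])
qed

lemma ip_cauchy_convergent:
  assumes X: "X \<in> cauchy" and Y: "Y \<in> cauchy"
  shows "convergent (\<lambda>n. ip (X n) (Y n))"
proof -
  obtain C where C: "0 \<le> C" "\<And>n. nrm (X n) \<le> C" using cauchy_bounded[OF X] by blast
  obtain D where D: "0 \<le> D" "\<And>n. nrm (Y n) \<le> D" using cauchy_bounded[OF Y] by blast
  note XV = cauchy_closed[OF X] and YV = cauchy_closed[OF Y]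
  have "Cauchy (\<lambda>n. ip (X n) (Y n))"
  proof (rule CauchyI)
    fix e :: real assume e: "0 < e"
    let ?d = "e / (C + D + 1)"
    have d: "0 < ?d" using e C D by (intro divide_pos_pos) auto
    obtain N where N: "\<And>m n. m \<ge> N \<Longrightarrow> n \<ge> N \<Longrightarrow> nrm (dif (X m) (X n)) < ?d"
      using cauchyD[OF X d] by auto
    obtain M where M: "\<And>m n. m \<ge> M \<Longrightarrow> n \<ge> M \<Longrightarrow> nrm (dif (Y m) (Y n)) < ?d"
      using cauchyD[OF Y d] by auto
    have "norm (ip (X m) (Y m) - ip (X n) (Y n)) < e" if "m \<ge> max M N" "n \<ge> max M N" for m n
    proof -
      have "norm (ip (X m) (Y m) - ip (X n) (Y n)) \<le> nrm (dif (X m) (X n)) * nrm (Y m) + nrm (X n) * nrm (dif (Y m) (Y n))"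
        by (rule ip_dif_bound) (rule XV YV)+
      also have "\<dots> \<le> ?d * D + C * ?d"
        using that XV YV C D N[of m n] M[of m n] d by (intro add_mono mult_mono) (auto intro: less_imp_le)
      also have "\<dots> = (C + D) * ?d"
      proof -
        have "x * D + C * x = (C + D) * x" for x :: real by (simp add: algebra_simps)
        then show ?thesis .
      qed
      also have "\<dots> < (C + D + 1) * ?d" using d by (intro mult_strict_right_mono) auto
      also have "\<dots> = e" using C D by simp
      finally show ?thesis .
    qed
    then show "\<exists>N. \<forall>m\<ge>N. \<forall>n\<ge>N. norm (ip (X m) (Y m) - ip (X n) (Y n)) < e" by blast
  qed
  then show ?thesis by (rule Cauchy_convergent)
qed

lemma ip_equi_limit:
  assumes X: "(X, X') \<in> equi" and Y: "(Y, Y') \<in> equi" and l: "(\<lambda>n. ip (X n) (Y n)) \<longlonglongrightarrow> l"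
  shows "(\<lambda>n. ip (X' n) (Y' n)) \<longlonglongrightarrow> l"
proof -
  obtain C where C: "0 \<le> C" "\<And>n. nrm (X n) \<le> C" using cauchy_bounded[OF equiD(1)[OF X]] by blast
  obtain D where D: "0 \<le> D" "\<And>n. nrm (Y' n) \<le> D" using cauchy_bounded[OF equiD(2)[OF Y]] by blast
  have XV: "X n \<in> V" "X' n \<in> V" "Y n \<in> V" "Y' n \<in> V" for n
    using cauchy_closed[OF equiD(1)[OF X]] cauchy_closed[OF equiD(2)[OF X]]
      cauchy_closed[OF equiD(1)[OF Y]] cauchy_closed[OF equiD(2)[OF Y]] by auto
  have "(\<lambda>n. nrm (dif (X n) (X' n)) * D + C * nrm (dif (Y n) (Y' n))) \<longlonglongrightarrow> 0 * D + C * 0"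
    by (intro tendsto_intros equiD(3)[OF X] equiD(3)[OF Y])
  then have lim: "(\<lambda>n. nrm (dif (X n) (X' n)) * D + C * nrm (dif (Y n) (Y' n))) \<longlonglongrightarrow> 0" by simp
  have "(\<lambda>n. ip (X n) (Y n) - ip (X' n) (Y' n)) \<longlonglongrightarrow> 0"
  proof (rule Lim_null_comparison[OF always_eventually[OF allI] lim])
    fix n
    have "norm (ip (X n) (Y n) - ip (X' n) (Y' n)) = norm (ip (X' n) (Y' n) - ip (X n) (Y n))"
      by (rule norm_minus_commute)
    also have "\<dots> \<le> nrm (dif (X' n) (X n)) * nrm (Y' n) + nrm (X n) * nrm (dif (Y' n) (Y n))"
      by (rule ip_dif_bound) (rule XV)+
    also have "\<dots> \<le> nrm (dif (X' n) (X n)) * D + C * nrm (dif (Y' n) (Y n))"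
      using XV C D by (intro add_mono mult_mono) auto
    finally show "norm (ip (X n) (Y n) - ip (X' n) (Y' n)) \<le> nrm (dif (X n) (X' n)) * D + C * nrm (dif (Y n) (Y' n))"
      using XV by (simp add: nrm_dif_commute[of "X' n" "X n"] nrm_dif_commute[of "Y' n" "Y n"])
  qed
  from tendsto_diff[OF l this] show ?thesis by simp
qed

lemma hinner_cls:
  assumes X: "X \<in> cauchy" and Y: "Y \<in> cauchy"
  shows "(\<lambda>n. ip (X n) (Y n)) \<longlonglongrightarrow> hinner completion (cls X) (cls Y)"
proof -
  obtain l where l: "(\<lambda>n. ip (X n) (Y n)) \<longlonglongrightarrow> l"
    using ip_cauchy_convergent[OF X Y] by (auto simp: convergent_def)
  have "hinner completion (cls X) (cls Y) = (THE c. \<forall>X'\<in>cls X. \<forall>Y'\<in>cls Y. (\<lambda>n. ip (X' n) (Y' n)) \<longlonglongrightarrow> c)"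
    by (simp add: completion_def)
  also have "\<dots> = l"
  proof (rule the_equality)
    show "\<forall>X'\<in>cls X. \<forall>Y'\<in>cls Y. (\<lambda>n. ip (X' n) (Y' n)) \<longlonglongrightarrow> l"
      using ip_equi_limit[OF _ _ l] by (auto simp: mem_cls)
    fix c assume "\<forall>X'\<in>cls X. \<forall>Y'\<in>cls Y. (\<lambda>n. ip (X' n) (Y' n)) \<longlonglongrightarrow> c"
    then have "(\<lambda>n. ip (X n) (Y n)) \<longlonglongrightarrow> c" using self_mem_cls X Y by blast
    then show "c = l" using l by (rule LIMSEQ_unique)
  qed
  finally show ?thesis using l by simp
qed

lemma hinner_cls_eq:
  assumes "X \<in> cauchy" "Y \<in> cauchy" "(\<lambda>n. ip (X n) (Y n)) \<longlonglongrightarrow> l"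
  shows "hinner completion (cls X) (cls Y) = l"
  using hinner_cls[OF assms(1,2)] assms(3) by (rule LIMSEQ_unique)

lemma semi_inner_completion:
  "semi_inner (carr completion) (hzero completion) (hadd completion) (hscale completion) (hinner completion)"
proof
  show "hzero completion \<in> carr completion" by (simp add: hzero_completion cauchy_const)
next
  fix \<xi> \<eta> assume "\<xi> \<in> carr completion" "\<eta> \<in> carr completion"
  then obtain X Y where XY: "X \<in> cauchy" "\<xi> = cls X" "Y \<in> cauchy" "\<eta> = cls Y" by (auto elim!: carr_cases)
  then show "hadd completion \<xi> \<eta> \<in> carr completion" by (simp add: hadd_cls cauchy_add)
  have "(\<lambda>n. ip (Y n) (X n)) \<longlonglongrightarrow> cnj (hinner completion \<xi> \<eta>)"
    using tendsto_cnj[OF hinner_cls[OF XY(1,3)]] XY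
    by (simp add: ip_cnj[OF cauchy_closed[OF XY(1)] cauchy_closed[OF XY(3)]])
  then show "hinner completion \<eta> \<xi> = cnj (hinner completion \<xi> \<eta>)"
    using XY by (simp add: hinner_cls_eq)
next
  fix \<xi> c assume "\<xi> \<in> carr completion"
  then obtain X where X: "X \<in> cauchy" "\<xi> = cls X" by (auto elim!: carr_cases)
  then show "hscale completion c \<xi> \<in> carr completion" by (simp add: hscale_cls cauchy_scale)
  have "(\<lambda>n. ip vz (X n)) \<longlonglongrightarrow> 0" using cauchy_closed[OF X(1)] by (simp add: ip_zero)
  then show "hinner completion (hzero completion) \<xi> = 0"
    unfolding X hzero_completion by (intro hinner_cls_eq cauchy_const X) auto
  have "(\<lambda>n. Re (ip (X n) (X n))) \<longlonglongrightarrow> Re (hinner completion \<xi> \<xi>)"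
    using hinner_cls[OF X(1) X(1)] X by (intro tendsto_Re) simp
  then show "0 \<le> Re (hinner completion \<xi> \<xi>)"
    by (rule LIMSEQ_le_const) (use ip_nonneg cauchy_closed[OF X(1)] in auto)
next
  fix \<xi> \<eta> \<zeta> assume "\<xi> \<in> carr completion" "\<eta> \<in> carr completion" "\<zeta> \<in> carr completion"
  then obtain X Y Z where X: "X \<in> cauchy" "\<xi> = cls X" and Y: "Y \<in> cauchy" "\<eta> = cls Y" and Z: "Z \<in> cauchy" "\<zeta> = cls Z"
    by (auto elim!: carr_cases)
  have "(\<lambda>n. ip (va (X n) (Y n)) (Z n)) \<longlonglongrightarrow> hinner completion \<xi> \<zeta> + hinner completion \<eta> \<zeta>"
    using tendsto_add[OF hinner_cls[OF X(1) Z(1)] hinner_cls[OF Y(1) Z(1)]] X Y Z by (simp add: ip_add cauchy_closed)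
  then show "hinner completion (hadd completion \<xi> \<eta>) \<zeta> = hinner completion \<xi> \<zeta> + hinner completion \<eta> \<zeta>"
    using X Y Z by (simp add: hadd_cls hinner_cls_eq cauchy_add)
next
  fix \<xi> \<zeta> c assume "\<xi> \<in> carr completion" "\<zeta> \<in> carr completion"
  then obtain X Z where X: "X \<in> cauchy" "\<xi> = cls X" and Z: "Z \<in> cauchy" "\<zeta> = cls Z"
    by (auto elim!: carr_cases)
  have "(\<lambda>n. ip (vs c (X n)) (Z n)) \<longlonglongrightarrow> c * hinner completion \<xi> \<zeta>"
    using tendsto_mult_left[OF hinner_cls[OF X(1) Z(1)], of c] X Z by (simp add: ip_scale cauchy_closed)
  then show "hinner completion (hscale completion c \<xi>) \<zeta> = c * hinner completion \<xi> \<zeta>"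
    using X Z by (simp add: hscale_cls hinner_cls_eq cauchy_scale)
qed

interpretation C: semi_inner "carr completion" "hzero completion" "hadd completion" "hscale completion" "hinner completion"
  by (rule semi_inner_completion)

lemma cauchy_dif: "X \<in> cauchy \<Longrightarrow> Y \<in> cauchy \<Longrightarrow> (\<lambda>n. dif (X n) (Y n)) \<in> cauchy"
  unfolding dif_def by (intro cauchy_add cauchy_scale)

lemma dif_cls: "X \<in> cauchy \<Longrightarrow> Y \<in> cauchy \<Longrightarrow> C.dif (cls X) (cls Y) = cls (\<lambda>n. dif (X n) (Y n))"
  unfolding dif_def C.dif_def by (simp add: hscale_cls hadd_cls cauchy_scale)

lemma nrm_cls: "X \<in> cauchy \<Longrightarrow> (\<lambda>n. nrm (X n)) \<longlonglongrightarrow> C.nrm (cls X)"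
  unfolding nrm_def C.nrm_def by (intro tendsto_real_sqrt tendsto_Re hinner_cls)

lemma nrm_dif_cls:
  "X \<in> cauchy \<Longrightarrow> Y \<in> cauchy \<Longrightarrow> (\<lambda>n. nrm (dif (X n) (Y n))) \<longlonglongrightarrow> C.nrm (C.dif (cls X) (cls Y))"
  using nrm_cls[OF cauchy_dif] by (simp add: dif_cls)

lemma nrm_dif_cls_le:
  assumes X: "X \<in> cauchy" and Y: "Y \<in> cauchy" and "\<And>n. n \<ge> N \<Longrightarrow> nrm (dif (X n) (Y n)) \<le> e"
  shows "C.nrm (C.dif (cls X) (cls Y)) \<le> e"
  by (rule LIMSEQ_le_const2[OF nrm_dif_cls[OF X Y]]) (use assms(3) in auto)

text \<open>For completeness take a diagonal sequence: \<open>Y k\<close> is a term of a representative of the \<open>k\<close>-th class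
  beyond which this representative varies by less than \<open>1 / (k + 1)\<close>.  The constant sequence \<open>Y k\<close> is
  then that close to the \<open>k\<close>-th class.\<close>

lemma chilbert_completion: "chilbert completion"
proof
  fix \<xi> \<eta> assume "\<xi> \<in> carr completion" "\<eta> \<in> carr completion"
    and eq: "\<And>\<zeta>. \<zeta> \<in> carr completion \<Longrightarrow> hinner completion \<xi> \<zeta> = hinner completion \<eta> \<zeta>"
  then obtain X Y where X: "X \<in> cauchy" "\<xi> = cls X" and Y: "Y \<in> cauchy" "\<eta> = cls Y" by (auto elim!: carr_cases)
  have "C.nrm (C.dif \<xi> \<eta>) = C.nrm (C.dif \<eta> \<eta>)"
    by (rule C.nrm_cong) (use X Y eq in \<open>auto simp: C.ip_dif\<close>)
  also have "\<dots> = 0" using Y by (intro C.nrm_dif_self) auto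
  finally show "\<xi> = \<eta>"
    using nrm_dif_cls[OF X(1) Y(1)] X Y by (simp add: cls_eq_iff) (simp add: equi_def)
next
  fix \<Xi> :: "nat \<Rightarrow> (nat \<Rightarrow> 'a) set"
  assume \<Xi>: "\<And>k. \<Xi> k \<in> carr completion"
    and ca: "\<And>e. 0 < e \<Longrightarrow> \<exists>N. \<forall>m\<ge>N. \<forall>n\<ge>N. C.nrm (C.dif (\<Xi> m) (\<Xi> n)) < e"
  have "\<exists>X. X \<in> cauchy \<and> \<Xi> k = cls X" for k using carr_cases[OF \<Xi>[of k]] by metis
  then obtain X where X: "\<And>k. X k \<in> cauchy" "\<And>k. \<Xi> k = cls (X k)" by metis
  define r where "r k = 1 / real (Suc k)" for k
  have r: "0 < r k" for k by (simp add: r_def)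
  have r0: "r \<longlonglongrightarrow> 0" unfolding r_def by (rule LIMSEQ_Suc[OF lim_1_over_n])
  have "\<exists>N. \<forall>m\<ge>N. \<forall>n\<ge>N. nrm (dif (X k m) (X k n)) < r k" for k
    by (rule cauchyD[OF X(1) r])
  then obtain i where i: "\<And>k m n. m \<ge> i k \<Longrightarrow> n \<ge> i k \<Longrightarrow> nrm (dif (X k m) (X k n)) < r k" by metis
  define Y where "Y k = X k (i k)" for k
  have YV: "Y k \<in> V" for k using cauchy_closed[OF X(1)] by (simp add: Y_def)
  have YX: "C.nrm (C.dif (\<Xi> k) (cls (\<lambda>_. Y k))) \<le> r k" for k
    unfolding X(2) by (rule nrm_dif_cls_le[where N = "i k"]) (use X YV i in \<open>auto simp: cauchy_const Y_def intro: less_imp_le\<close>)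
  have YY: "nrm (dif (Y k) (Y l)) \<le> r k + C.nrm (C.dif (\<Xi> k) (\<Xi> l)) + r l" for k l
  proof -
    have "nrm (dif (Y k) (Y l)) = C.nrm (C.dif (cls (\<lambda>_. Y k)) (cls (\<lambda>_. Y l)))"
      using nrm_dif_cls[OF cauchy_const cauchy_const, OF YV YV, of k l] by (simp add: LIMSEQ_const_iff)
    also have "\<dots> \<le> C.nrm (C.dif (cls (\<lambda>_. Y k)) (\<Xi> k)) + C.nrm (C.dif (\<Xi> k) (cls (\<lambda>_. Y l)))"
      using YV \<Xi> by (intro C.nrm_dif_triangle) (auto simp: cauchy_const)
    also have "C.nrm (C.dif (\<Xi> k) (cls (\<lambda>_. Y l))) \<le> C.nrm (C.dif (\<Xi> k) (\<Xi> l)) + C.nrm (C.dif (\<Xi> l) (cls (\<lambda>_. Y l)))"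
      using YV \<Xi> by (intro C.nrm_dif_triangle) (auto simp: cauchy_const)
    also have "C.nrm (C.dif (cls (\<lambda>_. Y k)) (\<Xi> k)) = C.nrm (C.dif (\<Xi> k) (cls (\<lambda>_. Y k)))"
      using YV \<Xi> by (intro C.nrm_dif_commute) (auto simp: cauchy_const)
    finally show ?thesis using YX[of k] YX[of l] by linarith
  qed
  have Yc: "Y \<in> cauchy"
    unfolding cauchy_iff
  proof (intro conjI allI impI YV)
    fix e :: real assume e: "0 < e"
    obtain N where N: "\<And>m n. m \<ge> N \<Longrightarrow> n \<ge> N \<Longrightarrow> C.nrm (C.dif (\<Xi> m) (\<Xi> n)) < e / 3"
      using ca[of "e / 3"] e by auto
    obtain M where M: "\<And>k. k \<ge> M \<Longrightarrow> \<bar>r k\<bar> < e / 3" using LIMSEQ_D[OF r0, of "e / 3"] e by auto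
    have "nrm (dif (Y m) (Y n)) < e" if "m \<ge> max M N" "n \<ge> max M N" for m n
    proof -
      have "C.nrm (C.dif (\<Xi> m) (\<Xi> n)) < e / 3" "\<bar>r m\<bar> < e / 3" "\<bar>r n\<bar> < e / 3"
        using that N[of m n] M[of m] M[of n] by auto
      then show ?thesis using YY[of m n] by linarith
    qed
    then show "\<exists>N. \<forall>m\<ge>N. \<forall>n\<ge>N. nrm (dif (Y m) (Y n)) < e" by blast
  qed
  have "C.cvg \<Xi> (cls Y)"
    unfolding C.cvg_def
  proof (rule LIMSEQ_I)
    fix e :: real assume e: "0 < e"
    obtain N where N: "\<And>m n. m \<ge> N \<Longrightarrow> n \<ge> N \<Longrightarrow> nrm (dif (Y m) (Y n)) < e / 3"
      using cauchyD[OF Yc, of "e / 3"] e by auto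
    obtain M where M: "\<And>k. k \<ge> M \<Longrightarrow> \<bar>r k\<bar> < e / 3" using LIMSEQ_D[OF r0, of "e / 3"] e by auto
    have "C.nrm (C.dif (\<Xi> k) (cls Y)) < e" if k: "k \<ge> max M N" for k
    proof -
      have "C.nrm (C.dif (\<Xi> k) (cls Y)) \<le> C.nrm (C.dif (\<Xi> k) (cls (\<lambda>_. Y k))) + C.nrm (C.dif (cls (\<lambda>_. Y k)) (cls Y))"
        using YV \<Xi> Yc by (intro C.nrm_dif_triangle) (auto simp: cauchy_const)
      moreover have "C.nrm (C.dif (cls (\<lambda>_. Y k)) (cls Y)) \<le> e / 3"
        by (rule nrm_dif_cls_le[where N = N]) (use Yc YV N k in \<open>auto simp: cauchy_const intro: less_imp_le\<close>)
      moreover have "\<bar>r k\<bar> < e / 3" using M k by auto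
      ultimately show ?thesis using YX[of k] e by linarith
    qed
    then show "\<exists>N. \<forall>k\<ge>N. norm (C.nrm (C.dif (\<Xi> k) (cls Y)) - 0) < e"
      using \<Xi> Yc by (intro exI[of _ "max M N"]) auto
  qed
  then show "\<exists>\<xi>\<in>carr completion. C.cvg \<Xi> \<xi>" using Yc by blast
qed

text \<open>Symmetry and the two bounds on the form are closed conditions, so they pass to limits.\<close>

lemma bounded_positive_extend_op:
  assumes A: "\<And>u. u \<in> V \<Longrightarrow> A u \<in> V"
    and C: "\<And>u v. u \<in> V \<Longrightarrow> v \<in> V \<Longrightarrow> nrm (dif (A u) (A v)) \<le> C * nrm (dif u v)"
    and sa: "\<And>u v. u \<in> V \<Longrightarrow> v \<in> V \<Longrightarrow> ip (A u) v = ip u (A v)"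
    and pos: "\<And>u. u \<in> V \<Longrightarrow> 0 \<le> Re (ip (A u) u)"
    and le: "\<And>u. u \<in> V \<Longrightarrow> Re (ip (A u) u) \<le> c * Re (ip u u)"
    and c: "0 < c"
  shows "bounded_positive completion (extend_op A) c"
proof -
  interpret chilbert completion by (rule chilbert_completion)
  note ext = extend_op_cls[OF _ A C] and ca = cauchy_lipschitz[OF _ A C]
  show ?thesis
  proof
    fix \<xi> assume "\<xi> \<in> carr completion"
    then obtain X where X: "X \<in> cauchy" "\<xi> = cls X" by (auto elim!: carr_cases)
    show "extend_op A \<xi> \<in> carr completion" using X ca by (simp add: ext)
    note XV = cauchy_closed[OF X(1)]
    have l1: "(\<lambda>n. Re (ip (A (X n)) (X n))) \<longlonglongrightarrow> Re (hinner completion (extend_op A \<xi>) \<xi>)"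
      using tendsto_Re[OF hinner_cls[OF ca[OF X(1)] X(1)]] X ext by simp
    have l2: "(\<lambda>n. c * Re (ip (X n) (X n))) \<longlonglongrightarrow> c * Re (hinner completion \<xi> \<xi>)"
      using tendsto_mult_left[OF tendsto_Re[OF hinner_cls[OF X(1) X(1)]], of c] X by simp
    show "0 \<le> Re (hinner completion (extend_op A \<xi>) \<xi>)"
      by (rule LIMSEQ_le_const[OF l1]) (use pos XV in auto)
    show "Re (hinner completion (extend_op A \<xi>) \<xi>) \<le> c * Re (hinner completion \<xi> \<xi>)"
      by (rule LIMSEQ_le[OF l1 l2]) (use le XV in auto)
  next
    fix \<xi> \<eta> assume "\<xi> \<in> carr completion" "\<eta> \<in> carr completion"
    then obtain X Y where X: "X \<in> cauchy" "\<xi> = cls X" and Y: "Y \<in> cauchy" "\<eta> = cls Y" by (auto elim!: carr_cases)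
    have "(\<lambda>n. ip (X n) (A (Y n))) \<longlonglongrightarrow> hinner completion (extend_op A \<xi>) \<eta>"
      using hinner_cls[OF ca[OF X(1)] Y(1)] X Y ext by (simp add: sa cauchy_closed)
    then show "hinner completion (extend_op A \<xi>) \<eta> = hinner completion \<xi> (extend_op A \<eta>)"
      using X Y ext ca by (simp add: hinner_cls_eq)
  qed (rule c)
qed

lemma extend_op_bounded:
  assumes A: "\<And>u. u \<in> V \<Longrightarrow> A u \<in> V"
    and C: "\<And>u v. u \<in> V \<Longrightarrow> v \<in> V \<Longrightarrow> nrm (dif (A u) (A v)) \<le> C * nrm (dif u v)"
    and C': "\<And>u. u \<in> V \<Longrightarrow> nrm (A u) \<le> C * nrm u"
    and \<xi>: "\<xi> \<in> carr completion"
  shows "hnorm completion (extend_op A \<xi>) \<le> C * hnorm completion \<xi>"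
proof -
  interpret K: chilbert completion by (rule chilbert_completion)
  obtain X where X: "X \<in> cauchy" "\<xi> = cls X" using \<xi> by (auto elim!: carr_cases)
  have 1: "(\<lambda>n. nrm (A (X n))) \<longlonglongrightarrow> C.nrm (extend_op A \<xi>)"
    using nrm_cls[OF cauchy_lipschitz[OF X(1) A C]] X extend_op_cls[OF X(1) A C] by simp
  have 2: "(\<lambda>n. C * nrm (X n)) \<longlonglongrightarrow> C * C.nrm \<xi>"
    using tendsto_mult_left[OF nrm_cls[OF X(1)], of C] X by simp
  show ?thesis
    unfolding K.hnorm_eq by (rule LIMSEQ_le[OF 1 2]) (use C' cauchy_closed[OF X(1)] in auto)
qed

lemma extend_op_pow_cls:
  assumes A: "\<And>u. u \<in> V \<Longrightarrow> A u \<in> V"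
    and C: "\<And>u v. u \<in> V \<Longrightarrow> v \<in> V \<Longrightarrow> nrm (dif (A u) (A v)) \<le> C * nrm (dif u v)"
    and X: "X \<in> cauchy"
  shows "(extend_op A ^^ k) (cls X) = cls (\<lambda>n. (A ^^ k) (X n))" "(\<lambda>n. (A ^^ k) (X n)) \<in> cauchy"
proof (induction k)
  case (Suc k)
  show "(\<lambda>n. (A ^^ Suc k) (X n)) \<in> cauchy" using cauchy_lipschitz[OF Suc(2) A C] by simp
  show "(extend_op A ^^ Suc k) (cls X) = cls (\<lambda>n. (A ^^ Suc k) (X n))"
    using extend_op_cls[OF Suc(2) A C] Suc(1) by simp
qed (use X in simp_all)

end

section \<open>Balls, patterns and the trace\<close>

lemma infsum_finite_support:
  fixes f :: "'a \<Rightarrow> complex"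
  assumes "finite S" "\<And>x. x \<notin> S \<Longrightarrow> f x = 0"
  shows "infsum f UNIV = sum f S"
proof -
  have "infsum f UNIV = infsum f S" by (rule infsum_cong_neutral) (use assms in auto)
  then show ?thesis using assms by simp
qed

locale aq_graph =
  fixes E :: "'v rel"
  assumes AQ: "AQ_graph E"
begin

abbreviation "d \<equiv> graph_dist E"
abbreviation "gball \<equiv> graph_ball E"
abbreviation "PG \<equiv> pattern_invariant E"

lemma symE: "(x, y) \<in> E \<Longrightarrow> (y, x) \<in> E"
  using AQ by (auto simp: AQ_graph_def simple_graph_def dest: symD)

lemma relpow_sym: "(x, y) \<in> E ^^ n \<Longrightarrow> (y, x) \<in> E ^^ n"
proof (induction n arbitrary: y)
  case (Suc n)
  then obtain z where "(x, z) \<in> E ^^ n" "(z, y) \<in> E" by auto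
  then show ?case using Suc.IH symE by (intro relpow_Suc_I2) auto
qed simp

lemma relpow_dist: "(x, y) \<in> E ^^ d x y"
proof -
  have "(x, y) \<in> E\<^sup>*" using AQ by (auto simp: AQ_graph_def connected_graph_def)
  then have "\<exists>n. (x, y) \<in> E ^^ n" by (rule rtrancl_imp_relpow)
  then show ?thesis unfolding graph_dist_def by (rule LeastI_ex)
qed

lemma dist_le: "(x, y) \<in> E ^^ n \<Longrightarrow> d x y \<le> n"
  unfolding graph_dist_def by (rule Least_le)

lemma dist_self [simp]: "d x x = 0"
  using dist_le[of x x 0] by simp

lemma dist_eq_0: "d x y = 0 \<longleftrightarrow> x = y"
  using relpow_dist[of x y] by auto

lemma dist_sym: "d x y = d y x"
  by (rule antisym; rule dist_le; rule relpow_sym; rule relpow_dist)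

lemma dist_triangle: "d x z \<le> d x y + d y z"
  by (rule dist_le) (unfold relpow_add, rule relcompI[OF relpow_dist relpow_dist])

lemma mem_ball: "y \<in> gball r x \<longleftrightarrow> d x y \<le> r"
  by (simp add: graph_ball_def)

lemma center_mem_ball [simp]: "x \<in> gball r x"
  by (simp add: mem_ball)

lemma mem_ball_sym: "y \<in> gball r x \<longleftrightarrow> x \<in> gball r y"
  by (simp add: mem_ball dist_sym)

lemma ball_mono: "r \<le> s \<Longrightarrow> gball r x \<subseteq> gball s x"
  by (auto simp: mem_ball)

lemma ball_card_bound: "\<exists>K. \<forall>x. finite (gball r x) \<and> card (gball r x) \<le> K"
proof (induction r)
  case 0
  have "gball 0 x = {x}" for x by (auto simp: mem_ball dist_eq_0)
  then show ?case by (intro exI[of _ 1]) simp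
next
  case (Suc r)
  then obtain K where K: "\<And>x. finite (gball r x)" "\<And>x. card (gball r x) \<le> K" by blast
  obtain D where D: "\<And>x. finite {y. (x, y) \<in> E}" "\<And>x. card {y. (x, y) \<in> E} \<le> D"
    using AQ unfolding AQ_graph_def bounded_degree_def by blast
  have "finite (gball (Suc r) x) \<and> card (gball (Suc r) x) \<le> K + K * D" for x
  proof -
    let ?U = "gball r x \<union> (\<Union>z\<in>gball r x. {y. (z, y) \<in> E})"
    have sub: "gball (Suc r) x \<subseteq> ?U"
    proof
      fix y assume y: "y \<in> gball (Suc r) x"
      show "y \<in> ?U"
      proof (cases "d x y \<le> r")
        case False
        with y have "d x y = Suc r" by (simp add: mem_ball)
        then obtain z where "(x, z) \<in> E ^^ r" "(z, y) \<in> E" using relpow_dist[of x y] by auto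
        then show ?thesis using dist_le[of x z r] by (auto simp: mem_ball)
      qed (simp add: mem_ball)
    qed
    have fin: "finite ?U" using K D by auto
    have "card ?U \<le> card (gball r x) + card (\<Union>z\<in>gball r x. {y. (z, y) \<in> E})" by (rule card_Un_le)
    also have "card (\<Union>z\<in>gball r x. {y. (z, y) \<in> E}) \<le> (\<Sum>z\<in>gball r x. card {y. (z, y) \<in> E})"
      by (rule card_UN_le[OF K(1)])
    also have "\<dots> \<le> (\<Sum>z\<in>gball r x. D)" by (rule sum_mono) (rule D)
    also have "\<dots> \<le> K * D" using K(2)[of x] by simp
    finally have "card ?U \<le> K + K * D" using K(2)[of x] by simp
    then show ?thesis using fin sub card_mono[OF fin sub] finite_subset[OF sub fin] by simp
  qed
  then show ?case by blast
qed

definition ballcard :: "nat \<Rightarrow> nat" where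
  "ballcard r = (SOME K. \<forall>x. finite (gball r x) \<and> card (gball r x) \<le> K)"

lemma ballcard: "finite (gball r x)" "card (gball r x) \<le> ballcard r"
  using someI_ex[OF ball_card_bound[of r]] unfolding ballcard_def by blast+

declare ballcard(1) [simp, intro]

subsection \<open>Isomorphisms of balls\<close>

lemma ball_isoD:
  assumes "ball_iso E r x x' \<phi>"
  shows "bij_betw \<phi> (gball r x) (gball r x')" "\<phi> x = x'"
    "u \<in> gball r x \<Longrightarrow> v \<in> gball r x \<Longrightarrow> (u, v) \<in> E \<longleftrightarrow> (\<phi> u, \<phi> v) \<in> E"
  using assms by (auto simp: ball_iso_def)

lemma ball_iso_mem: "ball_iso E r x x' \<phi> \<Longrightarrow> u \<in> gball r x \<Longrightarrow> \<phi> u \<in> gball r x'"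
  using ball_isoD(1) by (metis bij_betwE)

lemma ball_iso_inverse:
  assumes "ball_iso E r x x' \<phi>"
  defines "\<psi> \<equiv> inv_into (gball r x) \<phi>"
  shows "ball_iso E r x' x \<psi>" "u \<in> gball r x \<Longrightarrow> \<psi> (\<phi> u) = u" "v \<in> gball r x' \<Longrightarrow> \<phi> (\<psi> v) = v"
proof -
  note b = ball_isoD[OF assms(1)]
  show 1: "u \<in> gball r x \<Longrightarrow> \<psi> (\<phi> u) = u" for u
    using b(1) by (simp add: \<psi>_def bij_betw_inv_into_left)
  show 2: "v \<in> gball r x' \<Longrightarrow> \<phi> (\<psi> v) = v" for v
    using b(1) by (simp add: \<psi>_def bij_betw_inv_into_right)
  have b': "bij_betw \<psi> (gball r x') (gball r x)"
    unfolding \<psi>_def by (rule bij_betw_inv_into[OF b(1)])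
  show "ball_iso E r x' x \<psi>"
    unfolding ball_iso_def
  proof (intro conjI ballI b')
    show "\<psi> x' = x" using 1[of x] b(2) by simp
    fix u v assume uv: "u \<in> gball r x'" "v \<in> gball r x'"
    then have "\<psi> u \<in> gball r x" "\<psi> v \<in> gball r x" using b' by (auto dest: bij_betwE)
    from b(3)[OF this] show "(u, v) \<in> E \<longleftrightarrow> (\<psi> u, \<psi> v) \<in> E" using uv by (simp add: 2)
  qed
qed

text \<open>An isomorphism of balls maps paths inside the ball to paths.  The condition guarantees that a
  shortest path from \<open>z\<close> to \<open>u\<close> stays in the ball; for other pairs of points distances need not be
  preserved.\<close>

lemma ball_iso_dist_le:
  assumes iso: "ball_iso E r x x' \<phi>" and le: "d x z + d z u \<le> r"
  shows "d (\<phi> z) (\<phi> u) \<le> d z u"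
proof -
  have "(z, u) \<in> E ^^ n \<Longrightarrow> d x z + n \<le> r \<Longrightarrow> (\<phi> z, \<phi> u) \<in> E ^^ n" for n
  proof (induction n arbitrary: u)
    case (Suc n)
    then obtain w where w: "(z, w) \<in> E ^^ n" "(w, u) \<in> E" by auto
    have "d z w \<le> n" "d z u \<le> Suc n" by (rule dist_le, rule w, rule dist_le, rule Suc.prems)
    then have "w \<in> gball r x" "u \<in> gball r x"
      using dist_triangle[of x w z] dist_triangle[of x u z] Suc.prems by (auto simp: mem_ball)
    then have "(\<phi> w, \<phi> u) \<in> E" using ball_isoD(3)[OF iso] w(2) by blast
    moreover have "(\<phi> z, \<phi> w) \<in> E ^^ n" using Suc.IH[OF w(1)] Suc.prems by simp
    ultimately show ?case by auto
  qed simp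
  from this[OF relpow_dist le] show ?thesis by (rule dist_le)
qed

lemma ball_iso_dist_center_le:
  "ball_iso E r x x' \<phi> \<Longrightarrow> u \<in> gball r x \<Longrightarrow> d x' (\<phi> u) \<le> d x u"
  using ball_iso_dist_le[of r x x' \<phi> x u] ball_isoD(2)[of r x x' \<phi>] by (simp add: mem_ball)

lemma ball_iso_dist_ge:
  assumes iso: "ball_iso E r x x' \<phi>" and z: "z \<in> gball r x" and u: "u \<in> gball r x" and le: "d x z + d (\<phi> z) (\<phi> u) \<le> r"
  shows "d z u \<le> d (\<phi> z) (\<phi> u)"
proof -
  note inv = ball_iso_inverse[OF iso]
  have "d x' (\<phi> z) + d (\<phi> z) (\<phi> u) \<le> r"
    using ball_iso_dist_center_le[OF iso z] le by simp
  from ball_iso_dist_le[OF inv(1) this] show ?thesis using inv(2) z u by simp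
qed

text \<open>Entries of products and adjoints involve balls around points \<open>z\<close> near \<open>x\<close>, so an isomorphism of a
  large ball has to be restricted to smaller ones with another center.\<close>

lemma ball_iso_restrict:
  assumes iso: "ball_iso E r x x' \<phi>" and le: "d x z + s \<le> r"
  shows "ball_iso E s z (\<phi> z) \<phi>"
proof -
  note inv = ball_iso_inverse[OF iso]
  let ?\<psi> = "inv_into (gball r x) \<phi>"
  have z: "z \<in> gball r x" using le by (simp add: mem_ball)
  have sub: "gball s z \<subseteq> gball r x"
  proof
    fix u assume "u \<in> gball s z"
    then show "u \<in> gball r x" using dist_triangle[of x u z] le by (simp add: mem_ball)
  qed
  have z': "d x' (\<phi> z) + s \<le> r" using ball_iso_dist_center_le[OF iso z] le by simp
  have sub': "gball s (\<phi> z) \<subseteq> gball r x'"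
  proof
    fix u assume "u \<in> gball s (\<phi> z)"
    then show "u \<in> gball r x'" using dist_triangle[of x' u "\<phi> z"] z' by (simp add: mem_ball)
  qed
  have "\<phi> ` gball s z = gball s (\<phi> z)"
  proof
    show "\<phi> ` gball s z \<subseteq> gball s (\<phi> z)"
    proof
      fix v assume "v \<in> \<phi> ` gball s z"
      then obtain u where u: "d z u \<le> s" "v = \<phi> u" by (auto simp: mem_ball)
      have "d (\<phi> z) (\<phi> u) \<le> d z u" by (rule ball_iso_dist_le[OF iso]) (use u le in simp)
      then show "v \<in> gball s (\<phi> z)" using u by (simp add: mem_ball)
    qed
    show "gball s (\<phi> z) \<subseteq> \<phi> ` gball s z"
    proof
      fix v assume v: "v \<in> gball s (\<phi> z)"
      then have "d (\<phi> z) v \<le> s" by (simp add: mem_ball)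
      then have "d (?\<psi> (\<phi> z)) (?\<psi> v) \<le> d (\<phi> z) v"
        using z' by (intro ball_iso_dist_le[OF inv(1)]) simp
      then have "?\<psi> v \<in> gball s z" using \<open>d (\<phi> z) v \<le> s\<close> inv(2)[OF z] by (simp add: mem_ball)
      moreover have "\<phi> (?\<psi> v) = v" using inv(3) sub' v by blast
      ultimately show "v \<in> \<phi> ` gball s z" by (metis imageI)
    qed
  qed
  moreover have "inj_on \<phi> (gball s z)"
    using ball_isoD(1)[OF iso] sub by (meson bij_betw_imp_inj_on inj_on_subset)
  ultimately show ?thesis
    using ball_isoD(3)[OF iso] sub unfolding ball_iso_def bij_betw_def by blast
qed

subsection \<open>The algebra of pattern-invariant matrices\<close>

text \<open>Pattern invariance with the propagation as a parameter.\<close>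

definition inv_kernel :: "nat \<Rightarrow> 'v kernel \<Rightarrow> bool" where
  "inv_kernel r A \<longleftrightarrow> (\<forall>x y. d x y > r \<longrightarrow> A x y = 0) \<and>
     (\<forall>x x' \<phi>. ball_iso E r x x' \<phi> \<longrightarrow> (\<forall>y\<in>gball r x. A x y = A (\<phi> x) (\<phi> y)))"

lemma PG_iff: "A \<in> PG \<longleftrightarrow> (\<exists>r. inv_kernel r A)"
  by (simp add: pattern_invariant_def inv_kernel_def)

lemma inv_kernel_far: "inv_kernel r A \<Longrightarrow> r < d x y \<Longrightarrow> A x y = 0"
  unfolding inv_kernel_def by blast

lemma inv_kernel_iso:
  "inv_kernel r A \<Longrightarrow> ball_iso E r x x' \<phi> \<Longrightarrow> y \<in> gball r x \<Longrightarrow> A x y = A (\<phi> x) (\<phi> y)"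
  unfolding inv_kernel_def by blast

lemma inv_kernel_zero: "inv_kernel r A \<Longrightarrow> y \<notin> gball r x \<Longrightarrow> A x y = 0"
  by (rule inv_kernel_far) (simp_all add: mem_ball not_le)

text \<open>Invariance in rows other than that of the center.  Within the propagation it holds by
  restriction of the isomorphism; outside both entries vanish, because the isomorphism cannot bring
  distant points within distance \<open>r\<close>.\<close>

lemma inv_kernel_eq:
  assumes A: "inv_kernel r A" and iso: "ball_iso E R x x' \<phi>" and z: "d x z + r \<le> R" and y: "y \<in> gball R x"
  shows "A z y = A (\<phi> z) (\<phi> y)"
proof (cases "y \<in> gball r z")
  case True
  then show ?thesis
    by (rule inv_kernel_iso[OF A ball_iso_restrict[OF iso z]])
next
  case False
  have "\<not> d (\<phi> z) (\<phi> y) \<le> r"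
  proof
    assume le: "d (\<phi> z) (\<phi> y) \<le> r"
    have "d z y \<le> d (\<phi> z) (\<phi> y)"
      using z y le by (intro ball_iso_dist_ge[OF iso]) (auto simp: mem_ball)
    with le False show False by (simp add: mem_ball)
  qed
  then show ?thesis using False by (simp add: inv_kernel_far[OF A] mem_ball)
qed

lemma inv_kernelI:
  assumes "\<And>x y. d x y > r \<Longrightarrow> A x y = 0"
    and "\<And>x x' \<phi> y. ball_iso E r x x' \<phi> \<Longrightarrow> y \<in> gball r x \<Longrightarrow> A x y = A (\<phi> x) (\<phi> y)"
  shows "inv_kernel r A"
  unfolding inv_kernel_def by (intro conjI allI impI ballI; rule assms; assumption)

lemma inv_kernel_mono: "inv_kernel r A \<Longrightarrow> r \<le> R \<Longrightarrow> inv_kernel R A"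
proof (rule inv_kernelI)
  fix x x' \<phi> y assume A: "inv_kernel r A" "r \<le> R" "ball_iso E R x x' \<phi>" "y \<in> gball R x"
  show "A x y = A (\<phi> x) (\<phi> y)" by (rule inv_kernel_eq[OF A(1,3)]) (use A in auto)
qed (simp add: inv_kernel_far)

lemma PG_zero: "(\<lambda>x y. 0) \<in> PG"
  unfolding PG_iff by (intro exI[of _ 0] inv_kernelI) auto

lemma PG_add:
  assumes "A \<in> PG" "B \<in> PG"
  shows "(\<lambda>x y. A x y + B x y) \<in> PG"
proof -
  obtain r s where A: "inv_kernel r A" and B: "inv_kernel s B" using assms by (auto simp: PG_iff)
  have A': "inv_kernel (max r s) A" by (rule inv_kernel_mono[OF A]) simp
  have B': "inv_kernel (max r s) B" by (rule inv_kernel_mono[OF B]) simp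
  have "inv_kernel (max r s) (\<lambda>x y. A x y + B x y)"
  proof (rule inv_kernelI)
    fix x x' \<phi> y assume i: "ball_iso E (max r s) x x' \<phi>" "y \<in> gball (max r s) x"
    show "A x y + B x y = A (\<phi> x) (\<phi> y) + B (\<phi> x) (\<phi> y)"
      using inv_kernel_iso[OF A' i] inv_kernel_iso[OF B' i] by argo
  qed (simp add: inv_kernel_far[OF A'] inv_kernel_far[OF B'])
  then show ?thesis unfolding PG_iff by blast
qed

lemma PG_scale:
  assumes "A \<in> PG"
  shows "(\<lambda>x y. c * A x y) \<in> PG"
proof -
  obtain r where A: "inv_kernel r A" using assms by (auto simp: PG_iff)
  have "inv_kernel r (\<lambda>x y. c * A x y)"
  proof (rule inv_kernelI)
    fix x x' \<phi> y assume "ball_iso E r x x' \<phi>" "y \<in> gball r x"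
    then show "c * A x y = c * A (\<phi> x) (\<phi> y)" by (rule arg_cong[OF inv_kernel_iso[OF A]])
  qed (simp add: inv_kernel_far[OF A])
  then show ?thesis unfolding PG_iff by blast
qed

lemma PG_one: "kernel_one \<in> PG"
  unfolding PG_iff
  by (intro exI[of _ 0] inv_kernelI) (auto simp: kernel_one_def mem_ball dist_eq_0)

text \<open>The radius doubles, since the entry \<open>A y x\<close> is governed by the \<open>r\<close>-ball around \<open>y\<close>.\<close>

lemma PG_adj:
  assumes "A \<in> PG"
  shows "kernel_adj A \<in> PG"
proof -
  obtain r where A: "inv_kernel r A" using assms by (auto simp: PG_iff)
  have "inv_kernel (2 * r) (kernel_adj A)"
  proof (rule inv_kernelI)
    fix x y assume "d x y > 2 * r"
    then show "kernel_adj A x y = 0"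
      using inv_kernel_zero[OF A, of x y] by (simp add: kernel_adj_def mem_ball dist_sym[of y x])
  next
    fix x x' \<phi> y assume iso: "ball_iso E (2 * r) x x' \<phi>" and y: "y \<in> gball (2 * r) x"
    have "A y x = A (\<phi> y) (\<phi> x)"
    proof (cases "d x y \<le> r")
      case True
      then show ?thesis by (intro inv_kernel_eq[OF A iso]) auto
    next
      case False
      have "\<not> d (\<phi> x) (\<phi> y) \<le> r"
      proof
        assume le: "d (\<phi> x) (\<phi> y) \<le> r"
        then have "d x y \<le> d (\<phi> x) (\<phi> y)" using y by (intro ball_iso_dist_ge[OF iso]) auto
        with le False show False by simp
      qed
      then show ?thesis
        using False inv_kernel_zero[OF A] by (simp add: mem_ball dist_sym[of y x] dist_sym[of "\<phi> y" "\<phi> x"])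
    qed
    then show "kernel_adj A x y = kernel_adj A (\<phi> x) (\<phi> y)" by (simp add: kernel_adj_def)
  qed
  then show ?thesis unfolding PG_iff by blast
qed

lemma kernel_mult_eq_sum:
  assumes A: "inv_kernel r A"
  shows "kernel_mult A B x y = (\<Sum>z\<in>gball r x. A x z * B z y)"
  unfolding kernel_mult_def
  by (rule infsum_finite_support) (use inv_kernel_zero[OF A] in auto)

lemma PG_mult:
  assumes "A \<in> PG" "B \<in> PG"
  shows "kernel_mult A B \<in> PG"
proof -
  obtain r s where A: "inv_kernel r A" and B: "inv_kernel s B" using assms by (auto simp: PG_iff)
  have "inv_kernel (r + s) (kernel_mult A B)"
  proof (rule inv_kernelI)
    fix x y assume far: "d x y > r + s"
    have "B z y = 0" if "z \<in> gball r x" for z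
      using that far dist_triangle[of x y z] by (intro inv_kernel_zero[OF B]) (auto simp: mem_ball)
    then show "kernel_mult A B x y = 0" by (simp add: kernel_mult_eq_sum[OF A])
  next
    fix x x' \<phi> y assume iso: "ball_iso E (r + s) x x' \<phi>" and y: "y \<in> gball (r + s) x"
    have bij: "bij_betw \<phi> (gball r x) (gball r (\<phi> x))"
      by (rule ball_isoD(1)[OF ball_iso_restrict[OF iso]]) simp
    have "kernel_mult A B (\<phi> x) (\<phi> y) = (\<Sum>z\<in>gball r x. A (\<phi> x) (\<phi> z) * B (\<phi> z) (\<phi> y))"
      unfolding kernel_mult_eq_sum[OF A] by (rule sum.reindex_bij_betw[OF bij, symmetric])
    also have "\<dots> = (\<Sum>z\<in>gball r x. A x z * B z y)"
    proof (intro sum.cong refl)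
      fix z assume z: "z \<in> gball r x"
      have "A x z = A (\<phi> x) (\<phi> z)"
        using z by (intro inv_kernel_eq[OF A iso]) (auto simp: mem_ball)
      moreover have "B z y = B (\<phi> z) (\<phi> y)"
        using z y by (intro inv_kernel_eq[OF B iso]) (auto simp: mem_ball)
      ultimately show "A (\<phi> x) (\<phi> z) * B (\<phi> z) (\<phi> y) = A x z * B z y" by simp
    qed
    finally show "kernel_mult A B x y = kernel_mult A B (\<phi> x) (\<phi> y)"
      by (simp add: kernel_mult_eq_sum[OF A])
  qed
  then show ?thesis unfolding PG_iff by blast
qed

subsection \<open>Finitely many patterns\<close>

lemma same_pattern_equiv: "equiv UNIV {(x, y). same_pattern E r x y}"
proof (rule equivI)
  show "refl {(x, y). same_pattern E r x y}"
    by (auto simp: refl_on_def same_pattern_def ball_iso_def intro!: exI[of _ id])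
  show "sym {(x, y). same_pattern E r x y}"
    using ball_iso_inverse(1) by (fastforce simp: sym_def same_pattern_def)
  show "trans {(x, y). same_pattern E r x y}"
  proof (rule transI)
    fix x y z assume "(x, y) \<in> {(x, y). same_pattern E r x y}" "(y, z) \<in> {(x, y). same_pattern E r x y}"
    then obtain \<phi> \<psi> where \<phi>: "ball_iso E r x y \<phi>" and \<psi>: "ball_iso E r y z \<psi>" by (auto simp: same_pattern_def)
    have "ball_iso E r x z (\<psi> \<circ> \<phi>)"
      unfolding ball_iso_def
      using bij_betw_trans[OF ball_isoD(1)[OF \<phi>] ball_isoD(1)[OF \<psi>]] ball_isoD[OF \<phi>] ball_isoD[OF \<psi>] ball_iso_mem[OF \<phi>]
      by auto
    then show "(x, z) \<in> {(x, y). same_pattern E r x y}" by (auto simp: same_pattern_def)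
  qed
qed auto

lemma finite_range_factor:
  assumes "finite (range c)" "\<And>x y. c x = c y \<Longrightarrow> g x = g y"
  shows "finite (range g)"
proof -
  have "g x = (\<lambda>k. g (SOME y. c y = k)) (c x)" for x
    using someI[of "\<lambda>y. c y = c x" x] assms(2) by metis
  then have "range g \<subseteq> (\<lambda>k. g (SOME y. c y = k)) ` range c" by blast
  then show ?thesis using assms(1) by (meson finite_imageI finite_subset)
qed

text \<open>Numbering the points of a ball codes it by its size, the number of the root and the set of
  numbered edges.  Equal codes give isomorphic balls, and there are finitely many codes as the size of
  balls is bounded.\<close>

lemma finite_patterns: "finite (patterns E r)"
proof -
  have "\<exists>f. bij_betw f (gball r x) {..<card (gball r x)}" for x
    using ex_bij_betw_finite_nat[of "gball r x"] by (auto simp: atLeast0LessThan)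
  then obtain f where f: "\<And>x. bij_betw (f x) (gball r x) {..<card (gball r x)}" by metis
  define code where "code x = (card (gball r x), f x x, {(f x u, f x v) | u v. u \<in> gball r x \<and> v \<in> gball r x \<and> (u, v) \<in> E})" for x
  let ?K = "{..<Suc (ballcard r)}"
  have fK: "f x u \<in> ?K" if "u \<in> gball r x" for x u
    using bij_betwE[OF f] that ballcard(2)[of r x] by fastforce
  have "range code \<subseteq> ?K \<times> ?K \<times> Pow (?K \<times> ?K)"
    using fK ballcard(2) by (auto simp: code_def less_Suc_eq_le)
  then have fin: "finite (range code)" by (rule finite_subset) simp
  have edge: "(f x u, f x v) \<in> snd (snd (code x)) \<longleftrightarrow> (u, v) \<in> E" if "u \<in> gball r x" "v \<in> gball r x" for x u v
  proof -
    have "inj_on (f x) (gball r x)" using f by (auto simp: bij_betw_def)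
    with that show ?thesis by (auto simp: code_def inj_on_def)
  qed
  have same: "same_pattern E r x y" if eq: "code x = code y" for x y
  proof -
    define \<phi> where "\<phi> u = inv_into (gball r y) (f y) (f x u)" for u
    have card: "card (gball r x) = card (gball r y)" and root: "f x x = f y y" using eq by (auto simp: code_def)
    have fy: "f y (\<phi> u) = f x u" "\<phi> u \<in> gball r y" if "u \<in> gball r x" for u
    proof -
      have "f x u < card (gball r x)" using bij_betwE[OF f] that by auto
      then have "f x u \<in> f y ` gball r y" using f[of y] card by (simp add: bij_betw_def)
      then show "f y (\<phi> u) = f x u" "\<phi> u \<in> gball r y" by (auto simp: \<phi>_def f_inv_into_f inv_into_into)
    qed
    have bij: "bij_betw \<phi> (gball r x) (gball r y)"
      unfolding \<phi>_def using bij_betw_trans[OF f[of x] bij_betw_inv_into[OF f[of y], folded card]] by (simp add: o_def)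
    have injy: "inj_on (f y) (gball r y)" using f by (auto simp: bij_betw_def)
    have "(u, v) \<in> E \<longleftrightarrow> (\<phi> u, \<phi> v) \<in> E" if uv: "u \<in> gball r x" "v \<in> gball r x" for u v
    proof -
      have "(u, v) \<in> E \<longleftrightarrow> (f x u, f x v) \<in> snd (snd (code x))" by (rule edge[OF uv, symmetric])
      also have "\<dots> \<longleftrightarrow> (f y (\<phi> u), f y (\<phi> v)) \<in> snd (snd (code y))" using eq fy uv by simp
      also have "\<dots> \<longleftrightarrow> (\<phi> u, \<phi> v) \<in> E" by (rule edge[OF fy(2)[OF uv(1)] fy(2)[OF uv(2)]])
      finally show ?thesis .
    qed
    moreover have "\<phi> x = y" using injy by (simp add: \<phi>_def root inv_into_f_f)
    ultimately show ?thesis using bij by (auto simp: same_pattern_def ball_iso_def)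
  qed
  have "finite (range (\<lambda>x. {(x, y). same_pattern E r x y} `` {x}))"
    by (rule finite_range_factor[OF fin]) (rule equiv_class_eq[OF same_pattern_equiv], use same in auto)
  then show ?thesis unfolding patterns_def quotient_def by (rule rev_finite_subset) auto
qed

lemma pattern_const:
  assumes "\<alpha> \<in> patterns E r" "x \<in> \<alpha>" "y \<in> \<alpha>"
  obtains \<phi> where "ball_iso E r x y \<phi>"
  using quotient_eq_iff[OF same_pattern_equiv, of \<alpha> r \<alpha> x y] assms
  by (auto simp: patterns_def same_pattern_def)

text \<open>A row is determined by the pattern of its index.  Finiteness provides both a bound for the
  entries and, if they are rational, a common denominator.\<close>

lemma finite_kernel_values:
  assumes "A \<in> PG"
  shows "finite {A x y | x y. True}"
proof -
  obtain r where A: "inv_kernel r A" using assms by (auto simp: PG_iff)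
  define rep where "rep \<alpha> = (SOME x::'v. x \<in> \<alpha>)" for \<alpha>
  have "{A x y | x y. True} \<subseteq> insert 0 (\<Union>\<alpha>\<in>patterns E r. A (rep \<alpha>) ` gball r (rep \<alpha>))"
  proof clarify
    fix x y assume nz: "A x y \<notin> (\<Union>\<alpha>\<in>patterns E r. A (rep \<alpha>) ` gball r (rep \<alpha>))"
    let ?\<alpha> = "{(x, y). same_pattern E r x y} `` {x}"
    have \<alpha>: "?\<alpha> \<in> patterns E r" unfolding patterns_def by (rule quotientI) simp
    have x: "x \<in> ?\<alpha>" by (rule equiv_class_self[OF same_pattern_equiv]) simp
    then have "rep ?\<alpha> \<in> ?\<alpha>" unfolding rep_def by (rule someI)
    then obtain \<phi> where \<phi>: "ball_iso E r x (rep ?\<alpha>) \<phi>" using pattern_const[OF \<alpha> x] by blast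
    show "A x y = 0"
    proof (cases "y \<in> gball r x")
      case True
      then have "A x y = A (rep ?\<alpha>) (\<phi> y)" using inv_kernel_eq[OF A \<phi>, of x y] ball_isoD(2)[OF \<phi>] by simp
      moreover have "\<phi> y \<in> gball r (rep ?\<alpha>)" by (rule ball_iso_mem[OF \<phi> True])
      ultimately show ?thesis using nz \<alpha> by blast
    qed (rule inv_kernel_zero[OF A])
  qed
  then show ?thesis by (rule finite_subset) (simp add: finite_patterns)
qed

subsection \<open>Existence of the trace\<close>

lemma folner_exists: "\<exists>Q. folner_seq E Q"
  using AQ by (auto simp: AQ_graph_def amenable_graph_def)

text \<open>Diagonal entries depend on the pattern only, so their averages are finite combinations of pattern
  frequencies.\<close>

lemma trace_limit:
  assumes A: "A \<in> PG" and Q: "folner_seq E Q"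
  shows "(\<lambda>n. (\<Sum>x\<in>Q n. A x x) / of_nat (card (Q n))) \<longlonglongrightarrow> graph_trace E A"
proof -
  obtain r where r: "inv_kernel r A" using A by (auto simp: PG_iff)
  have "\<exists>p. \<forall>\<alpha>\<in>patterns E r. \<forall>Q. folner_seq E Q \<longrightarrow> (\<lambda>n. real (card (Q n \<inter> \<alpha>)) / real (card (Q n))) \<longlonglongrightarrow> p \<alpha>"
    using AQ unfolding AQ_graph_def by (intro bchoice) blast
  then obtain p where p: "\<And>\<alpha> Q. \<alpha> \<in> patterns E r \<Longrightarrow> folner_seq E Q \<Longrightarrow> (\<lambda>n. real (card (Q n \<inter> \<alpha>)) / real (card (Q n))) \<longlonglongrightarrow> p \<alpha>"
    by blast
  define a where "a \<alpha> = (let x = SOME x::'v. x \<in> \<alpha> in A x x)" for \<alpha>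
  have a: "A x x = a \<alpha>" if \<alpha>: "\<alpha> \<in> patterns E r" and x: "x \<in> \<alpha>" for x \<alpha>
  proof -
    let ?y = "SOME x::'v. x \<in> \<alpha>"
    have "?y \<in> \<alpha>" using x by (rule someI)
    then obtain \<phi> where \<phi>: "ball_iso E r x ?y \<phi>" using pattern_const[OF \<alpha> x] by blast
    have "A x x = A ?y ?y" using inv_kernel_eq[OF r \<phi>, of x x] ball_isoD(2)[OF \<phi>] by simp
    then show ?thesis by (simp add: a_def Let_def)
  qed
  define t where "t = (\<Sum>\<alpha>\<in>patterns E r. a \<alpha> * of_real (p \<alpha>))"
  have lim: "(\<lambda>n. (\<Sum>x\<in>Q n. A x x) / of_nat (card (Q n))) \<longlonglongrightarrow> t" if Q: "folner_seq E Q" for Q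
  proof -
    have fin: "finite (Q n)" for n using Q by (auto simp: folner_seq_def)
    have "(\<Sum>x\<in>Q n. A x x) / of_nat (card (Q n)) =
        (\<Sum>\<alpha>\<in>patterns E r. a \<alpha> * of_real (real (card (Q n \<inter> \<alpha>)) / real (card (Q n))))" for n
    proof -
      have "Q n = (\<Union>\<alpha>\<in>patterns E r. Q n \<inter> \<alpha>)"
        using Union_quotient[OF same_pattern_equiv, of r] by (auto simp: patterns_def)
      then have "(\<Sum>x\<in>Q n. A x x) = (\<Sum>x\<in>(\<Union>\<alpha>\<in>patterns E r. Q n \<inter> \<alpha>). A x x)" by simp
      also have "\<dots> = (\<Sum>\<alpha>\<in>patterns E r. \<Sum>x\<in>Q n \<inter> \<alpha>. A x x)"
      proof (rule sum.UNION_disjoint[OF finite_patterns])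
        show "\<forall>\<alpha>\<in>patterns E r. \<forall>\<beta>\<in>patterns E r. \<alpha> \<noteq> \<beta> \<longrightarrow> (Q n \<inter> \<alpha>) \<inter> (Q n \<inter> \<beta>) = {}"
          using quotient_disj[OF same_pattern_equiv, of _ r] unfolding patterns_def by blast
      qed (use fin in auto)
      also have "\<dots> = (\<Sum>\<alpha>\<in>patterns E r. of_nat (card (Q n \<inter> \<alpha>)) * a \<alpha>)"
        by (intro sum.cong refl) (simp add: a)
      finally show ?thesis by (simp add: sum_divide_distrib mult.commute)
    qed
    moreover have "(\<lambda>n. \<Sum>\<alpha>\<in>patterns E r. a \<alpha> * of_real (real (card (Q n \<inter> \<alpha>)) / real (card (Q n)))) \<longlonglongrightarrow> t"
      unfolding t_def by (intro tendsto_sum tendsto_mult tendsto_const tendsto_of_real p Q)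
    ultimately show ?thesis by presburger
  qed
  have "graph_trace E A = t"
    unfolding graph_trace_def
  proof (rule the_equality)
    fix s assume s: "\<forall>Q. folner_seq E Q \<longrightarrow> (\<lambda>n. (\<Sum>x\<in>Q n. A x x) / of_nat (card (Q n))) \<longlonglongrightarrow> s"
    then show "s = t" using Q lim by (blast intro: LIMSEQ_unique)
  qed (use lim in blast)
  then show ?thesis using lim[OF Q] by simp
qed

end

section \<open>The Hilbert space of the graph\<close>

subsection \<open>Finitely supported functions\<close>

definition finsupp :: "('v \<Rightarrow> complex) \<Rightarrow> bool" where
  "finsupp f \<longleftrightarrow> finite {x. f x \<noteq> 0}"

lemma l2_inner_eq_sum:
  assumes "finite S" "{x. f x \<noteq> 0} \<subseteq> S"
  shows "l2_inner f g = (\<Sum>x\<in>S. f x * cnj (g x))"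
  unfolding l2_inner_def by (rule infsum_finite_support) (use assms in auto)

lemma finsupp_square_summable: "finsupp f \<Longrightarrow> f \<in> square_summable"
  unfolding finsupp_def square_summable_def
  by (subst mem_Collect_eq, subst summable_on_cong_neutral[where T = "{x. f x \<noteq> 0}" and g = "\<lambda>x. (cmod (f x))\<^sup>2"])
    auto

lemma l2_inner_self:
  assumes "finite S" "{x. f x \<noteq> 0} \<subseteq> S"
  shows "l2_inner f f = of_real (\<Sum>x\<in>S. (cmod (f x))\<^sup>2)"
  unfolding of_real_sum complex_norm_square by (rule l2_inner_eq_sum[OF assms])

lemma l2_inner_add:
  assumes "finsupp f" "finsupp f'"
  shows "l2_inner (\<lambda>x. f x + f' x) g = l2_inner f g + l2_inner f' g"
proof -
  let ?S = "{x. f x \<noteq> 0} \<union> {x. f' x \<noteq> 0}"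
  have S: "finite ?S" using assms by (simp add: finsupp_def)
  have "l2_inner (\<lambda>x. f x + f' x) g = (\<Sum>x\<in>?S. (f x + f' x) * cnj (g x))"
    by (rule l2_inner_eq_sum[OF S]) auto
  also have "\<dots> = l2_inner f g + l2_inner f' g"
    using l2_inner_eq_sum[OF S, of f g] l2_inner_eq_sum[OF S, of f' g] by (simp add: sum.distrib distrib_right)
  finally show ?thesis .
qed

lemma l2_inner_scale:
  assumes "finsupp f"
  shows "l2_inner (\<lambda>x. c * f x) g = c * l2_inner f g"
proof -
  have "l2_inner (\<lambda>x. c * f x) g = (\<Sum>x\<in>{x. f x \<noteq> 0}. c * f x * cnj (g x))"
    by (rule l2_inner_eq_sum) (use assms in \<open>auto simp: finsupp_def\<close>)
  also have "\<dots> = c * l2_inner f g"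
    using assms by (subst l2_inner_eq_sum[of "{x. f x \<noteq> 0}" f]) (auto simp: finsupp_def sum_distrib_left mult.assoc)
  finally show ?thesis .
qed

lemma l2_inner_cnj: 
  assumes "finsupp f" "finsupp g"
  shows "l2_inner g f = cnj (l2_inner f g)"
proof -
  let ?S = "{x. f x \<noteq> 0} \<union> {x. g x \<noteq> 0}"
  have S: "finite ?S" using assms by (simp add: finsupp_def)
  show ?thesis
    using l2_inner_eq_sum[OF S, of f g] l2_inner_eq_sum[OF S, of g f] by (simp add: mult.commute)
qed

context aq_graph
begin

lemma kernel_op_eq_sum:
  assumes B: "inv_kernel r B"
  shows "kernel_op B f x = (\<Sum>y\<in>gball r x. B x y * f y)"
  unfolding kernel_op_def by (rule infsum_finite_support) (simp_all add: inv_kernel_zero[OF B])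

lemma kernel_op_support:
  assumes B: "inv_kernel r B"
  shows "{x. kernel_op B f x \<noteq> 0} \<subseteq> (\<Union>y\<in>{y. f y \<noteq> 0}. gball r y)"
proof
  fix x assume "x \<in> {x. kernel_op B f x \<noteq> 0}"
  then have "\<exists>y\<in>gball r x. B x y * f y \<noteq> 0"
    unfolding kernel_op_eq_sum[OF B] by (metis (mono_tags, lifting) mem_Collect_eq sum.neutral)
  then show "x \<in> (\<Union>y\<in>{y. f y \<noteq> 0}. gball r y)" using mem_ball_sym by fastforce
qed

lemma finsupp_kernel_op: "B \<in> PG \<Longrightarrow> finsupp f \<Longrightarrow> finsupp (kernel_op B f)"
proof -
  assume B: "B \<in> PG" and f: "finsupp f"
  obtain r where r: "inv_kernel r B" using B by (auto simp: PG_iff)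
  show ?thesis
    using finite_subset[OF kernel_op_support[OF r, of f]] f by (auto simp: finsupp_def)
qed

lemma kernel_bounded:
  assumes "B \<in> PG"
  obtains M where "0 < M" "\<And>x y. cmod (B x y) \<le> M"
proof -
  have fin: "finite (cmod ` {B x y | x y. True})" using finite_kernel_values[OF assms] by simp
  show ?thesis
  proof (rule that[of "Max (insert 1 (cmod ` {B x y | x y. True}))"])
    have "1 \<le> Max (insert 1 (cmod ` {B x y | x y. True}))"
      using fin by (intro Max_ge) auto
    then show "0 < Max (insert 1 (cmod ` {B x y | x y. True}))" by linarith
    show "cmod (B x y) \<le> Max (insert 1 (cmod ` {B x y | x y. True}))" for x y
      using fin by (intro Max_ge) auto
  qed
qed

text \<open>The Schur test: with at most \<open>K\<close> nonzero entries in each row and each column, all bounded by \<open>M\<close>,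
  both the \<open>l\<^sup>2\<close> norm and the supremum norm of the operator are at most \<open>M K\<close>.  The latter
  bounds powers of \<open>B\<close> at point masses as well as eigenvalues of finite blocks.\<close>

lemma kernel_op_bounded:
  assumes B: "B \<in> PG"
  shows "\<exists>C>0. (\<forall>f. finsupp f \<longrightarrow> Re (l2_inner (kernel_op B f) (kernel_op B f)) \<le> C\<^sup>2 * Re (l2_inner f f)) \<and>
    (\<forall>f x m. (\<forall>y. cmod (f y) \<le> m) \<longrightarrow> cmod (kernel_op B f x) \<le> C * m)"
proof -
  obtain r where r: "inv_kernel r B" using B by (auto simp: PG_iff)
  obtain M where M: "0 < M" "\<And>x y. cmod (B x y) \<le> M" using kernel_bounded[OF B] by blast
  define K where "K = real (ballcard r)"
  have K: "real (card (gball r x)) \<le> K" for x using ballcard(2) by (simp add: K_def)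
  have "card (gball r undefined) > 0" by (subst card_gt_0_iff) (use center_mem_ball in blast)
  then have K0: "0 < K" using K[of undefined] by linarith
  have sq: "(cmod (kernel_op B f x))\<^sup>2 \<le> M\<^sup>2 * K * (\<Sum>y\<in>gball r x. (cmod (f y))\<^sup>2)" for f x
  proof -
    have "cmod (kernel_op B f x) \<le> (\<Sum>y\<in>gball r x. cmod (B x y * f y))"
      unfolding kernel_op_eq_sum[OF r] by (rule norm_sum)
    also have "\<dots> \<le> (\<Sum>y\<in>gball r x. M * cmod (f y))"
      by (intro sum_mono) (simp add: norm_mult mult_right_mono M)
    finally have "(cmod (kernel_op B f x))\<^sup>2 \<le> (\<Sum>y\<in>gball r x. M * cmod (f y))\<^sup>2" by (rule power_mono) simp
    also have "\<dots> \<le> (\<Sum>y\<in>gball r x. (M * cmod (f y))\<^sup>2) * real (card (gball r x))"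
      by (rule sum_squared_le_sum_of_squares)
    also have "\<dots> \<le> (\<Sum>y\<in>gball r x. (M * cmod (f y))\<^sup>2) * K"
      by (intro mult_left_mono K sum_nonneg) auto
    also have "\<dots> = M\<^sup>2 * K * (\<Sum>y\<in>gball r x. (cmod (f y))\<^sup>2)"
      by (simp add: power_mult_distrib sum_distrib_left mult_ac)
    finally show ?thesis .
  qed
  have "Re (l2_inner (kernel_op B f) (kernel_op B f)) \<le> (M * K)\<^sup>2 * Re (l2_inner f f)" if f: "finsupp f" for f
  proof -
    let ?S = "{y. f y \<noteq> 0}"
    let ?U = "\<Union>y\<in>?S. gball r y"
    have S: "finite ?S" using f by (simp add: finsupp_def)
    then have U: "finite ?U" by auto
    have "Re (l2_inner (kernel_op B f) (kernel_op B f)) = (\<Sum>x\<in>?U. (cmod (kernel_op B f x))\<^sup>2)"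
      using l2_inner_self[OF U kernel_op_support[OF r]] by simp
    also have "\<dots> \<le> (\<Sum>x\<in>?U. M\<^sup>2 * K * (\<Sum>y\<in>gball r x. (cmod (f y))\<^sup>2))" by (intro sum_mono sq)
    also have "\<dots> = M\<^sup>2 * K * (\<Sum>x\<in>?U. \<Sum>y\<in>gball r x. (cmod (f y))\<^sup>2)" by (simp add: sum_distrib_left)
    also have "(\<Sum>x\<in>?U. \<Sum>y\<in>gball r x. (cmod (f y))\<^sup>2) = (\<Sum>x\<in>?U. \<Sum>y\<in>?S. if y \<in> gball r x then (cmod (f y))\<^sup>2 else 0)"
    proof (rule sum.cong[OF refl])
      fix x
      have "(\<Sum>y\<in>gball r x. (cmod (f y))\<^sup>2) = (\<Sum>y\<in>gball r x \<inter> ?S. (cmod (f y))\<^sup>2)"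
        by (rule sum.mono_neutral_right) auto
      also have "\<dots> = (\<Sum>y\<in>?S. if y \<in> gball r x then (cmod (f y))\<^sup>2 else 0)"
        using sum.inter_restrict[OF S, of "\<lambda>y. (cmod (f y))\<^sup>2" "gball r x"] by (simp add: Int_commute)
      finally show "(\<Sum>y\<in>gball r x. (cmod (f y))\<^sup>2) = (\<Sum>y\<in>?S. if y \<in> gball r x then (cmod (f y))\<^sup>2 else 0)" .
    qed
    also have "\<dots> = (\<Sum>y\<in>?S. \<Sum>x\<in>?U. if y \<in> gball r x then (cmod (f y))\<^sup>2 else 0)" by (rule sum.swap)
    also have "\<dots> \<le> (\<Sum>y\<in>?S. K * (cmod (f y))\<^sup>2)"
    proof (rule sum_mono)
      fix y
      have "(\<Sum>x\<in>?U. if y \<in> gball r x then (cmod (f y))\<^sup>2 else 0) = (\<Sum>x\<in>?U \<inter> gball r y. (cmod (f y))\<^sup>2)"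
        using sum.inter_restrict[OF U, of "\<lambda>x. (cmod (f y))\<^sup>2" "gball r y"] by (simp add: mem_ball_sym[of y])
      also have "\<dots> = real (card (?U \<inter> gball r y)) * (cmod (f y))\<^sup>2" by simp
      also have "\<dots> \<le> K * (cmod (f y))\<^sup>2"
      proof (rule mult_right_mono)
        have "card (?U \<inter> gball r y) \<le> card (gball r y)" by (intro card_mono) auto
        then show "real (card (?U \<inter> gball r y)) \<le> K" using K[of y] by linarith
      qed simp
      finally show "(\<Sum>x\<in>?U. if y \<in> gball r x then (cmod (f y))\<^sup>2 else 0) \<le> K * (cmod (f y))\<^sup>2" .
    qed
    also have "\<dots> = K * Re (l2_inner f f)"
      using l2_inner_self[OF S, of f] by (simp add: sum_distrib_left)
    finally have "Re (l2_inner (kernel_op B f) (kernel_op B f)) \<le> M\<^sup>2 * K * (K * Re (l2_inner f f))"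
      using M K0 by (simp add: mult_left_mono)
    then show ?thesis by (simp add: power2_eq_square mult_ac)
  qed
  moreover have "cmod (kernel_op B f x) \<le> M * K * m" if m: "\<forall>y. cmod (f y) \<le> m" for f x m
  proof -
    have m0: "0 \<le> m" using m norm_ge_zero order_trans by blast
    have "cmod (kernel_op B f x) \<le> (\<Sum>y\<in>gball r x. cmod (B x y * f y))"
      unfolding kernel_op_eq_sum[OF r] by (rule norm_sum)
    also have "\<dots> \<le> (\<Sum>y\<in>gball r x. M * m)"
      by (intro sum_mono) (use M m in \<open>auto simp: norm_mult intro!: mult_mono\<close>)
    also have "\<dots> = real (card (gball r x)) * (M * m)" by simp
    also have "\<dots> \<le> K * (M * m)" using K M m0 by (intro mult_right_mono) auto
    finally show ?thesis by (simp add: mult_ac)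
  qed
  ultimately show ?thesis using M K0 by (intro exI[of _ "M * K"]) auto
qed

subsection \<open>The trace inner product\<close>

abbreviation (input) "kcol A x \<equiv> (\<lambda>z. A z x)" for A :: "'v kernel"

lemma finsupp_col: "A \<in> PG \<Longrightarrow> finsupp (kcol A x)"
proof -
  assume "A \<in> PG"
  then obtain r where r: "inv_kernel r A" by (auto simp: PG_iff)
  have "{z. A z x \<noteq> 0} \<subseteq> gball r x" using inv_kernel_zero[OF r] mem_ball_sym by blast
  then show ?thesis unfolding finsupp_def by (rule finite_subset) simp
qed

lemma kernel_mult_col: "kcol (kernel_mult B A) x = kernel_op B (kcol A x)"
  by (simp add: kernel_mult_def kernel_op_def)

text \<open>The trace inner product is the average over \<open>x\<close> of the \<open>l\<^sup>2\<close> inner products of the columns at \<open>x\<close>.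
  As left multiplication acts columnwise, symmetry, positivity and boundedness of an operator on \<open>l\<^sup>2\<close>
  pass to left multiplication on the Hilbert space of the graph.\<close>

lemma trace_inner_limit:
  assumes "A \<in> PG" "B \<in> PG" "folner_seq E Q"
  shows "(\<lambda>n. (\<Sum>x\<in>Q n. l2_inner (kcol A x) (kcol B x)) / of_nat (card (Q n))) \<longlonglongrightarrow> trace_inner E A B"
proof -
  have "kernel_mult (kernel_adj B) A x x = l2_inner (kcol A x) (kcol B x)" for x
    by (simp add: kernel_mult_def kernel_adj_def l2_inner_def mult.commute)
  then show ?thesis
    using trace_limit[OF PG_mult[OF PG_adj[OF assms(2)] assms(1)] assms(3)] by (simp add: trace_inner_def)
qed

lemma trace_inner_eqI:
  assumes "A \<in> PG" "B \<in> PG"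
    and "\<And>Q. folner_seq E Q \<Longrightarrow> (\<lambda>n. (\<Sum>x\<in>Q n. l2_inner (kcol A x) (kcol B x)) / of_nat (card (Q n))) \<longlonglongrightarrow> t"
  shows "trace_inner E A B = t"
proof -
  obtain Q where Q: "folner_seq E Q" using folner_exists by blast
  show ?thesis by (rule LIMSEQ_unique[OF trace_inner_limit[OF assms(1,2) Q] assms(3)[OF Q]])
qed

lemma trace_inner_mono:
  assumes "A \<in> PG" "B \<in> PG" "A' \<in> PG" "B' \<in> PG"
    and "\<And>x. Re (l2_inner (kcol A x) (kcol B x)) \<le> k * Re (l2_inner (kcol A' x) (kcol B' x))"
  shows "Re (trace_inner E A B) \<le> k * Re (trace_inner E A' B')"
proof -
  obtain Q where Q: "folner_seq E Q" using folner_exists by blast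
  have "Re ((\<Sum>x\<in>Q n. l2_inner (kcol A x) (kcol B x)) / of_nat (card (Q n)))
     \<le> k * Re ((\<Sum>x\<in>Q n. l2_inner (kcol A' x) (kcol B' x)) / of_nat (card (Q n)))" for n
  proof -
    have "(\<Sum>x\<in>Q n. Re (l2_inner (kcol A x) (kcol B x))) / real (card (Q n))
      \<le> (\<Sum>x\<in>Q n. k * Re (l2_inner (kcol A' x) (kcol B' x))) / real (card (Q n))"
      by (intro divide_right_mono sum_mono assms) simp
    then show ?thesis by (simp add: Re_divide_of_nat sum_distrib_left)
  qed
  then show ?thesis
    by (intro LIMSEQ_le[OF tendsto_Re[OF trace_inner_limit[OF assms(1,2) Q]]
          tendsto_mult_left[OF tendsto_Re[OF trace_inner_limit[OF assms(3,4) Q]]]]) auto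
qed

lemma semi_inner_PG:
  "semi_inner PG (\<lambda>x y. 0) (\<lambda>A B x y. A x y + B x y) (\<lambda>c A x y. c * A x y) (trace_inner E)"
proof
  show "(\<lambda>x y. 0) \<in> PG" by (rule PG_zero)
  fix A B assume A: "A \<in> PG" and B: "B \<in> PG"
  show "(\<lambda>x y. A x y + B x y) \<in> PG" by (rule PG_add[OF A B])
  show "trace_inner E B A = cnj (trace_inner E A B)"
    by (rule trace_inner_eqI[OF B A], drule tendsto_cnj[OF trace_inner_limit[OF A B]])
      (simp add: l2_inner_cnj[OF finsupp_col[OF A] finsupp_col[OF B]])
  fix C assume C: "C \<in> PG"
  show "trace_inner E (\<lambda>x y. A x y + B x y) C = trace_inner E A C + trace_inner E B C"
  proof (rule trace_inner_eqI[OF PG_add[OF A B] C])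
    fix Q assume Q: "folner_seq E Q"
    show "(\<lambda>n. (\<Sum>x\<in>Q n. l2_inner (\<lambda>z. A z x + B z x) (kcol C x)) / of_nat (card (Q n))) \<longlonglongrightarrow> trace_inner E A C + trace_inner E B C"
      using tendsto_add[OF trace_inner_limit[OF A C Q] trace_inner_limit[OF B C Q]]
      by (simp add: l2_inner_add finsupp_col[OF A] finsupp_col[OF B] sum.distrib add_divide_distrib)
  qed
next
  fix A c assume A: "A \<in> PG"
  show "(\<lambda>x y. c * A x y) \<in> PG" by (rule PG_scale[OF A])
  show "trace_inner E (\<lambda>x y. 0) A = 0"
    by (rule trace_inner_eqI[OF PG_zero A]) (simp add: l2_inner_def)
  have "Re (trace_inner E (\<lambda>x y. 0) (\<lambda>x y. 0)) \<le> 1 * Re (trace_inner E A A)"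
  proof (rule trace_inner_mono[OF PG_zero PG_zero A A])
    fix x
    have "l2_inner (kcol A x) (kcol A x) = of_real (\<Sum>z\<in>{z. A z x \<noteq> 0}. (cmod (A z x))\<^sup>2)"
      by (rule l2_inner_self) (use finsupp_col[OF A, of x] in \<open>auto simp: finsupp_def\<close>)
    then show "Re (l2_inner (\<lambda>z. 0) (\<lambda>z. 0)) \<le> 1 * Re (l2_inner (kcol A x) (kcol A x))"
      by (simp add: l2_inner_def sum_nonneg)
  qed
  moreover have "trace_inner E (\<lambda>x y. 0) (\<lambda>x y. 0) = 0"
    by (rule trace_inner_eqI[OF PG_zero PG_zero]) (simp add: l2_inner_def)
  ultimately show "0 \<le> Re (trace_inner E A A)" by simp
next
  fix A C c assume A: "A \<in> PG" and C: "C \<in> PG"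
  show "trace_inner E (\<lambda>x y. c * A x y) C = c * trace_inner E A C"
  proof (rule trace_inner_eqI[OF PG_scale[OF A] C])
    fix Q assume Q: "folner_seq E Q"
    show "(\<lambda>n. (\<Sum>x\<in>Q n. l2_inner (\<lambda>z. c * A z x) (kcol C x)) / of_nat (card (Q n))) \<longlonglongrightarrow> c * trace_inner E A C"
      using tendsto_mult_left[OF trace_inner_limit[OF A C Q], of c]
      by (simp add: l2_inner_scale finsupp_col[OF A] sum_distrib_left)
  qed
qed

sublocale TI: semi_inner PG "\<lambda>x y. 0" "\<lambda>A B x y. A x y + B x y" "\<lambda>c A x y. c * A x y" "trace_inner E"
  by (rule semi_inner_PG)

lemma trace_dist_eq: "trace_dist E A B = TI.nrm (TI.dif A B)"
  by (simp add: trace_dist_def Let_def TI.nrm_def TI.dif_def)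

lemma trace_cauchy_eq: "trace_cauchy E = TI.cauchy"
  by (simp add: trace_cauchy_def TI.cauchy_def trace_dist_eq)

lemma trace_equiv_eq: "trace_equiv E = TI.equi"
  by (simp add: trace_equiv_def TI.equi_def trace_cauchy_eq trace_dist_eq)

lemma graph_class_eq: "graph_class E A = TI.cls (\<lambda>_. A)"
  by (simp add: graph_class_def TI.cls_def trace_equiv_eq)

lemma graph_hilbert_eq: "graph_hilbert E = TI.completion"
  by (simp add: graph_hilbert_def TI.completion_def trace_cauchy_eq trace_equiv_eq graph_class_eq)

lemma left_mult_op_eq: "left_mult_op E B = TI.extend_op (kernel_mult B)"
  by (simp add: left_mult_op_def TI.extend_op_def graph_hilbert_eq trace_equiv_eq)

end

subsection \<open>Left multiplication by a positive matrix\<close>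

locale aq_positive = aq_graph E for E :: "'v rel" +
  fixes B :: "'v kernel"
  assumes B: "B \<in> PG" and B_sa: "l2_self_adjoint B" and B_pos: "l2_positive B"
begin

text \<open>Any constant as in \<open>kernel_op_bounded\<close>.\<close>

definition Bnorm :: real where
  "Bnorm = (SOME C. C > 0 \<and> (\<forall>f. finsupp f \<longrightarrow> Re (l2_inner (kernel_op B f) (kernel_op B f)) \<le> C\<^sup>2 * Re (l2_inner f f)) \<and>
    (\<forall>f x m. (\<forall>y. cmod (f y) \<le> m) \<longrightarrow> cmod (kernel_op B f x) \<le> C * m))"

lemma Bnorm: "Bnorm > 0"
  "finsupp f \<Longrightarrow> Re (l2_inner (kernel_op B f) (kernel_op B f)) \<le> Bnorm\<^sup>2 * Re (l2_inner f f)"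
  "(\<And>y. cmod (f y) \<le> m) \<Longrightarrow> cmod (kernel_op B f x) \<le> Bnorm * m"
proof -
  note * = someI_ex[OF kernel_op_bounded[OF B], folded Bnorm_def]
  show "Bnorm > 0" using * by (rule conjunct1)
  show "finsupp f \<Longrightarrow> Re (l2_inner (kernel_op B f) (kernel_op B f)) \<le> Bnorm\<^sup>2 * Re (l2_inner f f)"
    by (rule *[THEN conjunct2, THEN conjunct1, rule_format])
  show "(\<And>y. cmod (f y) \<le> m) \<Longrightarrow> cmod (kernel_op B f x) \<le> Bnorm * m"
    by (rule *[THEN conjunct2, THEN conjunct2, rule_format])
qed

lemma left_closed: "A \<in> PG \<Longrightarrow> kernel_mult B A \<in> PG"
  by (rule PG_mult[OF B])

lemma left_nrm: 
  assumes A: "A \<in> PG"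
  shows "TI.nrm (kernel_mult B A) \<le> Bnorm * TI.nrm A"
proof -
  have "Re (trace_inner E (kernel_mult B A) (kernel_mult B A)) \<le> Bnorm\<^sup>2 * Re (trace_inner E A A)"
    by (rule trace_inner_mono) (simp_all add: left_closed A kernel_mult_col Bnorm finsupp_col)
  then have "(TI.nrm (kernel_mult B A))\<^sup>2 \<le> (Bnorm * TI.nrm A)\<^sup>2"
    by (simp add: TI.nrm_sq left_closed A power_mult_distrib)
  then show ?thesis
    by (rule power2_le_imp_le) (use A Bnorm(1) in simp)
qed

lemma left_dif: "A \<in> PG \<Longrightarrow> A' \<in> PG \<Longrightarrow> TI.dif (kernel_mult B A) (kernel_mult B A') = kernel_mult B (TI.dif A A')"
proof -
  obtain r where r: "inv_kernel r B" using B by (auto simp: PG_iff)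
  show ?thesis
    by (intro ext) (simp add: TI.dif_def kernel_mult_eq_sum[OF r] sum_subtractf[symmetric] algebra_simps)
qed

lemma left_lipschitz:
  "A \<in> PG \<Longrightarrow> A' \<in> PG \<Longrightarrow> TI.nrm (TI.dif (kernel_mult B A) (kernel_mult B A')) \<le> Bnorm * TI.nrm (TI.dif A A')"
  using left_nrm[OF TI.dif_closed, of A A'] by (simp add: left_dif)

lemma left_sa:
  assumes A: "A \<in> PG" and A': "A' \<in> PG"
  shows "trace_inner E (kernel_mult B A) A' = trace_inner E A (kernel_mult B A')"
proof (rule trace_inner_eqI[OF left_closed[OF A] A'])
  fix Q assume Q: "folner_seq E Q"
  have "l2_inner (kernel_op B (kcol A x)) (kcol A' x) = l2_inner (kcol A x) (kernel_op B (kcol A' x))" for x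
    using B_sa finsupp_square_summable[OF finsupp_col[OF A]] finsupp_square_summable[OF finsupp_col[OF A']]
    unfolding l2_self_adjoint_def by blast
  then show "(\<lambda>n. (\<Sum>x\<in>Q n. l2_inner (kcol (kernel_mult B A) x) (kcol A' x)) / of_nat (card (Q n))) \<longlonglongrightarrow> trace_inner E A (kernel_mult B A')"
    using trace_inner_limit[OF A left_closed[OF A'] Q] by (simp add: kernel_mult_col)
qed

lemma B_pos_finsupp:
  "finsupp f \<Longrightarrow> l2_inner (kernel_op B f) f \<in> \<real>" "finsupp f \<Longrightarrow> 0 \<le> Re (l2_inner (kernel_op B f) f)"
  using B_pos finsupp_square_summable unfolding l2_positive_def by blast+

lemma left_pos:
  assumes A: "A \<in> PG"
  shows "0 \<le> Re (trace_inner E (kernel_mult B A) A)"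
proof -
  have "Re (trace_inner E (\<lambda>x y. 0) A) \<le> 1 * Re (trace_inner E (kernel_mult B A) A)"
    by (rule trace_inner_mono[OF PG_zero A left_closed[OF A] A])
      (simp add: kernel_mult_col B_pos_finsupp finsupp_col[OF A] l2_inner_def[of "\<lambda>_. 0"])
  then show ?thesis using TI.ip_zero[OF A] by simp
qed

lemma left_le:
  assumes A: "A \<in> PG"
  shows "Re (trace_inner E (kernel_mult B A) A) \<le> Bnorm * Re (trace_inner E A A)"
proof -
  have "Re (trace_inner E (kernel_mult B A) A) \<le> cmod (trace_inner E (kernel_mult B A) A)"
    by (rule complex_Re_le_cmod)
  also have "\<dots> \<le> TI.nrm (kernel_mult B A) * TI.nrm A"
    by (rule TI.Cauchy_Schwarz[OF left_closed[OF A] A])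
  also have "\<dots> \<le> Bnorm * TI.nrm A * TI.nrm A"
    using A by (intro mult_right_mono left_nrm) auto
  also have "\<dots> = Bnorm * Re (trace_inner E A A)"
    using TI.nrm_sq[OF A] by (simp add: power2_eq_square)
  finally show ?thesis .
qed

sublocale bounded_positive "graph_hilbert E" "left_mult_op E B" Bnorm
  unfolding graph_hilbert_eq left_mult_op_eq
  by (rule TI.bounded_positive_extend_op[where C = Bnorm])
    (fact left_closed left_lipschitz left_sa left_pos left_le Bnorm(1))+

lemma left_mult_in_vN: "left_mult_op E B \<in> graph_vN_algebra E"
proof -
  have "left_mult_op E B \<in> bounded_ops (graph_hilbert E)"
    unfolding bounded_ops_def
  proof (intro CollectI conjI ballI allI)
    show "left_mult_op E B \<in> V \<rightarrow>\<^sub>E V"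
    proof (rule PiE_I)
      show "left_mult_op E B u \<in> V" if "u \<in> V" for u using that by (rule T_closed)
      show "left_mult_op E B u = undefined" if "u \<notin> V" for u using that by (simp add: left_mult_op_def)
    qed
    show "\<exists>C. \<forall>u\<in>V. hnorm (graph_hilbert E) (left_mult_op E B u) \<le> C * hnorm (graph_hilbert E) u"
      unfolding graph_hilbert_eq left_mult_op_eq
      by (intro exI[of _ Bnorm] ballI TI.extend_op_bounded left_closed left_lipschitz left_nrm)
  qed (auto simp: T_add T_scale)
  moreover have "left_mult_op E B \<in> left_mult_op E ` PG" using B by (rule imageI)
  ultimately show ?thesis
    unfolding graph_vN_algebra_def weak_operator_closure_def
    by (intro CollectI conjI allI impI bexI[of _ "left_mult_op E B"]) auto
qed

lemma left_mult_sa: "self_adjoint_op (graph_hilbert E) (left_mult_op E B)"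
  by (simp add: self_adjoint_op_def T_sa)

lemma left_mult_pos: "positive_op (graph_hilbert E) (left_mult_op E B)"
  unfolding positive_op_def
proof (intro ballI conjI)
  fix u assume u: "u \<in> V"
  show "0 \<le> Re (ip (left_mult_op E B u) u)" by (rule T_pos[OF u])
  have "cnj (ip (left_mult_op E B u) u) = ip (left_mult_op E B u) u"
    using ip_cnj[of "left_mult_op E B u" u] T_sa[of u u] u by simp
  then show "ip (left_mult_op E B u) u \<in> \<real>" by (simp add: Reals_cnj_iff)
qed

subsection \<open>Moments of the integrated density of states\<close>

definition Bpow :: "nat \<Rightarrow> 'v kernel" where
  "Bpow k = (kernel_mult B ^^ k) kernel_one"

lemma Bpow_closed: "Bpow k \<in> PG"
  unfolding Bpow_def by (induction k) (auto simp: PG_one left_closed)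

text \<open>The vector \<open>L\<^sub>B\<^sup>k 1\<close> is the class of \<open>B\<^sup>k\<close>, so its inner product with \<open>1\<close> is the trace of \<open>B\<^sup>k\<close>.\<close>

lemma ip_one_moment:
  assumes Q: "folner_seq E Q"
  shows "(\<lambda>n. (\<Sum>x\<in>Q n. Bpow k x x) / of_nat (card (Q n))) \<longlonglongrightarrow>
    ip ((left_mult_op E B ^^ k) (graph_class E kernel_one)) (graph_class E kernel_one)"
proof -
  have c: "(\<lambda>_. kernel_one) \<in> TI.cauchy" by (rule TI.cauchy_const[OF PG_one])
  have "(left_mult_op E B ^^ k) (graph_class E kernel_one) = TI.cls (\<lambda>_. Bpow k)"
    unfolding left_mult_op_eq graph_class_eq Bpow_def
    by (rule TI.extend_op_pow_cls(1)[OF left_closed left_lipschitz c])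
  then have "ip ((left_mult_op E B ^^ k) (graph_class E kernel_one)) (graph_class E kernel_one) = trace_inner E (Bpow k) kernel_one"
    unfolding graph_hilbert_eq graph_class_eq
    by (simp add: TI.hinner_cls_eq[OF TI.cauchy_const[OF Bpow_closed] c])
  moreover have "l2_inner (kcol (Bpow k) x) (kcol kernel_one x) = Bpow k x x" for x
  proof -
    have "l2_inner (kcol (Bpow k) x) (kcol kernel_one x) = (\<Sum>\<^sub>\<infinity>z. Bpow k z x * cnj (kernel_one z x))"
      by (simp add: l2_inner_def)
    also have "\<dots> = (\<Sum>z\<in>{x}. Bpow k z x * cnj (kernel_one z x))"
      by (rule infsum_finite_support) (auto simp: kernel_one_def)
    finally show ?thesis by (simp add: kernel_one_def)
  qed
  ultimately show ?thesis using trace_inner_limit[OF Bpow_closed PG_one Q, of k] by simp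
qed

text \<open>The measure is the spectral measure of \<open>L\<^sub>B\<close> at the vector \<open>1\<close>.\<close>

lemma ids_measure:
  obtains \<mu> :: "real measure" where "finite_measure \<mu>" "sets \<mu> = sets borel" "AE t in \<mu>. t \<in> {0..Bnorm}"
    "\<And>t. spectral_function E B t = measure \<mu> {0..t}"
    "\<And>k Q. folner_seq E Q \<Longrightarrow> (\<lambda>n. (\<Sum>x\<in>Q n. Re (Bpow k x x)) / real (card (Q n))) \<longlonglongrightarrow> (\<integral>t. t ^ k \<partial>\<mu>)"
proof -
  let ?one = "graph_class E kernel_one"
  have one: "?one \<in> V" unfolding graph_hilbert_eq graph_class_eq by (intro TI.cls_in_carr TI.cauchy_const PG_one)
  show ?thesis
  proof (rule that[of "smeas ?one"])
    show "spectral_function E B t = measure (smeas ?one) {0..t}" for t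
      unfolding spectral_function_def vN_trace_def
      using one by (simp add: spectral_projection_eq ip_proj_self)
    fix k Q assume Q: "folner_seq E Q"
    have "(\<integral>t. t ^ k \<partial>smeas ?one) = Re (pform ?one ?one (monom 1 k))"
      using smeas(4)[OF one, of "monom 1 k"] by (simp add: poly_monom)
    also have "pform ?one ?one (monom 1 k) = ip ((left_mult_op E B ^^ k) ?one) ?one"
    proof -
      have "pform ?one ?one (monom 1 k) = (\<Sum>i\<in>{k}. of_real (coeff (monom 1 k) i) * ip ((left_mult_op E B ^^ i) ?one) ?one)"
        unfolding pform_def by (rule sum.mono_neutral_right) (auto simp: degree_monom_eq)
      then show ?thesis by simp
    qed
    finally have "(\<integral>t. t ^ k \<partial>smeas ?one) = Re (ip ((left_mult_op E B ^^ k) ?one) ?one)" .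
    then show "(\<lambda>n. (\<Sum>x\<in>Q n. Re (Bpow k x x)) / real (card (Q n))) \<longlonglongrightarrow> (\<integral>t. t ^ k \<partial>smeas ?one)"
      using tendsto_Re[OF ip_one_moment[OF Q, of k]] by (simp add: Re_divide_of_nat)
  qed (rule smeas[OF one])+
qed

end

section \<open>Eigenvalues of integer matrices\<close>

subsection \<open>Triangular form and polynomial functions of a matrix\<close>

lemma complex_triangular_form:
  fixes A :: "complex Matrix.mat"
  assumes A: "A \<in> carrier_mat n n" and cp: "char_poly A = (\<Prod>a\<leftarrow>es. [:- a, 1:])"
  obtains U P R where "similar_mat_wit A U P R" "upper_triangular U" "diag_mat U = es"
proof -
  obtain U P R where "schur_decomposition A es = (U, P, R)" by (cases "schur_decomposition A es") auto
  from schur_decomposition[OF A cp this] that show ?thesis by blast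
qed

lemma upper_triangular_mult:
  fixes U W :: "'a::semiring_1 Matrix.mat"
  assumes U: "U \<in> carrier_mat n n" "upper_triangular U" and W: "W \<in> carrier_mat n n" "upper_triangular W"
  shows "upper_triangular (U * W)" "i < n \<Longrightarrow> (U * W) $$ (i, i) = U $$ (i, i) * W $$ (i, i)"
proof -
  have entry: "(U * W) $$ (i, j) = (\<Sum>k<n. U $$ (i, k) * W $$ (k, j))" if "i < n" "j < n" for i j
    using U W that by (auto simp: scalar_prod_def atLeast0LessThan intro!: sum.cong)
  have zeroU: "U $$ (i, k) = 0" if "k < i" "i < n" for i k using U that by (auto dest: upper_triangularD)
  have zeroW: "W $$ (k, j) = 0" if "j < k" "k < n" for j k using W that by (auto dest: upper_triangularD)
  show "upper_triangular (U * W)"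
  proof (rule upper_triangularI)
    fix i j assume ji: "j < i" "i < dim_row (U * W)"
    then have "i < n" "j < n" using U by auto
    moreover have "U $$ (i, k) * W $$ (k, j) = 0" if "k < n" for k
      using that ji U zeroU[of k i] zeroW[of j k] by (cases "k < i") auto
    ultimately show "(U * W) $$ (i, j) = 0" by (simp add: entry)
  qed
  assume i: "i < n"
  have "(\<Sum>k<n. U $$ (i, k) * W $$ (k, i)) = (\<Sum>k\<in>{i}. U $$ (i, k) * W $$ (k, i))"
  proof (rule sum.mono_neutral_right)
    show "\<forall>k\<in>{..<n} - {i}. U $$ (i, k) * W $$ (k, i) = 0"
    proof
      fix k assume k: "k \<in> {..<n} - {i}"
      show "U $$ (i, k) * W $$ (k, i) = 0"
        using k i zeroU[of k i] zeroW[of i k] by (cases "k < i") auto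
    qed
  qed (use i in auto)
  then show "(U * W) $$ (i, i) = U $$ (i, i) * W $$ (i, i)" using i by (simp add: entry)
qed

text \<open>Horner's scheme on a list of coefficients: the recursion commutes with the entrywise embedding of
  integer matrices into complex ones.\<close>

primrec mat_poly :: "nat \<Rightarrow> 'a::comm_ring_1 Matrix.mat \<Rightarrow> 'a list \<Rightarrow> 'a Matrix.mat" where
  "mat_poly n A [] = 0\<^sub>m n n"
| "mat_poly n A (a # as) = a \<cdot>\<^sub>m 1\<^sub>m n + A * mat_poly n A as"

lemma mat_poly_carrier [simp]: "A \<in> carrier_mat n n \<Longrightarrow> mat_poly n A as \<in> carrier_mat n n"
  by (induction as) auto

lemma mat_poly_similar:
  assumes A: "A \<in> carrier_mat n n" and wit: "similar_mat_wit A U P R"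
  shows "similar_mat_wit (mat_poly n A as) (mat_poly n U as) P R"
proof -
  note w = similar_mat_witD2[OF A wit]
  have "mat_poly n A as = P * mat_poly n U as * R"
  proof (induction as)
    case Nil
    then show ?case using w by simp
  next
    case (Cons a as)
    let ?M = "mat_poly n U as"
    have M: "?M \<in> carrier_mat n n" using w by simp
    have cs: "P \<in> carrier_mat n n" "U \<in> carrier_mat n n" "R \<in> carrier_mat n n"
      "?M * R \<in> carrier_mat n n" "U * ?M \<in> carrier_mat n n" "P * U \<in> carrier_mat n n" "P * (?M * R) \<in> carrier_mat n n"
      using w(5-7) M by (auto intro!: mult_carrier_mat)
    have "A * (P * ?M * R) = P * (U * ?M) * R"
    proof -
      have 1: "P * ?M * R = P * (?M * R)" by (rule assoc_mult_mat[OF cs(1) M cs(3)])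
      have 2: "P * U * R * (P * (?M * R)) = P * U * (R * (P * (?M * R)))" by (rule assoc_mult_mat[OF cs(6,3,7)])
      have 3: "R * (P * (?M * R)) = R * P * (?M * R)" by (rule assoc_mult_mat[OF cs(3,1,4), symmetric])
      have 4: "R * P * (?M * R) = ?M * R" unfolding w(2) by (rule left_mult_one_mat[OF cs(4)])
      have 5: "P * U * (?M * R) = P * (U * (?M * R))" by (rule assoc_mult_mat[OF cs(1,2,4)])
      have 6: "U * (?M * R) = U * ?M * R" by (rule assoc_mult_mat[OF cs(2) M cs(3), symmetric])
      have 7: "P * (U * ?M * R) = P * (U * ?M) * R" by (rule assoc_mult_mat[OF cs(1,5,3), symmetric])
      show ?thesis unfolding 1 w(3) 2 3 4 5 6 7 ..
    qed
    moreover have "a \<cdot>\<^sub>m 1\<^sub>m n = P * (a \<cdot>\<^sub>m 1\<^sub>m n) * R"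
    proof -
      have "P * (a \<cdot>\<^sub>m 1\<^sub>m n) = a \<cdot>\<^sub>m (P * 1\<^sub>m n)" by (rule mult_smult_distrib[OF cs(1) one_carrier_mat])
      also have "P * 1\<^sub>m n = P" by (rule right_mult_one_mat[OF cs(1)])
      finally have "P * (a \<cdot>\<^sub>m 1\<^sub>m n) * R = a \<cdot>\<^sub>m (P * R)" using mult_smult_assoc_mat[OF cs(1,3)] by simp
      then show ?thesis unfolding w(1) ..
    qed
    moreover have "P * (a \<cdot>\<^sub>m 1\<^sub>m n + U * ?M) * R = P * (a \<cdot>\<^sub>m 1\<^sub>m n) * R + P * (U * ?M) * R"
    proof -
      have aI: "a \<cdot>\<^sub>m 1\<^sub>m n \<in> carrier_mat n n" by simp
      have "P * (a \<cdot>\<^sub>m 1\<^sub>m n + U * ?M) = P * (a \<cdot>\<^sub>m 1\<^sub>m n) + P * (U * ?M)"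
        by (rule mult_add_distrib_mat[OF cs(1) aI cs(5)])
      then show ?thesis
        using add_mult_distrib_mat[OF mult_carrier_mat[OF cs(1) aI] mult_carrier_mat[OF cs(1,5)] cs(3)] by simp
    qed
    ultimately show ?case by (simp only: mat_poly.simps Cons)
  qed
  then show ?thesis
    using w A by (intro similar_mat_witI[of _ _ n]) auto
qed

lemma mat_poly_triangular:
  assumes U: "U \<in> carrier_mat n n" "upper_triangular U"
  shows "upper_triangular (mat_poly n U as) \<and>
    (\<forall>i<n. mat_poly n U as $$ (i, i) = poly (Poly as) (U $$ (i, i)))"
proof (induction as)
  case (Cons a as)
  let ?M = "mat_poly n U as"
  have M: "?M \<in> carrier_mat n n" using U by simp
  note t = upper_triangular_mult[OF U M conjunct1[OF Cons.IH]]
  have UM: "U * ?M \<in> carrier_mat n n" using U M by simp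
  have add_entry: "(a \<cdot>\<^sub>m 1\<^sub>m n + U * ?M) $$ (i, j) = (if i = j then a else 0) + (U * ?M) $$ (i, j)"
    if "i < n" "j < n" for i j
  proof -
    have "(a \<cdot>\<^sub>m 1\<^sub>m n + U * ?M) $$ (i, j) = (a \<cdot>\<^sub>m 1\<^sub>m n) $$ (i, j) + (U * ?M) $$ (i, j)"
      by (rule index_add_mat(1)) (use UM that in auto)
    then show ?thesis using that by simp
  qed
  show ?case
  proof (intro conjI allI impI)
    show "upper_triangular (mat_poly n U (a # as))"
    proof (rule upper_triangularI)
      fix i j assume ji: "j < i" "i < dim_row (mat_poly n U (a # as))"
      have i: "i < n" using ji U UM by simp
      have "(U * ?M) $$ (i, j) = 0" using t(1) ji UM i by (auto dest: upper_triangularD)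
      then show "mat_poly n U (a # as) $$ (i, j) = 0"
        using ji i by (simp only: mat_poly.simps add_entry) simp
    qed
    show "mat_poly n U (a # as) $$ (i, i) = poly (Poly (a # as)) (U $$ (i, i))" if "i < n" for i
    proof -
      have "mat_poly n U (a # as) $$ (i, i) = a + (U * ?M) $$ (i, i)"
        unfolding mat_poly.simps using add_entry[OF that that] by simp
      also have "(U * ?M) $$ (i, i) = U $$ (i, i) * poly (Poly as) (U $$ (i, i))"
        unfolding t(2)[OF that] using Cons.IH that by simp
      finally show ?thesis by simp
    qed
  qed
qed auto

text \<open>The eigenvalues of \<open>p(A)\<close> are the values of \<open>p\<close> at those of \<open>A\<close>, with multiplicity: after a change of
  basis \<open>A\<close> is triangular, and then \<open>p(A)\<close> is triangular with the values of \<open>p\<close> on the diagonal.\<close>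

lemma char_poly_mat_poly:
  fixes A :: "complex Matrix.mat"
  assumes A: "A \<in> carrier_mat n n" and cp: "char_poly A = (\<Prod>a\<leftarrow>es. [:- a, 1:])"
  shows "char_poly (mat_poly n A as) = (\<Prod>a\<leftarrow>es. [:- poly (Poly as) a, 1:])"
proof -
  obtain U P R where w: "similar_mat_wit A U P R" and U: "upper_triangular U" "diag_mat U = es"
    by (rule complex_triangular_form[OF A cp])
  have Uc: "U \<in> carrier_mat n n" using similar_mat_witD2[OF A w] by simp
  have "char_poly (mat_poly n A as) = char_poly (mat_poly n U as)"
    by (rule char_poly_similar) (use mat_poly_similar[OF A w] in \<open>auto simp: similar_mat_def\<close>)
  also have "\<dots> = (\<Prod>a\<leftarrow>diag_mat (mat_poly n U as). [:- a, 1:])"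
    using Uc mat_poly_triangular[OF Uc U(1), of as] by (intro char_poly_upper_triangular[of _ n]) auto
  also have "diag_mat (mat_poly n U as) = map (poly (Poly as)) es"
  proof -
    have "dim_row (mat_poly n U as) = n" using mat_poly_carrier[OF Uc, of as] by (rule carrier_matD)
    then have "diag_mat (mat_poly n U as) = map (\<lambda>i. mat_poly n U as $$ (i, i)) [0..<n]"
      by (simp add: diag_mat_def)
    also have "\<dots> = map (\<lambda>i. poly (Poly as) (U $$ (i, i))) [0..<n]"
      using mat_poly_triangular[OF Uc U(1), of as] by (intro map_cong) auto
    also have "\<dots> = map (poly (Poly as)) (diag_mat U)" using Uc by (simp add: diag_mat_def)
    finally show ?thesis by (simp add: U(2))
  qed
  finally show ?thesis by (simp add: o_def)
qed

definition mat_trace :: "'a::comm_ring_1 Matrix.mat \<Rightarrow> 'a" where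
  "mat_trace A = (\<Sum>i<dim_row A. A $$ (i, i))"

lemma mat_trace_commute:
  assumes "A \<in> carrier_mat n n" "B \<in> carrier_mat n n"
  shows "mat_trace (A * B) = mat_trace (B * A)"
proof -
  have entry: "(X * Y) $$ (i, i) = (\<Sum>k<n. X $$ (i, k) * Y $$ (k, i))"
    if "X \<in> carrier_mat n n" "Y \<in> carrier_mat n n" "i < n" for X Y :: "'a Matrix.mat" and i
    using that by (auto simp: scalar_prod_def atLeast0LessThan intro!: sum.cong)
  have tr: "mat_trace (X * Y) = (\<Sum>i<n. \<Sum>k<n. X $$ (i, k) * Y $$ (k, i))"
    if "X \<in> carrier_mat n n" "Y \<in> carrier_mat n n" for X Y :: "'a Matrix.mat"
  proof -
    have "dim_row (X * Y) = n" using that by simp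
    then show ?thesis unfolding mat_trace_def by (simp only:) (intro sum.cong refl entry that, simp)
  qed
  have "mat_trace (A * B) = (\<Sum>i<n. \<Sum>k<n. A $$ (i, k) * B $$ (k, i))" by (rule tr[OF assms])
  also have "\<dots> = (\<Sum>k<n. \<Sum>i<n. B $$ (k, i) * A $$ (i, k))"
    by (subst sum.swap) (simp add: mult.commute)
  also have "\<dots> = mat_trace (B * A)" by (rule tr[OF assms(2,1), symmetric])
  finally show ?thesis .
qed

lemma mat_trace_pow:
  fixes A :: "complex Matrix.mat"
  assumes A: "A \<in> carrier_mat n n" and cp: "char_poly A = (\<Prod>a\<leftarrow>es. [:- a, 1:])"
  shows "mat_trace (A ^\<^sub>m k) = (\<Sum>a\<leftarrow>es. a ^ k)"
proof -
  obtain U P R where w: "similar_mat_wit A U P R" and U: "upper_triangular U" "diag_mat U = es"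
    by (rule complex_triangular_form[OF A cp])
  note c = similar_mat_witD2[OF A w]
  have Uk: "U ^\<^sub>m k \<in> carrier_mat n n" using c by simp
  have tri: "upper_triangular (U ^\<^sub>m k) \<and> (\<forall>i<n. (U ^\<^sub>m k) $$ (i, i) = (U $$ (i, i)) ^ k)"
  proof (induction k)
    case (Suc k)
    then show ?case
      using upper_triangular_mult[of "U ^\<^sub>m k" n U] c U by (auto simp: mult.commute)
  qed (use c in auto)
  have "mat_trace (A ^\<^sub>m k) = mat_trace (P * U ^\<^sub>m k * R)"
    by (simp add: similar_mat_wit_pow_id[OF w])
  also have "\<dots> = mat_trace (R * (P * U ^\<^sub>m k))"
    using c Uk by (intro mat_trace_commute[of _ n]) auto
  also have "R * (P * U ^\<^sub>m k) = U ^\<^sub>m k"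
    using c Uk by (simp add: assoc_mult_mat[of R n n P n "U ^\<^sub>m k" n, symmetric])
  also have "mat_trace (U ^\<^sub>m k) = (\<Sum>a\<leftarrow>es. a ^ k)"
  proof -
    have "(\<Sum>a\<leftarrow>es. a ^ k) = (\<Sum>i<n. (U $$ (i, i)) ^ k)"
      unfolding U(2)[symmetric] diag_mat_def using c by (simp add: o_def interv_sum_list_conv_sum_set_nat atLeast0LessThan)
    then show ?thesis using tri Uk c by (simp add: mat_trace_def)
  qed
  finally show ?thesis .
qed

subsection \<open>A lower bound for products of eigenvalues\<close>

text \<open>The zero roots contribute a power of \<open>X\<close>, so the lowest nonvanishing coefficient is the product of
  the other roots up to sign.\<close>

lemma coeff_linear_factors:
  fixes bs :: "'a::idom list"
  shows "coeff (\<Prod>b\<leftarrow>bs. [:- b, 1:]) (length (filter (\<lambda>b. b = 0) bs)) = (\<Prod>b\<leftarrow>filter (\<lambda>b. b \<noteq> 0) bs. - b)"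
proof -
  have "(\<Prod>b\<leftarrow>bs. [:- b, 1:]) = monom 1 (length (filter (\<lambda>b. b = 0) bs)) * (\<Prod>b\<leftarrow>filter (\<lambda>b. b \<noteq> 0) bs. [:- b, 1:])"
  proof (induction bs)
    case (Cons b bs)
    let ?m = "monom 1 (length (filter (\<lambda>b. b = 0) bs)) :: 'a poly"
    let ?q = "\<Prod>b\<leftarrow>filter (\<lambda>b. b \<noteq> 0) bs. [:- b, 1:]"
    show ?case
    proof (cases "b = 0")
      case True
      then show ?thesis using Cons by (simp add: monom_Suc)
    next
      case False
      have "(\<Prod>b\<leftarrow>b # bs. [:- b, 1:]) = [:- b, 1:] * (?m * ?q)"
        by (simp only: list.map prod_list.Cons Cons)
      also have "\<dots> = ?m * ([:- b, 1:] * ?q)" by (rule mult.left_commute)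
      also have "[:- b, 1:] * ?q = (\<Prod>b\<leftarrow>filter (\<lambda>b. b \<noteq> 0) (b # bs). [:- b, 1:])"
        using False by (simp only: filter.simps if_True not_False_eq_True list.map prod_list.Cons simp_thms)
      finally show ?thesis using False by (simp only: filter.simps if_False)
    qed
  qed simp
  moreover have "coeff (monom 1 k * q) k = poly q 0" for k and q :: "'a poly"
    by (simp add: coeff_monom_mult poly_0_coeff_0)
  moreover have "poly (\<Prod>b\<leftarrow>bs. [:- b, 1:]) 0 = (\<Prod>b\<leftarrow>bs. - b)" for bs :: "'a list"
    by (induction bs) auto
  ultimately show ?thesis by simp
qed

text \<open>The product is, up to sign, the lowest nonvanishing coefficient of the characteristic polynomial
  of the integer matrix \<open>h(M)\<close>, hence the absolute value of a nonzero integer.\<close>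

lemma prod_nonzero_ge_1:
  fixes A :: "complex Matrix.mat" and M :: "int Matrix.mat" and h :: "int poly"
  assumes M: "M \<in> carrier_mat n n" and cp: "char_poly (map_mat of_int M) = (\<Prod>a\<leftarrow>es. [:- a, 1:])"
  shows "1 \<le> (\<Prod>a\<leftarrow>filter (\<lambda>a. poly (map_poly of_int h) a \<noteq> 0) es. cmod (poly (map_poly of_int h) a))"
proof -
  let ?A = "map_mat of_int M :: complex Matrix.mat"
  let ?h = "map_poly of_int h :: complex poly"
  interpret of_int_hom: comm_ring_hom "of_int :: int \<Rightarrow> complex" by unfold_locales auto
  have A: "?A \<in> carrier_mat n n" using M by simp
  have hom: "mat_poly n ?A (map of_int as) = map_mat of_int (mat_poly n M as)" for as
  proof (induction as)
    case (Cons a as)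
    have "map_mat of_int (M * mat_poly n M as) = ?A * (map_mat of_int (mat_poly n M as) :: complex Matrix.mat)"
      by (rule of_int_hom.mat_hom_mult[OF M mat_poly_carrier[OF M]])
    moreover have "map_mat of_int (a \<cdot>\<^sub>m 1\<^sub>m n + X) = (of_int a \<cdot>\<^sub>m 1\<^sub>m n + map_mat of_int X :: complex Matrix.mat)"
      if "X \<in> carrier_mat n n" for X :: "int Matrix.mat"
      by (rule eq_matI) (use that in auto)
    moreover have "M * mat_poly n M as \<in> carrier_mat n n" using M by simp
    ultimately show ?case by (simp only: list.map mat_poly.simps Cons)
  qed (auto intro!: eq_matI)
  have h: "Poly (map of_int (coeffs h)) = ?h"
    by (simp add: map_poly_def)
  let ?p = "char_poly (mat_poly n M (coeffs h))"
  have "map_poly of_int ?p = char_poly (mat_poly n ?A (map of_int (coeffs h)))"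
    unfolding hom by (rule of_int_hom.char_poly_hom[OF mat_poly_carrier[OF M], symmetric])
  also have "\<dots> = (\<Prod>b\<leftarrow>map (poly ?h) es. [:- b, 1:])"
    by (simp add: char_poly_mat_poly[OF A cp] h o_def)
  finally have p: "map_poly of_int ?p = (\<Prod>b\<leftarrow>map (poly ?h) es. [:- b, 1:])" .
  define bs where "bs = filter (\<lambda>b. b \<noteq> 0) (map (poly ?h) es)"
  let ?k = "length (filter (\<lambda>b. b = 0) (map (poly ?h) es))"
  have "of_int (coeff ?p ?k) = coeff (map_poly of_int ?p :: complex poly) ?k"
    by (simp add: coeff_map_poly)
  also have "\<dots> = (\<Prod>b\<leftarrow>bs. - b)"
    unfolding p bs_def by (rule coeff_linear_factors)
  finally have int: "of_int (coeff ?p ?k) = (\<Prod>b\<leftarrow>bs. - b)" .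
  have "0 \<notin> set (map uminus bs)" by (auto simp: bs_def)
  then have "(\<Prod>b\<leftarrow>bs. - b) \<noteq> 0" by (simp add: prod_list_zero_iff)
  then have "coeff ?p ?k \<noteq> 0" using int by auto
  then have "1 \<le> cmod (of_int (coeff ?p ?k))" by (simp add: norm_of_int)
  also have "\<dots> = (\<Prod>b\<leftarrow>bs. cmod b)"
    unfolding int by (induction bs) (auto simp: norm_mult)
  also have "\<dots> = (\<Prod>a\<leftarrow>filter (\<lambda>a. poly ?h a \<noteq> 0) es. cmod (poly ?h a))"
    by (simp add: bs_def filter_map o_def)
  finally show ?thesis .
qed

subsection \<open>Integer polynomials that are small at a given point\<close>

text \<open>Dirichlet's pigeonhole argument.  There are \<open>H\<^sup>m\<close> polynomials with \<open>m\<close> coefficients in \<open>{0..<H}\<close>, and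
  their values at \<open>x\<close> lie in an interval of length \<open>2 W\<close> where \<open>W\<close> is proportional to \<open>H\<close>; so two of them
  differ at \<open>x\<close> by less than a multiple of \<open>H\<^bsup>1 - m\<^esup>\<close>.  Their difference \<open>h\<close> is bounded by a multiple of
  \<open>H\<close> on \<open>[0, K]\<close>.  If \<open>m\<close> is large compared with \<open>1 / \<eta>\<close> and \<open>H\<close> is large enough to absorb the
  constants, then \<open>S\<close> is at most \<open>(1 / s)\<^sup>\<eta>\<close>.\<close>

lemma small_integer_polynomial:
  fixes x K \<eta> :: real
  assumes \<eta>: "0 < \<eta>"
  obtains h :: "int poly" and s S :: real
  where "h \<noteq> 0" "0 < s" "s < 1" "1 \<le> S" "ln S \<le> \<eta> * ln (1 / s)"
    "\<bar>poly (map_poly of_int h) x\<bar> < s" "\<And>y. 0 \<le> y \<Longrightarrow> y \<le> K \<Longrightarrow> \<bar>poly (map_poly of_int h) y\<bar> \<le> S"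
proof -
  define R where "R = max 1 (max \<bar>x\<bar> K)"
  have R: "1 \<le> R" "\<bar>x\<bar> \<le> R" "\<And>y. 0 \<le> y \<Longrightarrow> y \<le> K \<Longrightarrow> \<bar>y\<bar> \<le> R" by (auto simp: R_def)
  obtain m :: nat where m: "2 / \<eta> + 2 \<le> real m" using real_arch_simple by blast
  have m2: "2 \<le> m"
  proof -
    have "0 \<le> 2 / \<eta>" using \<eta> by simp
    then have "2 \<le> real m" using m by linarith
    then show ?thesis by simp
  qed
  \<comment> \<open>With \<open>S = C H\<close> and \<open>s = C H\<^bsup>1 - m\<^esup>\<close> the claim \<open>ln S \<le> \<eta> ln (1 / s)\<close> reads
    \<open>(1 + \<eta>) ln C + ln H \<le> \<eta> (m - 1) ln H\<close>; the right-hand side is at least \<open>2 ln H\<close> by the choice of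
    \<open>m\<close>, so it suffices that \<open>(1 + \<eta>) ln C \<le> ln H\<close>.\<close>
  define C where "C = 4 * real m * R ^ m"
  have C: "4 \<le> C"
  proof -
    have "1 * 1 \<le> real m * R ^ m" using m2 R by (intro mult_mono one_le_power) auto
    then show ?thesis by (simp add: C_def)
  qed
  obtain H :: nat where H: "max 3 (exp ((1 + \<eta>) * ln C)) \<le> real H" using real_arch_simple by blast
  have H3: "3 \<le> real H" using H by simp
  have lnC: "0 < ln C" using C by simp
  have lnH: "(1 + \<eta>) * ln C \<le> ln H"
  proof -
    have "exp ((1 + \<eta>) * ln C) \<le> real H" using H by simp
    then show ?thesis using H3 by (simp add: ln_ge_iff)
  qed
  have lnCH: "ln C < ln H"
  proof -
    have "ln C < (1 + \<eta>) * ln C" using lnC \<eta> by simp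
    then show ?thesis using lnH by simp
  qed
  define S where "S = C * real H"
  define s where "s = C * real H / real H ^ m"
  have s0: "0 < s" using C H3 by (simp add: s_def)
  have lns: "ln s = ln C - real (m - 1) * ln H"
  proof -
    have "ln s = ln C + ln H - real m * ln H"
      using C H3 by (simp add: s_def ln_div ln_mult ln_realpow)
    also have "\<dots> = ln C - real (m - 1) * ln H" using m2 by (simp add: of_nat_diff algebra_simps)
    finally show ?thesis .
  qed
  have "1 * ln H \<le> real (m - 1) * ln H" using m2 H3 by (intro mult_right_mono) auto
  then have "ln s < 0" using lns lnCH by simp
  then have s1: "s < 1" using s0 by (simp add: ln_less_zero_iff)
  have ratio: "ln S \<le> \<eta> * ln (1 / s)"
  proof -
    have "2 * ln H \<le> (\<eta> * real (m - 1)) * ln H"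
    proof (rule mult_right_mono)
      have "2 / \<eta> \<le> real (m - 1)" using m m2 by (simp add: of_nat_diff)
      then show "2 \<le> \<eta> * real (m - 1)" by (simp only: pos_divide_le_eq[OF \<eta>] mult.commute)
    qed (use H3 in simp)
    then have "ln C + ln H \<le> \<eta> * (real (m - 1) * ln H - ln C)"
      using lnH by (simp add: algebra_simps)
    moreover have "ln S = ln C + ln H" using C H3 by (simp add: S_def ln_mult)
    moreover have "ln (1 / s) = real (m - 1) * ln H - ln C" using s0 lns by (simp add: ln_div)
    ultimately show ?thesis by simp
  qed
  define W where "W = real m * real H * R ^ m"
  have W: "0 < W" using m2 H3 R by (simp add: W_def)
  \<comment> \<open>Boxes of length \<open>s\<close> cut an interval of length \<open>2 W\<close> into about \<open>H\<^sup>m / 2\<close> pieces, fewer than there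
    are polynomials.\<close>
  have sW: "s = 4 * W / real H ^ m" by (simp add: s_def W_def C_def mult_ac)
  have WS: "W \<le> S" "1 \<le> S"
  proof -
    have "S = 4 * W" by (simp add: S_def W_def C_def mult_ac)
    then show "W \<le> S" using W by simp
    have "1 * 1 \<le> C * real H" using C H3 by (intro mult_mono) auto
    then show "1 \<le> S" by (simp add: S_def)
  qed
  let ?F = "{..<m} \<rightarrow>\<^sub>E {..<H}"
  define val :: "(nat \<Rightarrow> nat) \<Rightarrow> real \<Rightarrow> real" where "val f y = (\<Sum>i<m. real (f i) * y ^ i)" for f y
  have term_bound: "\<bar>c * y ^ i\<bar> \<le> real H * R ^ m" if "\<bar>c\<bar> \<le> real H" "\<bar>y\<bar> \<le> R" "i < m" for c y i
  proof -
    have "\<bar>y\<bar> ^ i \<le> R ^ i" using that by (intro power_mono) auto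
    also have "\<dots> \<le> R ^ m" using that R by (intro power_increasing) auto
    finally show ?thesis using that unfolding abs_mult power_abs by (intro mult_mono) auto
  qed
  have sum_bound: "\<bar>\<Sum>i<m. c i * y ^ i\<bar> \<le> W" if "\<And>i. i < m \<Longrightarrow> \<bar>c i\<bar> \<le> real H" "\<bar>y\<bar> \<le> R" for c y
  proof -
    have "\<bar>\<Sum>i<m. c i * y ^ i\<bar> \<le> (\<Sum>i<m. real H * R ^ m)"
      by (rule order.trans[OF sum_abs], rule sum_mono) (use that term_bound in auto)
    then show ?thesis by (simp add: W_def)
  qed
  have val_bound: "\<bar>val f x\<bar> \<le> W" if "f \<in> ?F" for f
    unfolding val_def by (rule sum_bound) (use that R in \<open>auto simp: PiE_iff less_imp_le\<close>)
  define box where "box f = nat \<lfloor>(val f x + W) / s\<rfloor>" for f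
  have Hm: "9 \<le> real H ^ m"
  proof -
    have "(3::real) ^ 2 \<le> real H ^ m"
      using H3 m2 by (meson order.trans power_increasing power_mono zero_le_numeral one_le_numeral numeral_One)
    then show ?thesis by simp
  qed
  have box_le: "box f \<le> nat \<lfloor>real H ^ m / 2\<rfloor>" if "f \<in> ?F" for f
  proof -
    have "(val f x + W) / s \<le> (2 * W) / s" using val_bound[OF that] s0 by (intro divide_right_mono) auto
    also have "\<dots> = real H ^ m / 2" unfolding sW using W Hm by (simp add: field_simps)
    finally show ?thesis unfolding box_def by (intro nat_mono floor_mono)
  qed
  have "\<not> inj_on box ?F"
  proof
    assume inj: "inj_on box ?F"
    have "card ?F \<le> card {..nat \<lfloor>real H ^ m / 2\<rfloor>}"
      by (rule card_inj_on_le[OF inj]) (use box_le in auto)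
    then have "H ^ m \<le> Suc (nat \<lfloor>real H ^ m / 2\<rfloor>)" by (simp add: card_PiE)
    then have "real (H ^ m) \<le> real (Suc (nat \<lfloor>real H ^ m / 2\<rfloor>))" by (rule of_nat_mono)
    also have "\<dots> \<le> real H ^ m / 2 + 1" using of_nat_floor[of "real H ^ m / 2"] Hm by simp
    finally show False using Hm by simp
  qed
  then obtain f g where fg: "f \<in> ?F" "g \<in> ?F" "f \<noteq> g" "box f = box g" by (auto simp: inj_on_def)
  define c where "c i = int (f i) - int (g i)" for i
  define h where "h = (\<Sum>i<m. monom (c i) i)"
  have coeff_h: "coeff h i = (if i < m then c i else 0)" for i
    by (auto simp: h_def coeff_sum)
  have poly_h: "poly (map_poly of_int h) y = (\<Sum>i<m. of_int (c i) * y ^ i)" for y :: real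
  proof -
    have "map_poly of_int h = (\<Sum>i<m. monom (of_int (c i)) i :: real poly)"
      by (rule poly_eqI) (simp add: coeff_map_poly coeff_h coeff_sum)
    then show ?thesis by (simp add: poly_sum poly_monom)
  qed
  have hne: "h \<noteq> 0"
  proof
    assume "h = 0"
    then have "c i = 0" if "i < m" for i using coeff_h[of i] that by simp
    then have "f i = g i" if "i < m" for i using that by (simp add: c_def)
    then have "f = g" using fg(1,2) by (intro PiE_ext[OF fg(1,2)]) auto
    with fg(3) show False ..
  qed
  have cb: "\<bar>real_of_int (c i)\<bar> \<le> real H" if "i < m" for i
  proof -
    have "f i < H" "g i < H" using fg(1,2) that by (auto simp: PiE_iff)
    then show ?thesis by (auto simp: c_def)
  qed
  have small: "\<bar>poly (map_poly of_int h) x\<bar> < s"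
  proof -
    have "poly (map_poly of_int h) x = val f x - val g x"
      by (simp add: poly_h val_def c_def sum_subtractf[symmetric] left_diff_distrib)
    moreover have "\<bar>val f x - val g x\<bar> < s"
    proof -
      have pos: "0 \<le> (val f x + W) / s" "0 \<le> (val g x + W) / s"
        using val_bound[OF fg(1)] val_bound[OF fg(2)] s0 by (auto intro!: divide_nonneg_pos)
      have "\<lfloor>(val f x + W) / s\<rfloor> = \<lfloor>(val g x + W) / s\<rfloor>"
        using fg(4) pos unfolding box_def by (simp add: nat_eq_iff2)
      then have "\<bar>(val f x + W) / s - (val g x + W) / s\<bar> < 1" by linarith
      moreover have "(val f x + W) / s - (val g x + W) / s = (val f x - val g x) / s"
        by (simp add: diff_divide_distrib[symmetric])
      ultimately show ?thesis using s0 by (simp add: abs_divide)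
    qed
    ultimately show ?thesis by simp
  qed
  have bound: "\<bar>poly (map_poly of_int h) y\<bar> \<le> S" if "0 \<le> y" "y \<le> K" for y
    unfolding poly_h using sum_bound[of "\<lambda>i. of_int (c i)" y] cb R(3)[OF that] WS(1) by fastforce
  show ?thesis by (rule that[OF hne s0 s1 WS(2) ratio small bound])
qed

lemma poly_of_int_poly:
  fixes x :: "'a::{comm_ring_1,ring_char_0}"
  shows "poly (map_poly of_int h) x = (\<Sum>i\<le>degree h. of_int (coeff h i) * x ^ i)"
proof -
  have "degree (map_poly of_int h :: 'a poly) = degree h" by (rule degree_map_poly) auto
  then show ?thesis by (simp add: poly_altdef coeff_map_poly)
qed

text \<open>Take \<open>h\<close> small at \<open>x\<close>.  Close to \<open>x\<close>, but away from \<open>x\<close>, the value of \<open>h\<close> is nonzero and below \<open>s\<close>; the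
  other nonzero values on \<open>[0, K]\<close> are at most \<open>S\<close>.  If \<open>k\<close> of \<open>N\<close> eigenvalues are of the first kind, then
  \<open>1 \<le> s\<^sup>k S\<^sup>N\<close>, so \<open>k ln (1 / s) \<le> N ln S \<le> \<eta> N ln (1 / s)\<close>.  The distance \<open>\<epsilon>\<close> depends on \<open>h\<close> only, not on
  the size of the matrix.\<close>

theorem integer_matrix_eigenvalue_gap:
  fixes x K \<eta> :: real
  assumes \<eta>: "0 < \<eta>"
  shows "\<exists>\<epsilon>>0. \<forall>n (M :: int Matrix.mat) ls. M \<in> carrier_mat n n \<longrightarrow>
    char_poly (map_mat of_int M) = (\<Prod>l\<leftarrow>ls. [:- complex_of_real l, 1:]) \<longrightarrow> set ls \<subseteq> {0..K} \<longrightarrow>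
    real (length (filter (\<lambda>l. l \<noteq> x \<and> \<bar>l - x\<bar> < \<epsilon>) ls)) \<le> \<eta> * real (length ls)"
proof -
  obtain h :: "int poly" and s S :: real
    where h: "h \<noteq> 0" and s: "0 < s" "s < 1" and S: "1 \<le> S" and ratio: "ln S \<le> \<eta> * ln (1 / s)"
      and small: "\<bar>poly (map_poly of_int h) x\<bar> < s"
      and bound: "\<And>y. 0 \<le> y \<Longrightarrow> y \<le> K \<Longrightarrow> \<bar>poly (map_poly of_int h) y\<bar> \<le> S"
    by (rule small_integer_polynomial[OF \<eta>, of x K], rule that)
  let ?h = "map_poly of_int h :: real poly"
  have hne: "?h \<noteq> 0" using h by (auto simp: poly_eq_iff coeff_map_poly)
  have "isCont (\<lambda>y. \<bar>poly ?h y\<bar>) x" by (intro continuous_intros)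
  then have "\<forall>\<^sub>F y in at x. \<bar>poly ?h y\<bar> < s"
    using small by (auto simp: isCont_def intro: order_tendstoD)
  then obtain e1 where e1: "0 < e1" "\<And>y. y \<noteq> x \<Longrightarrow> \<bar>y - x\<bar> < e1 \<Longrightarrow> \<bar>poly ?h y\<bar> < s"
    by (auto simp: eventually_at dist_real_def)
  obtain e2 where e2: "0 < e2" "\<And>y. y \<noteq> x \<Longrightarrow> \<bar>y - x\<bar> < e2 \<Longrightarrow> poly ?h y \<noteq> 0"
  proof -
    obtain e where "0 < e" "\<forall>y\<in>{y. poly ?h y = 0}. y \<noteq> x \<longrightarrow> e \<le> dist x y"
      using finite_set_avoid[OF poly_roots_finite[OF hne], of x] by blast
    then show ?thesis by (intro that[of e]) (auto simp: dist_real_def abs_minus_commute)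
  qed
  have lns: "0 < ln (1 / s)" using s by simp
  have "real (length (filter (\<lambda>l. l \<noteq> x \<and> \<bar>l - x\<bar> < min e1 e2) ls)) \<le> \<eta> * real (length ls)"
    if M: "M \<in> carrier_mat n n" and cp: "char_poly (map_mat of_int M) = (\<Prod>l\<leftarrow>ls. [:- complex_of_real l, 1:])"
      and ls: "set ls \<subseteq> {0..K}" for n and M :: "int Matrix.mat" and ls
  proof -
    let ?bad = "\<lambda>l. l \<noteq> x \<and> \<bar>l - x\<bar> < min e1 e2"
    let ?k = "length (filter ?bad ls)"
    have cp': "char_poly (map_mat of_int M) = (\<Prod>a\<leftarrow>map complex_of_real ls. [:- a, 1:])"
      using cp by (simp add: o_def)
    have ev: "poly (map_poly of_int h) (complex_of_real l) = of_real (poly ?h l)" for l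
      by (simp add: poly_of_int_poly)
    have "1 \<le> (\<Prod>a\<leftarrow>filter (\<lambda>a. poly (map_poly of_int h) a \<noteq> 0) (map complex_of_real ls). cmod (poly (map_poly of_int h) a))"
      by (rule prod_nonzero_ge_1[OF M cp'])
    also have "\<dots> = (\<Prod>l\<leftarrow>filter (\<lambda>l. poly ?h l \<noteq> 0) ls. \<bar>poly ?h l\<bar>)"
      by (simp add: filter_map o_def ev)
    also have "\<dots> \<le> s ^ ?k * S ^ length ls"
      using ls
    proof (induction ls)
      case (Cons l ls)
      let ?P = "\<Prod>l\<leftarrow>filter (\<lambda>l. poly ?h l \<noteq> 0) ls. \<bar>poly ?h l\<bar>" and ?Q = "s ^ length (filter ?bad ls) * S ^ length ls"
      have IH: "?P \<le> ?Q" using Cons by auto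
      have P0: "0 \<le> ?P" by (induction ls) auto
      have Q0: "0 \<le> ?Q" using s S by simp
      consider "?bad l" | "\<not> ?bad l" "poly ?h l = 0" | "\<not> ?bad l" "poly ?h l \<noteq> 0" by blast
      then show ?case
      proof cases
        case 1
        then have "\<bar>poly ?h l\<bar> \<le> s * S" using e1(2)[of l] s S
          by (intro order.trans[OF less_imp_le mult_left_mono[of 1 S s, simplified]]) auto
        then have "\<bar>poly ?h l\<bar> * ?P \<le> (s * S) * ?Q" using IH P0 s S by (intro mult_mono) auto
        then show ?thesis using 1 e2(2)[of l] by (simp add: mult_ac)
      next
        case 2
        have "1 * ?Q \<le> S * ?Q" using Q0 S by (intro mult_right_mono) auto
        moreover have "filter ?bad (l # ls) = filter ?bad ls" using 2(1) by (simp only: filter.simps if_False)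
        moreover have "filter (\<lambda>l. poly ?h l \<noteq> 0) (l # ls) = filter (\<lambda>l. poly ?h l \<noteq> 0) ls" using 2(2) by simp
        ultimately show ?thesis using IH by (simp only: list.size power_Suc add_Suc_right add_0_right) (simp only: mult_1 mult.assoc mult.left_commute[of S])
      next
        case 3
        have "\<bar>poly ?h l\<bar> * ?P \<le> S * ?Q" using IH P0 Q0 S Cons.prems by (intro mult_mono bound) auto
        moreover have "filter ?bad (l # ls) = filter ?bad ls" using 3(1) by (simp only: filter.simps if_False)
        moreover have "filter (\<lambda>l. poly ?h l \<noteq> 0) (l # ls) = l # filter (\<lambda>l. poly ?h l \<noteq> 0) ls" using 3(2) by simp
        ultimately show ?thesis
          by (simp only: list.size power_Suc add_Suc_right add_0_right list.map prod_list.Cons) (simp only: mult.assoc mult.left_commute[of S])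
      qed
    qed simp
    finally have "1 \<le> s ^ ?k * S ^ length ls" .
    then have "0 \<le> ln (s ^ ?k * S ^ length ls)" by (rule ln_ge_zero)
    also have "\<dots> = real ?k * ln s + real (length ls) * ln S"
      using s S by (simp add: ln_mult ln_realpow)
    finally have "real ?k * ln (1 / s) \<le> real (length ls) * ln S" using s by (simp add: ln_div)
    also have "\<dots> \<le> real (length ls) * (\<eta> * ln (1 / s))" using ratio by (intro mult_left_mono) auto
    finally have "real ?k * ln (1 / s) \<le> (\<eta> * real (length ls)) * ln (1 / s)" by (simp add: mult_ac)
    then show ?thesis using lns by (simp only: mult_le_cancel_right_pos)
  qed
  then show ?thesis using e1(1) e2(1) by (intro exI[of _ "min e1 e2"]) auto
qed

section \<open>Uniform convergence of distribution functions\<close>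

definition list_cdf :: "real list \<Rightarrow> real \<Rightarrow> real" where
  "list_cdf ls t = real (length (filter (\<lambda>l. l \<le> t) ls)) / real (length ls)"

definition list_avg :: "real list \<Rightarrow> (real \<Rightarrow> real) \<Rightarrow> real" where
  "list_avg ls f = (\<Sum>l\<leftarrow>ls. f l) / real (length ls)"

lemma list_avg_mono: "(\<And>l. l \<in> set ls \<Longrightarrow> f l \<le> g l) \<Longrightarrow> list_avg ls f \<le> list_avg ls g"
  unfolding list_avg_def by (intro divide_right_mono sum_list_mono) auto

lemma list_avg_indicator: "list_avg ls (\<lambda>l. if l \<le> t then 1 else 0) = list_cdf ls t"
proof -
  have "(\<Sum>l\<leftarrow>ls. if l \<le> t then 1 else 0) = real (length (filter (\<lambda>l. l \<le> t) ls))"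
    by (induction ls) auto
  then show ?thesis by (simp add: list_avg_def list_cdf_def)
qed

lemma list_cdf_mono: "s \<le> t \<Longrightarrow> list_cdf ls s \<le> list_cdf ls t"
  unfolding list_avg_indicator[symmetric] by (rule list_avg_mono) auto

lemma list_avg_close:
  assumes "\<And>l. l \<in> set ls \<Longrightarrow> \<bar>f l - g l\<bar> \<le> e" "ls \<noteq> []"
  shows "\<bar>list_avg ls f - list_avg ls g\<bar> \<le> e"
proof -
  have "(\<Sum>l\<leftarrow>ls. f l) \<le> (\<Sum>l\<leftarrow>ls. g l + e) \<and> (\<Sum>l\<leftarrow>ls. g l) \<le> (\<Sum>l\<leftarrow>ls. f l + e)"
    using assms(1) by (intro conjI sum_list_mono) (fastforce simp: abs_le_iff)+
  moreover have "(\<Sum>l\<leftarrow>ls. k l + e) = (\<Sum>l\<leftarrow>ls. k l) + real (length ls) * e" for k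
    by (induction ls) (auto simp: algebra_simps)
  ultimately have "\<bar>(\<Sum>l\<leftarrow>ls. f l) - (\<Sum>l\<leftarrow>ls. g l)\<bar> \<le> real (length ls) * e" by (simp add: abs_le_iff)
  moreover have "list_avg ls f - list_avg ls g = ((\<Sum>l\<leftarrow>ls. f l) - (\<Sum>l\<leftarrow>ls. g l)) / real (length ls)"
    by (simp add: list_avg_def diff_divide_distrib)
  ultimately show ?thesis using assms(2) by (simp add: abs_divide pos_divide_le_eq mult.commute)
qed

lemma list_cdf_gap:
  assumes gap: "real (length (filter (\<lambda>l. l \<noteq> x \<and> \<bar>l - x\<bar> < \<epsilon>) ls)) \<le> \<eta> * real (length ls)"
    and "s \<le> t" and between: "\<And>l. s < l \<Longrightarrow> l \<le> t \<Longrightarrow> l \<noteq> x \<and> \<bar>l - x\<bar> < \<epsilon>" and "ls \<noteq> []"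
  shows "list_cdf ls t \<le> list_cdf ls s + \<eta>"
proof -
  have "length (filter (\<lambda>l. l \<le> t) ls) \<le> length (filter (\<lambda>l. l \<le> s) ls) + length (filter (\<lambda>l. l \<noteq> x \<and> \<bar>l - x\<bar> < \<epsilon>) ls)"
  proof (induction ls)
    case (Cons l ls)
    then show ?case using between[of l] \<open>s \<le> t\<close> by (cases "l \<le> s"; cases "l \<le> t") auto
  qed simp
  then have "real (length (filter (\<lambda>l. l \<le> t) ls)) \<le> real (length (filter (\<lambda>l. l \<le> s) ls)) + \<eta> * real (length ls)"
    using gap by linarith
  then show ?thesis using assms(4) by (simp add: list_cdf_def field_simps)
qed

lemma list_avg_poly:
  "list_avg ls (poly p) = (\<Sum>k\<le>degree p. coeff p k * list_avg ls (\<lambda>l. l ^ k))"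
proof -
  have "(\<Sum>l\<leftarrow>ls. poly p l) = (\<Sum>k\<le>degree p. coeff p k * (\<Sum>l\<leftarrow>ls. l ^ k))"
  proof (induction ls)
    case (Cons l ls)
    then show ?case by (simp add: poly_altdef distrib_left sum.distrib)
  qed simp
  then show ?thesis by (simp add: list_avg_def sum_divide_distrib)
qed

text \<open>The lists are eigenvalues with multiplicity.  The condition \<open>gap\<close> allows a list to have a large
  proportion of entries equal to \<open>x\<close>, but only a small one, uniformly in \<open>n\<close>, near \<open>x\<close> and different from
  it.\<close>

locale moment_convergence =
  fixes ls :: "nat \<Rightarrow> real list" and \<mu> :: "real measure" and c :: real
  assumes finite_mu: "finite_measure \<mu>" and sets_mu: "sets \<mu> = sets borel"
    and AE_mu: "AE t in \<mu>. t \<in> {0..c}"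
    and ls_range: "set (ls n) \<subseteq> {0..c}" and ls_ne: "ls n \<noteq> []"
    and moments: "(\<lambda>n. list_avg (ls n) (\<lambda>l. l ^ k)) \<longlonglongrightarrow> (\<integral>t. t ^ k \<partial>\<mu>)"
    and gap: "0 < \<eta> \<Longrightarrow> \<exists>\<epsilon>>0. \<forall>n. real (length (filter (\<lambda>l. l \<noteq> x \<and> \<bar>l - x\<bar> < \<epsilon>) (ls n))) \<le> \<eta> * real (length (ls n))"
begin

lemma measurable_mu: "measurable \<mu> M = measurable borel M"
  by (rule measurable_cong_sets[OF sets_mu refl])

lemma space_mu: "space \<mu> = UNIV"
  using sets_eq_imp_space_eq[OF sets_mu] by simp

lemma integrable_continuous:
  fixes f :: "real \<Rightarrow> real"
  assumes f: "continuous_on UNIV f"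
  shows "integrable \<mu> f"
proof -
  have "compact (f ` {0..c})"
    by (intro compact_continuous_image continuous_on_subset[OF f]) auto
  then obtain C where C: "\<And>t. t \<in> {0..c} \<Longrightarrow> \<bar>f t\<bar> \<le> C"
    using bounded_real[THEN iffD1, OF compact_imp_bounded] by (metis imageI)
  show ?thesis
  proof (rule finite_measure.integrable_const_bound[OF finite_mu])
    show "AE t in \<mu>. norm (f t) \<le> C" using AE_mu by eventually_elim (simp add: C)
    show "f \<in> borel_measurable \<mu>" unfolding measurable_mu by (rule borel_measurable_continuous_onI[OF f])
  qed
qed

lemma avg_poly_tendsto: "(\<lambda>n. list_avg (ls n) (poly p)) \<longlonglongrightarrow> (\<integral>t. poly p t \<partial>\<mu>)"
proof -
  have "(\<integral>t. poly p t \<partial>\<mu>) = (\<integral>t. (\<Sum>k\<le>degree p. coeff p k * t ^ k) \<partial>\<mu>)"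
    by (simp add: poly_altdef)
  also have "\<dots> = (\<Sum>k\<le>degree p. \<integral>t. coeff p k * t ^ k \<partial>\<mu>)"
    by (rule Bochner_Integration.integral_sum) (intro integrable_continuous continuous_intros)
  also have "\<dots> = (\<Sum>k\<le>degree p. coeff p k * (\<integral>t. t ^ k \<partial>\<mu>))" by simp
  finally show ?thesis
    unfolding list_avg_poly by (simp only:) (intro tendsto_intros moments)
qed

lemma avg_continuous_tendsto:
  fixes f :: "real \<Rightarrow> real"
  assumes f: "continuous_on UNIV f"
  shows "(\<lambda>n. list_avg (ls n) f) \<longlonglongrightarrow> (\<integral>t. f t \<partial>\<mu>)"
proof (rule LIMSEQ_I)
  interpret finite_measure \<mu> by (rule finite_mu)
  fix e :: real assume e: "0 < e"
  define m where "m = measure \<mu> UNIV + 1"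
  have m: "1 \<le> m" by (simp add: m_def)
  define e' where "e' = e / (4 * m)"
  have e': "0 < e'" "e' \<le> e / 4" "e' * m = e / 4"
  proof -
    show "0 < e'" using e m by (simp add: e'_def)
    show "e' * m = e / 4" using m by (simp add: e'_def)
    moreover have "e' * 1 \<le> e' * m" using m \<open>0 < e'\<close> by (intro mult_left_mono) auto
    ultimately show "e' \<le> e / 4" by simp
  qed
  obtain p where p: "\<And>t. t \<in> {0..c} \<Longrightarrow> \<bar>poly p t - f t\<bar> < e'"
    using poly_approx_continuous[OF continuous_on_subset[OF f subset_UNIV] e'(1), of 0 c] by blast
  obtain N where N: "\<And>n. n \<ge> N \<Longrightarrow> \<bar>list_avg (ls n) (poly p) - (\<integral>t. poly p t \<partial>\<mu>)\<bar> < e / 4"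
    using LIMSEQ_D[OF avg_poly_tendsto[of p], of "e / 4"] e by auto
  have int: "\<bar>(\<integral>t. poly p t \<partial>\<mu>) - (\<integral>t. f t \<partial>\<mu>)\<bar> \<le> e / 4"
  proof -
    have ip: "integrable \<mu> (\<lambda>t. poly p t)" by (intro integrable_continuous continuous_intros)
    have if': "integrable \<mu> f" by (rule integrable_continuous[OF f])
    have "\<bar>(\<integral>t. poly p t \<partial>\<mu>) - (\<integral>t. f t \<partial>\<mu>)\<bar> = \<bar>\<integral>t. poly p t - f t \<partial>\<mu>\<bar>"
      by (simp add: Bochner_Integration.integral_diff[OF ip if'])
    also have "\<dots> \<le> (\<integral>t. \<bar>poly p t - f t\<bar> \<partial>\<mu>)" by (rule integral_abs_bound)
    also have "\<dots> \<le> (\<integral>t. e' \<partial>\<mu>)"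
    proof (rule integral_mono_AE)
      show "AE t in \<mu>. \<bar>poly p t - f t\<bar> \<le> e'" using AE_mu by eventually_elim (use p in \<open>auto intro: less_imp_le\<close>)
    qed (use ip if' in auto)
    also have "\<dots> = measure \<mu> UNIV * e'" by (simp add: space_mu)
    also have "\<dots> \<le> e' * m" using e'(1) by (simp add: m_def algebra_simps)
    finally show ?thesis using e'(3) by simp
  qed
  have "norm (list_avg (ls n) f - (\<integral>t. f t \<partial>\<mu>)) < e" if "n \<ge> N" for n
  proof -
    have "\<bar>list_avg (ls n) (poly p) - list_avg (ls n) f\<bar> \<le> e'"
      by (rule list_avg_close) (use p ls_range[of n] ls_ne in \<open>auto intro!: less_imp_le\<close>)
    then show ?thesis using N[OF that] int e'(2) unfolding real_norm_def by linarith
  qed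
  then show "\<exists>N. \<forall>n\<ge>N. norm (list_avg (ls n) f - (\<integral>t. f t \<partial>\<mu>)) < e" by blast
qed

definition ramp :: "real \<Rightarrow> real \<Rightarrow> real \<Rightarrow> real" where
  "ramp a b t = max 0 (min 1 ((b - t) / (b - a)))"

lemma ramp:
  assumes "a < b"
  shows "(if t \<le> a then 1 else 0) \<le> ramp a b t" "ramp a b t \<le> (if t \<le> b then 1 else 0)"
proof -
  show "(if t \<le> a then 1 else 0) \<le> ramp a b t"
  proof (cases "t \<le> a")
    case True
    then have "1 \<le> (b - t) / (b - a)" using assms by (simp add: le_divide_eq)
    then show ?thesis using True by (simp add: ramp_def)
  qed (simp add: ramp_def)
  show "ramp a b t \<le> (if t \<le> b then 1 else 0)"
  proof (cases "t \<le> b")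
    case False
    then have "(b - t) / (b - a) \<le> 0" using assms by (intro divide_nonpos_pos) auto
    then show ?thesis using False by (simp add: ramp_def)
  qed (simp add: ramp_def)
qed

lemma continuous_ramp: "a < b \<Longrightarrow> continuous_on UNIV (ramp a b)"
  unfolding ramp_def by (intro continuous_intros) auto

abbreviation "F n t \<equiv> list_cdf (ls n) t"
abbreviation "M t \<equiv> measure \<mu> {..t}"

lemma integral_indicator_atMost: "integrable \<mu> (\<lambda>t. if t \<le> a then 1 else 0 :: real)" "(\<integral>t. (if t \<le> a then 1 else 0) \<partial>\<mu>) = M a"
proof -
  interpret finite_measure \<mu> by (rule finite_mu)
  have eq: "(\<lambda>t. if t \<le> a then 1 else 0 :: real) = indicator {..a}" by (auto simp: indicator_def)
  have "{..a} \<in> sets \<mu>" by (simp add: sets_mu)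
  then show "integrable \<mu> (\<lambda>t. if t \<le> a then 1 else 0 :: real)" "(\<integral>t. (if t \<le> a then 1 else 0) \<partial>\<mu>) = M a"
    unfolding eq by (auto simp: emeasure_eq_measure space_mu intro!: integrable_real_indicator)
qed

lemma ramp_bounds:
  assumes ab: "a < b"
  shows "F n a \<le> list_avg (ls n) (ramp a b)" "list_avg (ls n) (ramp a b) \<le> F n b"
    "M a \<le> (\<integral>t. ramp a b t \<partial>\<mu>)" "(\<integral>t. ramp a b t \<partial>\<mu>) \<le> M b"
proof -
  note r = ramp[OF ab] and i = integrable_continuous[OF continuous_ramp[OF ab]]
  show "F n a \<le> list_avg (ls n) (ramp a b)" "list_avg (ls n) (ramp a b) \<le> F n b"
    unfolding list_avg_indicator[symmetric] by (intro list_avg_mono r)+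
  show "M a \<le> (\<integral>t. ramp a b t \<partial>\<mu>)"
    unfolding integral_indicator_atMost(2)[symmetric] by (intro integral_mono integral_indicator_atMost(1) i r)
  show "(\<integral>t. ramp a b t \<partial>\<mu>) \<le> M b"
    unfolding integral_indicator_atMost(2)[symmetric] by (intro integral_mono integral_indicator_atMost(1) i r)
qed

lemma cdf_right_continuous: 
  assumes "0 < e"
  shows "\<exists>b>t. M b < M t + e"
proof -
  interpret finite_borel_measure \<mu>
    using finite_mu sets_mu by (simp add: finite_borel_measure_def finite_borel_measure_axioms_def)
  have "(cdf \<mu> \<longlongrightarrow> cdf \<mu> t) (at_right t)"
    using cdf_is_right_cont[of t] by (simp add: continuous_within)
  then have "\<forall>\<^sub>F b in at_right t. cdf \<mu> b < cdf \<mu> t + e"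
    by (rule order_tendstoD) (use assms in simp)
  then obtain b where "b > t" "\<forall>y>t. y < b \<longrightarrow> cdf \<mu> y < cdf \<mu> t + e"
    unfolding eventually_at_right_field by blast
  then have "cdf \<mu> ((t + b) / 2) < cdf \<mu> t + e" by simp
  with \<open>b > t\<close> show ?thesis by (intro exI[of _ "(t + b) / 2"]) (simp add: cdf_def)
qed

text \<open>Weak convergence compares distribution functions up to a small shift of the argument.  For the
  upper estimate the shift is removed by right continuity of the limit, for the lower one by \<open>gap\<close>:
  immediately to the right of \<open>t\<close> there are few entries.\<close>

lemma cdf_tendsto: "(\<lambda>n. F n t) \<longlonglongrightarrow> M t"
proof (rule LIMSEQ_I)
  fix e :: real assume e: "0 < e"
  obtain \<epsilon> where \<epsilon>: "0 < \<epsilon>" "\<And>n. real (length (filter (\<lambda>l. l \<noteq> t \<and> \<bar>l - t\<bar> < \<epsilon>) (ls n))) \<le> e / 2 * real (length (ls n))"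
    using gap[of "e / 2" t] e by auto
  have step: "F n (t + \<epsilon> / 2) \<le> F n t + e / 2" for n
    by (rule list_cdf_gap[OF \<epsilon>(2)]) (use \<epsilon>(1) ls_ne in auto)
  have tt: "t < t + \<epsilon> / 2" using \<epsilon> by simp
  obtain N1 where N1: "\<And>n. n \<ge> N1 \<Longrightarrow> \<bar>list_avg (ls n) (ramp t (t + \<epsilon> / 2)) - (\<integral>x. ramp t (t + \<epsilon> / 2) x \<partial>\<mu>)\<bar> < e / 2"
    using LIMSEQ_D[OF avg_continuous_tendsto[OF continuous_ramp[OF tt]], of "e / 2"] e by auto
  obtain b where b: "b > t" "M b < M t + e / 2" using cdf_right_continuous[of "e / 2" t] e by auto
  obtain N2 where N2: "\<And>n. n \<ge> N2 \<Longrightarrow> \<bar>list_avg (ls n) (ramp t b) - (\<integral>x. ramp t b x \<partial>\<mu>)\<bar> < e / 2"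
    using LIMSEQ_D[OF avg_continuous_tendsto[OF continuous_ramp[OF b(1)]], of "e / 2"] e by auto
  have "norm (F n t - M t) < e" if "n \<ge> max N1 N2" for n
  proof -
    have n: "n \<ge> N1" "n \<ge> N2" using that by auto
    have "M t < F n t + e"
      using ramp_bounds(3)[OF tt] N1[OF n(1)] ramp_bounds(2)[OF tt, of n] step[of n] by linarith
    moreover have "F n t < M t + e"
      using ramp_bounds(1)[OF b(1), of n] N2[OF n(2)] ramp_bounds(4)[OF b(1)] b(2) by linarith
    ultimately show ?thesis unfolding real_norm_def by linarith
  qed
  then show "\<exists>N. \<forall>n\<ge>N. norm (F n t - M t) < e" by blast
qed

text \<open>By \<open>gap\<close>, near each \<open>x\<close> all the distribution functions are almost constant to the left of \<open>x\<close> and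
  almost constant from \<open>x\<close> on, uniformly in \<open>n\<close>; pointwise convergence gives the same for the limit.
  By compactness finitely many \<open>x\<close> suffice, and then it is enough to have convergence at one
  point to the left of each of them and at the points \<open>x\<close> themselves.\<close>

theorem cdf_uniform_limit: "uniform_limit {0..} (\<lambda>n t. F n t) M sequentially"
proof (rule uniform_limitI)
  fix e :: real assume e: "0 < e"
  define \<eta> where "\<eta> = e / 4"
  have \<eta>: "0 < \<eta>" using e by (simp add: \<eta>_def)
  have "\<exists>\<epsilon>. 0 < \<epsilon> \<and> (\<forall>n. real (length (filter (\<lambda>l. l \<noteq> x \<and> \<bar>l - x\<bar> < \<epsilon>) (ls n))) \<le> \<eta> * real (length (ls n)))" for x
    using gap[OF \<eta>] by blast
  then obtain \<epsilon> where \<epsilon>: "\<And>x. 0 < \<epsilon> x"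
    "\<And>x n. real (length (filter (\<lambda>l. l \<noteq> x \<and> \<bar>l - x\<bar> < \<epsilon> x) (ls n))) \<le> \<eta> * real (length (ls n))"
    by metis
  have cover: "{0..c} \<subseteq> (\<Union>x\<in>{0..c}. {x - \<epsilon> x<..<x + \<epsilon> x})" using \<epsilon>(1) by fastforce
  obtain D where D: "D \<subseteq> {0..c}" "finite D" "{0..c} \<subseteq> (\<Union>x\<in>D. {x - \<epsilon> x<..<x + \<epsilon> x})"
    by (rule compactE_image[OF compact_Icc _ cover]) auto
  \<comment> \<open>The point \<open>c\<close> serves all \<open>t > c\<close>, where the functions are constant.\<close>
  define G where "G = insert c (D \<union> (\<lambda>x. x - \<epsilon> x / 2) ` D)"
  have "finite G" using D(2) by (simp add: G_def)
  moreover have "\<forall>\<^sub>F n in sequentially. \<bar>F n g - M g\<bar> < \<eta>" for g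
    using tendstoD[OF cdf_tendsto \<eta>] by (simp add: dist_real_def)
  ultimately have ev: "\<forall>\<^sub>F n in sequentially. \<forall>g\<in>G. \<bar>F n g - M g\<bar> < \<eta>"
    by (simp add: eventually_ball_finite)
  have gapM: "M t \<le> M s + \<eta>" if "\<And>n. F n t \<le> F n s + \<eta>" for s t
    by (rule LIMSEQ_le[OF cdf_tendsto tendsto_add[OF cdf_tendsto tendsto_const]]) (use that in auto)
  have monoM: "M s \<le> M t" if "s \<le> t" for s t
    by (rule LIMSEQ_le[OF cdf_tendsto cdf_tendsto]) (use list_cdf_mono[OF that] in auto)
  have close: "\<forall>n. \<bar>F n t - F n s\<bar> \<le> \<eta> \<and> \<bar>M t - M s\<bar> \<le> \<eta>"
    if st: "s \<le> t" and k: "\<And>n. F n t \<le> F n s + \<eta>" for s t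
  proof (intro allI conjI)
    show "\<bar>F n t - F n s\<bar> \<le> \<eta>" for n using k[of n] list_cdf_mono[OF st, of "ls n"] by linarith
    show "\<bar>M t - M s\<bar> \<le> \<eta>" using gapM[OF k] monoM[OF st] by linarith
  qed
  have grid: "\<exists>g\<in>G. \<forall>n. \<bar>F n t - F n g\<bar> \<le> \<eta> \<and> \<bar>M t - M g\<bar> \<le> \<eta>" if t0: "0 \<le> t" for t
  proof (cases "t \<le> c")
    case False
    have "F n t = F n c" for n
    proof -
      have "filter (\<lambda>l. l \<le> t) (ls n) = filter (\<lambda>l. l \<le> c) (ls n)"
        using ls_range[of n] False by (intro filter_cong) auto
      then show ?thesis by (simp add: list_cdf_def)
    qed
    moreover from this have "M t = M c" using LIMSEQ_unique[OF cdf_tendsto[of t]] cdf_tendsto[of c] by simp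
    ultimately show ?thesis using \<eta> by (intro bexI[of _ c]) (auto simp: G_def)
  next
    case True
    then obtain x where x: "x \<in> D" "x - \<epsilon> x < t" "t < x + \<epsilon> x" using D(3) t0 by fastforce
    show ?thesis
    proof (cases "x \<le> t")
      case True
      have k: "F n t \<le> F n x + \<eta>" for n
        by (rule list_cdf_gap[OF \<epsilon>(2)[of x n] True]) (use x ls_ne in auto)
      have "\<forall>n. \<bar>F n t - F n x\<bar> \<le> \<eta> \<and> \<bar>M t - M x\<bar> \<le> \<eta>" by (rule close[OF True k])
      then show ?thesis using x(1) by (intro bexI[of _ x]) (auto simp: G_def)
    next
      case False
      define g where "g = x - \<epsilon> x / 2"
      have gG: "g \<in> G" using x(1) by (auto simp: G_def g_def)
      have in1: "x - \<epsilon> x < g" "g < x" using \<epsilon>(1)[of x] by (auto simp: g_def)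
      have key: "F n v \<le> F n u + \<eta>" if "u \<le> v" "x - \<epsilon> x < u" "v < x" for u v n
        by (rule list_cdf_gap[OF \<epsilon>(2)[of x n] that(1)]) (use that ls_ne in auto)
      have "\<forall>n. \<bar>F n t - F n g\<bar> \<le> \<eta> \<and> \<bar>M t - M g\<bar> \<le> \<eta>"
      proof (cases "g \<le> t")
        case True
        have k: "F n t \<le> F n g + \<eta>" for n by (rule key) (use True in1 False in auto)
        show ?thesis by (rule close[OF True k])
      next
        case gt: False
        then have tg: "t \<le> g" by simp
        have k: "F n g \<le> F n t + \<eta>" for n by (rule key) (use tg in1 x in auto)
        show ?thesis using close[OF tg k] by (simp add: abs_minus_commute)
      qed
      with gG show ?thesis by blast
    qed
  qed
  show "\<forall>\<^sub>F n in sequentially. \<forall>t\<in>{0..}. dist (F n t) (M t) < e"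
    using ev
  proof eventually_elim
    case (elim n)
    show ?case
    proof
      fix t :: real assume "t \<in> {0..}"
      then obtain g where g: "g \<in> G" "\<bar>F n t - F n g\<bar> \<le> \<eta>" "\<bar>M t - M g\<bar> \<le> \<eta>" using grid[of t] by auto
      have "\<bar>F n g - M g\<bar> < \<eta>" using elim g(1) by blast
      then have "\<bar>F n t - M t\<bar> < 4 * \<eta>" using g(2,3) \<eta> by linarith
      then show "dist (F n t) (M t) < e" by (simp add: dist_real_def \<eta>_def)
    qed
  qed
qed

end

section \<open>Finite restrictions\<close>

subsection \<open>The boundary layer\<close>

context aq_graph
begin

lemma exit_through_boundary:
  "(x, y) \<in> E ^^ n \<Longrightarrow> x \<in> S \<Longrightarrow> y \<notin> S \<Longrightarrow> \<exists>p\<in>graph_boundary E S. d x p \<le> n"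
proof (induction n arbitrary: y)
  case (Suc n)
  then obtain z where z: "(x, z) \<in> E ^^ n" "(z, y) \<in> E" by auto
  show ?case
  proof (cases "z \<in> S")
    case True
    then have "z \<in> graph_boundary E S" using z Suc.prems by (auto simp: graph_boundary_def)
    then show ?thesis using dist_le[OF z(1)] by (intro bexI[of _ z]) auto
  next
    case False
    then obtain p where "p \<in> graph_boundary E S" "d x p \<le> n" using Suc.IH[OF z(1) Suc.prems(2)] by blast
    then show ?thesis by (intro bexI[of _ p]) auto
  qed
qed auto

text \<open>A path that leaves \<open>S\<close> meets the boundary, so these points are within distance \<open>R\<close> of it.\<close>

lemma card_boundary_layer:
  assumes "finite S"
  shows "card {x \<in> S. \<not> gball R x \<subseteq> S} \<le> card (graph_boundary E S) * ballcard R"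
proof -
  have fin: "finite (graph_boundary E S)" using assms by (simp add: graph_boundary_def)
  have "{x \<in> S. \<not> gball R x \<subseteq> S} \<subseteq> (\<Union>p\<in>graph_boundary E S. gball R p)"
  proof
    fix x assume "x \<in> {x \<in> S. \<not> gball R x \<subseteq> S}"
    then have "x \<in> S" "\<not> gball R x \<subseteq> S" by auto
    then obtain y where y: "x \<in> S" "y \<notin> S" "d x y \<le> R" unfolding subset_iff mem_ball by blast
    then obtain p where "p \<in> graph_boundary E S" "d x p \<le> d x y"
      using exit_through_boundary[OF relpow_dist] by blast
    then show "x \<in> (\<Union>p\<in>graph_boundary E S. gball R p)"
      using y(3) by (auto simp: mem_ball dist_sym[of _ x] intro!: bexI[of _ p])
  qed
  then have "card {x \<in> S. \<not> gball R x \<subseteq> S} \<le> card (\<Union>p\<in>graph_boundary E S. gball R p)"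
    by (rule card_mono[rotated]) (use fin in auto)
  also have "\<dots> \<le> (\<Sum>p\<in>graph_boundary E S. card (gball R p))" by (rule card_UN_le[OF fin])
  also have "\<dots> \<le> (\<Sum>p\<in>graph_boundary E S. ballcard R)" by (intro sum_mono ballcard(2))
  finally show ?thesis by simp
qed

end

subsection \<open>Matrices of the restrictions\<close>

lemma nonneg_if_pos_multiple_nonneg:
  assumes "e * of_real a \<in> \<real>" "0 \<le> Re (e * of_real a)" "0 < (a::real)"
  shows "e = of_real (Re e)" "0 \<le> Re e"
proof -
  have "Im (e * of_real a) = 0" using assms(1) by (simp add: complex_is_Real_iff)
  then have "Im e = 0" using assms(3) by simp
  then show "e = of_real (Re e)" by (simp add: complex_eq_iff)
  show "0 \<le> Re e" using assms(2,3) by (simp add: zero_le_mult_iff)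
qed

lemma proots_linear_factors: "proots (\<Prod>l\<leftarrow>ls. [:- of_real l, 1:] :: complex poly) = mset (map of_real ls)"
proof (induction ls)
  case (Cons l ls)
  have "(\<Prod>l\<leftarrow>ls. [:- of_real l, 1:] :: complex poly) \<noteq> 0" by (auto simp: prod_list_zero_iff)
  then have "proots ([:- of_real l, 1:] * (\<Prod>l\<leftarrow>ls. [:- of_real l, 1:] :: complex poly)) =
      proots [:- of_real l, 1:] + proots (\<Prod>l\<leftarrow>ls. [:- of_real l, 1:])"
    by (intro proots_mult) auto
  also have "\<dots> = mset (map of_real (l # ls))" by (simp add: Cons)
  finally show ?case by simp
qed simp

lemma common_denominator:
  assumes "finite X" "X \<subseteq> (\<rat> :: complex set)"
  shows "\<exists>D::nat. 0 < D \<and> (\<forall>v\<in>X. of_nat D * v \<in> \<int>)"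
  using assms
proof (induction X rule: finite_induct)
  case (insert v X)
  then obtain D where D: "0 < D" "\<forall>v\<in>X. of_nat D * v \<in> \<int>" by auto
  obtain a b :: int where ab: "b > 0" "v = of_int a / of_int b"
    using insert.prems by (auto elim: Rats_cases')
  have "of_nat (nat b * D) * w \<in> \<int>" if "w \<in> insert v X" for w
  proof (cases "w = v")
    case True
    have "of_nat (nat b) = (of_int b :: complex)" using ab(1) by (metis int_nat_eq of_int_of_nat_eq less_imp_le)
    then have eq: "of_nat (nat b * D) * v = of_nat D * of_int a" using ab by simp
    show ?thesis unfolding True eq by (intro Ints_mult) auto
  next
    case False
    then have "of_nat D * w \<in> \<int>" using D(2) that by blast
    then have "of_nat (nat b) * (of_nat D * w) \<in> \<int>" by (rule Ints_mult[OF Ints_of_nat])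
    then show ?thesis by (simp add: mult.assoc)
  qed
  then show ?case using D(1) ab(1) by (intro exI[of _ "nat b * D"]) auto
qed auto

context aq_positive
begin

definition \<delta> :: "'v \<Rightarrow> 'v \<Rightarrow> complex" where
  "\<delta> x = (\<lambda>y. if y = x then 1 else 0)"

lemma kernel_op_delta: "kernel_op B (\<delta> y) x = B x y"
proof -
  have "kernel_op B (\<delta> y) x = (\<Sum>z\<in>{y}. B x z * \<delta> y z)"
    unfolding kernel_op_def by (rule infsum_finite_support) (auto simp: \<delta>_def)
  then show ?thesis by (simp add: \<delta>_def)
qed

lemma Bpow_col: "kcol (Bpow k) x = (kernel_op B ^^ k) (\<delta> x)"
proof (induction k)
  case 0
  show ?case by (simp add: Bpow_def kernel_one_def \<delta>_def)
next
  case (Suc k)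
  have "kcol (Bpow (Suc k)) x = kernel_op B (kcol (Bpow k) x)"
    unfolding Bpow_def by (simp add: kernel_mult_col)
  with Suc show ?case by simp
qed

lemma power_delta_bound:
  "cmod ((kernel_op B ^^ k) (\<delta> x) y) \<le> Bnorm ^ k" "cmod ((compression B S ^^ k) (\<delta> x) y) \<le> Bnorm ^ k"
proof (induction k arbitrary: y)
  case (Suc k)
  { case 1
    show ?case using Bnorm(3)[of "(kernel_op B ^^ k) (\<delta> x)" "Bnorm ^ k" y, OF Suc(1)] by simp }
  { case 2
    show ?case
      using Bnorm(3)[of "(compression B S ^^ k) (\<delta> x)" "Bnorm ^ k" y, OF Suc(2)] Bnorm(1)
      by (simp add: compression_def[of B S "(compression B S ^^ k) (\<delta> x)"] l2_restrict_def) }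
qed (simp_all add: \<delta>_def)

text \<open>The support of \<open>B\<^sup>j \<delta>\<^sub>x\<close> grows by \<open>r\<close> in each step; as long as it stays inside \<open>S\<close>, restricting to
  \<open>S\<close> after each step changes nothing.\<close>

lemma compression_power_agree:
  assumes r: "inv_kernel r B" and sub: "gball (k * r) x \<subseteq> S"
  shows "(compression B S ^^ k) (\<delta> x) = (kernel_op B ^^ k) (\<delta> x)"
proof -
  have supp: "y \<in> gball (j * r) x" if "(kernel_op B ^^ j) (\<delta> x) y \<noteq> 0" for j y
    using that
  proof (induction j arbitrary: y)
    case (Suc j)
    then have "y \<in> {y. kernel_op B ((kernel_op B ^^ j) (\<delta> x)) y \<noteq> 0}" by simp
    then have "y \<in> (\<Union>z\<in>{z. (kernel_op B ^^ j) (\<delta> x) z \<noteq> 0}. gball r z)"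
      by (rule subsetD[OF kernel_op_support[OF r]])
    then obtain z where z: "(kernel_op B ^^ j) (\<delta> x) z \<noteq> 0" "y \<in> gball r z" by blast
    then have "d x z \<le> j * r" "d z y \<le> r" using Suc.IH by (auto simp: mem_ball)
    then show ?case using dist_triangle[of x y z] by (simp add: mem_ball)
  qed (auto simp: \<delta>_def split: if_splits)
  have "j \<le> k \<Longrightarrow> (compression B S ^^ j) (\<delta> x) = (kernel_op B ^^ j) (\<delta> x)" for j
  proof (induction j)
    case (Suc j)
    have "compression B S ((kernel_op B ^^ j) (\<delta> x)) y = kernel_op B ((kernel_op B ^^ j) (\<delta> x)) y" for y
    proof (cases "y \<in> S")
      case False
      then have "y \<notin> gball (Suc j * r) x"
        using sub ball_mono[OF mult_le_mono1[OF Suc.prems], of r x] by blast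
      then have "(kernel_op B ^^ Suc j) (\<delta> x) y = 0" using supp by blast
      then show ?thesis using False by (simp add: compression_def l2_restrict_def)
    qed (simp add: compression_def l2_restrict_def)
    then have "compression B S ((kernel_op B ^^ j) (\<delta> x)) = kernel_op B ((kernel_op B ^^ j) (\<delta> x))" by (rule ext)
    moreover have "(compression B S ^^ j) (\<delta> x) = (kernel_op B ^^ j) (\<delta> x)" using Suc by simp
    ultimately show ?case by (simp only: funpow.simps comp_apply)
  qed simp
  then show ?thesis by simp
qed

context
  fixes S :: "'v set" assumes S: "finite S"
begin

definition enum :: "'v list" where
  "enum = (SOME xs. distinct xs \<and> set xs = S)"

abbreviation "A \<equiv> op_matrix S (compression B S)"

lemma enum: "distinct enum" "set enum = S" "length enum = card S"
proof -
  have "distinct enum \<and> set enum = S"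
    unfolding enum_def by (rule someI_ex) (use finite_distinct_list[OF S] in auto)
  then show "distinct enum" "set enum = S" "length enum = card S"
    using distinct_card[of enum] by auto
qed

lemma enum_bij: "bij_betw (\<lambda>i. enum ! i) {..<card S} S"
  using bij_betw_nth[OF enum(1), of "{..<card S}" S] enum by simp

lemma enum_mem: "i < card S \<Longrightarrow> enum ! i \<in> S"
  using enum by (metis nth_mem)

lemma A_carrier: "A \<in> carrier_mat (card S) (card S)"
  by (simp add: op_matrix_def Let_def)

lemma A_entry:
  assumes "i < card S" "j < card S"
  shows "A $$ (i, j) = B (enum ! i) (enum ! j)"
  using assms enum_mem[OF assms(1)] kernel_op_delta[of "enum ! j" "enum ! i"]
  by (simp add: op_matrix_def Let_def enum_def[symmetric] compression_def l2_restrict_def \<delta>_def)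

lemma sum_enum: "(\<Sum>j<card S. g (enum ! j)) = (\<Sum>y\<in>S. g y)"
  by (rule sum.reindex_bij_betw[OF enum_bij])

lemma kernel_op_supported:
  assumes "\<And>y. y \<notin> S \<Longrightarrow> f y = 0"
  shows "kernel_op B f x = (\<Sum>y\<in>S. B x y * f y)"
  unfolding kernel_op_def by (rule infsum_finite_support) (use S assms in auto)

lemma A_pow_entry:
  assumes "i < card S" "j < card S"
  shows "(A ^\<^sub>m k) $$ (i, j) = (compression B S ^^ k) (\<delta> (enum ! j)) (enum ! i)"
  using assms
proof (induction k arbitrary: i)
  case 0
  have "enum ! i = enum ! j \<longleftrightarrow> i = j" using 0 enum by (simp add: nth_eq_iff_index_eq)
  then show ?case using 0 A_carrier by (simp add: \<delta>_def)
next
  case (Suc k)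
  have Ak: "A ^\<^sub>m k \<in> carrier_mat (card S) (card S)" using A_carrier by simp
  have comm: "A ^\<^sub>m Suc k = A * A ^\<^sub>m k"
  proof (induction k)
    case (Suc k)
    have "A ^\<^sub>m Suc (Suc k) = A * A ^\<^sub>m k * A" using Suc by simp
    also have "\<dots> = A * (A ^\<^sub>m k * A)"
      using A_carrier by (intro assoc_mult_mat[of _ "card S" "card S" _ "card S" _ "card S"]) auto
    finally show ?case by simp
  qed (use A_carrier in simp)
  let ?g = "(compression B S ^^ k) (\<delta> (enum ! j))"
  have g0: "?g y = 0" if "y \<notin> S" for y
    using that Suc.prems enum_mem by (cases k) (auto simp: \<delta>_def compression_def l2_restrict_def)
  have "(A ^\<^sub>m Suc k) $$ (i, j) = (\<Sum>l<card S. A $$ (i, l) * (A ^\<^sub>m k) $$ (l, j))"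
    unfolding comm using Suc.prems A_carrier Ak by (auto simp: scalar_prod_def atLeast0LessThan intro!: sum.cong)
  also have "\<dots> = (\<Sum>l<card S. B (enum ! i) (enum ! l) * ?g (enum ! l))"
    by (intro sum.cong refl) (use Suc A_entry in simp)
  also have "\<dots> = (\<Sum>y\<in>S. B (enum ! i) y * ?g y)" by (rule sum_enum)
  also have "\<dots> = kernel_op B ?g (enum ! i)" by (rule kernel_op_supported[symmetric, OF g0])
  also have "\<dots> = compression B S ?g (enum ! i)"
    using enum_mem[OF Suc.prems(1)] by (simp add: compression_def[of B S ?g] l2_restrict_def)
  finally show ?case by (simp only: funpow.simps comp_apply)
qed

lemma A_trace_pow: "mat_trace (A ^\<^sub>m k) = (\<Sum>x\<in>S. (compression B S ^^ k) (\<delta> x) x)"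
proof -
  have "dim_row (A ^\<^sub>m k) = card S" using A_carrier by simp
  then have "mat_trace (A ^\<^sub>m k) = (\<Sum>i<card S. (A ^\<^sub>m k) $$ (i, i))" by (simp add: mat_trace_def)
  also have "\<dots> = (\<Sum>i<card S. (compression B S ^^ k) (\<delta> (enum ! i)) (enum ! i))"
    by (intro sum.cong refl A_pow_entry) auto
  also have "\<dots> = (\<Sum>x\<in>S. (compression B S ^^ k) (\<delta> x) x)" by (rule sum_enum)
  finally show ?thesis .
qed

text \<open>An eigenvector is a finitely supported function at which the form of \<open>B\<close> is the eigenvalue times
  the squared norm; this gives nonnegativity.  The upper bound comes from the point where the
  eigenvector is largest in absolute value and the bound on \<open>B\<close> in the supremum norm.\<close>

lemma eigenvalue_range:
  assumes "eigenvalue A e"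
  shows "e = of_real (Re e)" "Re e \<in> {0..Bnorm}"
proof -
  obtain v where v: "v \<in> carrier_vec (card S)" "v \<noteq> 0\<^sub>v (card S)" "A *\<^sub>v v = e \<cdot>\<^sub>v v"
    using assms A_carrier by (auto simp: eigenvalue_def eigenvector_def)
  define f where "f x = (if x \<in> S then vec_index v (THE i. i < card S \<and> enum ! i = x) else 0)" for x
  have fe: "f (enum ! i) = vec_index v i" if "i < card S" for i
  proof -
    have "(THE j. j < card S \<and> enum ! j = enum ! i) = i"
      using that enum by (intro the_equality) (auto simp: nth_eq_iff_index_eq)
    then show ?thesis using enum_mem[OF that] by (simp add: f_def)
  qed
  have f0: "f y = 0" if "y \<notin> S" for y using that by (simp add: f_def)
  have fin: "finsupp f" unfolding finsupp_def by (rule finite_subset[OF _ S]) (use f0 in auto)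
  have eig: "kernel_op B f x = e * f x" if x: "x \<in> S" for x
  proof -
    obtain i where i: "i < card S" "x = enum ! i" using x enum by (metis in_set_conv_nth)
    have "e * f x = vec_index (e \<cdot>\<^sub>v v) i" using v(1) i fe by simp
    also have "\<dots> = vec_index (A *\<^sub>v v) i" by (simp add: v(3))
    also have "\<dots> = (\<Sum>j<card S. A $$ (i, j) * vec_index v j)"
      using A_carrier v(1) i by (auto simp: scalar_prod_def atLeast0LessThan intro!: sum.cong)
    also have "\<dots> = (\<Sum>j<card S. B x (enum ! j) * f (enum ! j))"
      by (intro sum.cong refl) (use i fe A_entry in simp)
    also have "\<dots> = (\<Sum>y\<in>S. B x y * f y)" by (rule sum_enum)
    also have "\<dots> = kernel_op B f x" by (rule kernel_op_supported[symmetric, OF f0])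
    finally show ?thesis by simp
  qed
  have nz: "\<exists>x\<in>S. f x \<noteq> 0"
  proof (rule ccontr)
    assume "\<not> (\<exists>x\<in>S. f x \<noteq> 0)"
    then have "vec_index v i = 0" if "i < card S" for i using fe[OF that] enum_mem[OF that] by simp
    then have "v = 0\<^sub>v (card S)" using v(1) by (intro eq_vecI) auto
    with v(2) show False ..
  qed
  define a where "a = (\<Sum>x\<in>S. (cmod (f x))\<^sup>2)"
  have a: "0 < a"
  proof -
    obtain x where x: "x \<in> S" "f x \<noteq> 0" using nz by blast
    have "0 < (cmod (f x))\<^sup>2" using x by simp
    also have "\<dots> \<le> a" unfolding a_def using S x by (intro member_le_sum) auto
    finally show ?thesis .
  qed
  have "l2_inner (kernel_op B f) f = cnj (l2_inner f (kernel_op B f))"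
    by (rule l2_inner_cnj[OF fin finsupp_kernel_op[OF B fin]])
  also have "l2_inner f (kernel_op B f) = (\<Sum>x\<in>S. f x * cnj (kernel_op B f x))"
    by (rule l2_inner_eq_sum[OF S]) (use f0 in auto)
  also have "\<dots> = (\<Sum>x\<in>S. cnj e * (f x * cnj (f x)))"
    by (intro sum.cong refl) (simp add: eig mult_ac)
  also have "cnj \<dots> = e * of_real a"
    by (simp add: a_def sum_distrib_left[symmetric] complex_norm_square mult.commute flip: of_real_power)
  finally have q: "l2_inner (kernel_op B f) f = e * of_real a" .
  show e: "e = of_real (Re e)"
    by (rule nonneg_if_pos_multiple_nonneg(1)[of e a]) (use B_pos_finsupp[OF fin] q a in auto)
  have e0: "0 \<le> Re e"
    by (rule nonneg_if_pos_multiple_nonneg(2)[of e a]) (use B_pos_finsupp[OF fin] q a in auto)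
  have img: "finite ((\<lambda>y. cmod (f y)) ` S)" "(\<lambda>y. cmod (f y)) ` S \<noteq> {}" using S nz by auto
  obtain x where x: "x \<in> S" "Max ((\<lambda>y. cmod (f y)) ` S) = cmod (f x)" using Max_in[OF img] by auto
  have max: "cmod (f y) \<le> cmod (f x)" if "y \<in> S" for y
    unfolding x(2)[symmetric] using img(1) that by (intro Max_ge) auto
  have "cmod (f y) \<le> cmod (f x)" for y using max[of y] f0[of y] by (cases "y \<in> S") auto
  from Bnorm(3)[of f "cmod (f x)" x, OF this] have "cmod e * cmod (f x) \<le> Bnorm * cmod (f x)"
    by (simp add: eig[OF x(1)] norm_mult)
  moreover have "0 < cmod (f x)"
  proof -
    obtain y where "y \<in> S" "f y \<noteq> 0" using nz by blast
    then have "0 < cmod (f y)" by simp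
    also have "\<dots> \<le> cmod (f x)" by (rule max[OF \<open>y \<in> S\<close>])
    finally show ?thesis .
  qed
  ultimately have "cmod e \<le> Bnorm" by simp
  then show "Re e \<in> {0..Bnorm}" using e0 complex_Re_le_cmod[of e] by simp
qed

lemma eigenvalue_list:
  "\<exists>ls. char_poly A = (\<Prod>l\<leftarrow>ls. [:- complex_of_real l, 1:]) \<and> set ls \<subseteq> {0..Bnorm} \<and> length ls = card S"
proof -
  obtain es where es: "char_poly A = (\<Prod>a\<leftarrow>es. [:- a, 1:])" "length es = card S"
    using char_poly_factorized[OF A_carrier] by blast
  have "eigenvalue A e" if "e \<in> set es" for e
    unfolding eigenvalue_root_char_poly[OF A_carrier] es(1) using that
    by (auto simp: poly_prod_list prod_list_zero_iff image_iff intro!: bexI[of _ e])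
  note ev = eigenvalue_range[OF this]
  have "map (\<lambda>e. complex_of_real (Re e)) es = es" by (rule map_idI) (use ev(1) in auto)
  then have "char_poly A = (\<Prod>l\<leftarrow>map Re es. [:- complex_of_real l, 1:])"
  proof -
    have "(\<Prod>l\<leftarrow>map Re es. [:- complex_of_real l, 1:]) = (\<Prod>a\<leftarrow>map (\<lambda>e. complex_of_real (Re e)) es. [:- a, 1:])"
      by (simp add: o_def)
    then show ?thesis by (simp only: es(1) \<open>map (\<lambda>e. complex_of_real (Re e)) es = es\<close>)
  qed
  then show ?thesis using es(2) ev(2) by (intro exI[of _ "map Re es"]) auto
qed

definition eigs :: "real list" where
  "eigs = (SOME ls. char_poly A = (\<Prod>l\<leftarrow>ls. [:- complex_of_real l, 1:]) \<and> set ls \<subseteq> {0..Bnorm} \<and> length ls = card S)"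

lemma eigs: "char_poly A = (\<Prod>l\<leftarrow>eigs. [:- complex_of_real l, 1:])" "set eigs \<subseteq> {0..Bnorm}" "length eigs = card S"
  using someI_ex[OF eigenvalue_list] unfolding eigs_def by blast+

lemma spectral_distribution_eq: "spectral_distribution B S t = list_cdf eigs t"
proof -
  have "count_eigenvalues_le S (compression B S) t = size (filter_mset (\<lambda>\<mu>. \<mu> \<in> \<real> \<and> Re \<mu> \<le> t) (mset (map complex_of_real eigs)))"
    by (simp only: count_eigenvalues_le_def eigs(1) proots_linear_factors)
  also have "\<dots> = length (filter (\<lambda>l. l \<le> t) eigs)"
    by (simp only: mset_filter[symmetric] size_mset filter_map length_map) (simp add: o_def)
  finally show ?thesis by (simp add: spectral_distribution_def list_cdf_def eigs(3))
qed

lemma eigs_moment: "(\<Sum>l\<leftarrow>eigs. l ^ k) = (\<Sum>x\<in>S. Re ((compression B S ^^ k) (\<delta> x) x))"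
proof -
  have cp: "char_poly A = (\<Prod>a\<leftarrow>map complex_of_real eigs. [:- a, 1:])"
    by (simp add: eigs(1) o_def)
  have "complex_of_real (\<Sum>l\<leftarrow>ls. l ^ k) = (\<Sum>a\<leftarrow>map complex_of_real ls. a ^ k)" for ls
    by (induction ls) auto
  then have "complex_of_real (\<Sum>l\<leftarrow>eigs. l ^ k) = (\<Sum>a\<leftarrow>map complex_of_real eigs. a ^ k)" .
  also have "\<dots> = (\<Sum>x\<in>S. (compression B S ^^ k) (\<delta> x) x)"
    using mat_trace_pow[OF A_carrier cp, of k] A_trace_pow by simp
  finally have "Re (complex_of_real (\<Sum>l\<leftarrow>eigs. l ^ k)) = Re (\<Sum>x\<in>S. (compression B S ^^ k) (\<delta> x) x)" by simp
  then show ?thesis by simp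
qed

text \<open>Both sums run over diagonal entries of \<open>k\<close>-th powers, which agree at points whose \<open>(k r)\<close>-ball lies
  in \<open>S\<close> and are bounded by \<open>Bnorm\<^sup>k\<close> at the others.\<close>

lemma eigs_moment_error:
  assumes r: "inv_kernel r B"
  shows "\<bar>(\<Sum>l\<leftarrow>eigs. l ^ k) - (\<Sum>x\<in>S. Re (Bpow k x x))\<bar> \<le>
    2 * Bnorm ^ k * (real (card (graph_boundary E S)) * real (ballcard (k * r)))"
proof -
  let ?bad = "{x \<in> S. \<not> gball (k * r) x \<subseteq> S}"
  let ?D = "\<lambda>x. Re ((compression B S ^^ k) (\<delta> x) x) - Re (Bpow k x x)"
  have Bp: "Bpow k x x = (kernel_op B ^^ k) (\<delta> x) x" for x using Bpow_col[of k x] by (rule fun_cong)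
  have "(\<Sum>l\<leftarrow>eigs. l ^ k) - (\<Sum>x\<in>S. Re (Bpow k x x)) = (\<Sum>x\<in>S. ?D x)"
    by (simp add: eigs_moment sum_subtractf)
  also have "\<dots> = (\<Sum>x\<in>?bad. ?D x)"
  proof (rule sum.mono_neutral_right[OF S])
    show "\<forall>x\<in>S - ?bad. ?D x = 0"
    proof
      fix x assume "x \<in> S - ?bad"
      then have "gball (k * r) x \<subseteq> S" by auto
      from compression_power_agree[OF r this] show "?D x = 0" by (simp add: Bp)
    qed
  qed auto
  also have "\<bar>\<dots>\<bar> \<le> (\<Sum>x\<in>?bad. 2 * Bnorm ^ k)"
  proof (rule order.trans[OF sum_abs], rule sum_mono)
    fix x
    have "\<bar>Re ((compression B S ^^ k) (\<delta> x) x)\<bar> \<le> Bnorm ^ k"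
      by (rule order.trans[OF abs_Re_le_cmod power_delta_bound(2)])
    moreover have "\<bar>Re (Bpow k x x)\<bar> \<le> Bnorm ^ k"
      unfolding Bp by (rule order.trans[OF abs_Re_le_cmod power_delta_bound(1)])
    ultimately show "\<bar>?D x\<bar> \<le> 2 * Bnorm ^ k" by linarith
  qed
  also have "\<dots> = 2 * Bnorm ^ k * real (card ?bad)" by simp
  also have "\<dots> \<le> 2 * Bnorm ^ k * (real (card (graph_boundary E S)) * real (ballcard (k * r)))"
  proof (rule mult_left_mono)
    show "real (card ?bad) \<le> real (card (graph_boundary E S)) * real (ballcard (k * r))"
      using card_boundary_layer[OF S, of "k * r"] by (metis of_nat_le_iff of_nat_mult)
  qed (use Bnorm(1) in simp)
  finally show ?thesis .
qed

end

lemma moments_tendsto: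
  assumes Q: "folner_seq E Q" and lim: "(\<lambda>n. (\<Sum>x\<in>Q n. Re (Bpow k x x)) / real (card (Q n))) \<longlonglongrightarrow> m"
  shows "(\<lambda>n. list_avg (eigs (Q n)) (\<lambda>l. l ^ k)) \<longlonglongrightarrow> m"
proof -
  obtain r where r: "inv_kernel r B" using B by (auto simp: PG_iff)
  have fin: "finite (Q n)" for n using Q by (simp add: folner_seq_def)
  define C where "C = 2 * Bnorm ^ k * real (ballcard (k * r))"
  have "(\<lambda>n. C * (real (card (graph_boundary E (Q n))) / real (card (Q n)))) \<longlonglongrightarrow> C * 0"
    using Q by (intro tendsto_intros) (simp add: folner_seq_def)
  then have 0: "(\<lambda>n. C * (real (card (graph_boundary E (Q n))) / real (card (Q n)))) \<longlonglongrightarrow> 0" by simp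
  have "(\<lambda>n. list_avg (eigs (Q n)) (\<lambda>l. l ^ k) - (\<Sum>x\<in>Q n. Re (Bpow k x x)) / real (card (Q n))) \<longlonglongrightarrow> 0"
  proof (rule Lim_null_comparison[OF always_eventually[OF allI] 0])
    fix n
    have "norm (list_avg (eigs (Q n)) (\<lambda>l. l ^ k) - (\<Sum>x\<in>Q n. Re (Bpow k x x)) / real (card (Q n)))
       = \<bar>(\<Sum>l\<leftarrow>eigs (Q n). l ^ k) - (\<Sum>x\<in>Q n. Re (Bpow k x x))\<bar> / real (card (Q n))"
      by (simp add: list_avg_def eigs(3)[OF fin] diff_divide_distrib[symmetric] abs_divide)
    also have "\<dots> \<le> 2 * Bnorm ^ k * (real (card (graph_boundary E (Q n))) * real (ballcard (k * r))) / real (card (Q n))"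
      by (intro divide_right_mono eigs_moment_error[OF fin r]) simp
    finally show "norm (list_avg (eigs (Q n)) (\<lambda>l. l ^ k) - (\<Sum>x\<in>Q n. Re (Bpow k x x)) / real (card (Q n)))
       \<le> C * (real (card (graph_boundary E (Q n))) / real (card (Q n)))"
      by (simp add: C_def mult_ac)
  qed
  from tendsto_add[OF this lim] show ?thesis by simp
qed

text \<open>A common denominator \<open>D\<close> of the entries of \<open>B\<close> turns every block into an integer matrix with
  eigenvalues in \<open>[0, D Bnorm]\<close>, and the gap at \<open>D x\<close> is scaled back.\<close>

lemma eigs_gap:
  assumes rat: "\<And>x y. B x y \<in> \<rat>" and \<eta>: "0 < \<eta>"
  shows "\<exists>\<epsilon>>0. \<forall>S. finite S \<longrightarrow>
    real (length (filter (\<lambda>l. l \<noteq> x \<and> \<bar>l - x\<bar> < \<epsilon>) (eigs S))) \<le> \<eta> * real (length (eigs S))"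
proof -
  obtain D :: nat where D: "0 < D" "\<And>x y. of_nat D * B x y \<in> \<int>"
    using common_denominator[OF finite_kernel_values[OF B]] rat by blast
  obtain \<epsilon> where \<epsilon>: "0 < \<epsilon>" and gap: "\<forall>n (M :: int Matrix.mat) ls. M \<in> carrier_mat n n \<longrightarrow>
    char_poly (map_mat of_int M) = (\<Prod>l\<leftarrow>ls. [:- complex_of_real l, 1:]) \<longrightarrow> set ls \<subseteq> {0..real D * Bnorm} \<longrightarrow>
    real (length (filter (\<lambda>l. l \<noteq> real D * x \<and> \<bar>l - real D * x\<bar> < \<epsilon>) ls)) \<le> \<eta> * real (length ls)"
    using integer_matrix_eigenvalue_gap[OF \<eta>, where x = "real D * x" and K = "real D * Bnorm"] by (elim exE conjE)
  have "real (length (filter (\<lambda>l. l \<noteq> x \<and> \<bar>l - x\<bar> < \<epsilon> / real D) (eigs S))) \<le> \<eta> * real (length (eigs S))"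
    if S: "finite S" for S
  proof -
    let ?n = "card S" and ?A = "op_matrix S (compression B S)"
    define M where "M = Matrix.mat ?n ?n (\<lambda>(i, j). \<lfloor>Re (of_nat D * ?A $$ (i, j))\<rfloor>)"
    have M: "M \<in> carrier_mat ?n ?n" by (simp add: M_def)
    have A: "?A \<in> carrier_mat ?n ?n" by (rule A_carrier[OF S])
    have cp: "char_poly ?A = (\<Prod>a\<leftarrow>map complex_of_real (eigs S). [:- a, 1:])"
      by (simp add: eigs(1)[OF S] o_def)
    \<comment> \<open>The scaled matrix is the polynomial \<open>D X\<close> of the matrix, which gives its eigenvalues.\<close>
    have mp: "mat_poly ?n ?A [0, of_nat D] = of_nat D \<cdot>\<^sub>m ?A"
    proof -
      have "?A * (of_nat D \<cdot>\<^sub>m 1\<^sub>m ?n + ?A * 0\<^sub>m ?n ?n) = of_nat D \<cdot>\<^sub>m ?A"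
        using A by (simp add: mult_smult_distrib[OF A one_carrier_mat])
      then show ?thesis using A by (intro eq_matI) auto
    qed
    have "map_mat of_int M = of_nat D \<cdot>\<^sub>m ?A"
    proof (rule eq_matI)
      fix i j assume ij: "i < dim_row (of_nat D \<cdot>\<^sub>m ?A)" "j < dim_col (of_nat D \<cdot>\<^sub>m ?A)"
      then have ij': "i < ?n" "j < ?n" using A by auto
      have "of_nat D * ?A $$ (i, j) \<in> \<int>" unfolding A_entry[OF S ij'] by (rule D(2))
      then obtain z where z: "of_nat D * ?A $$ (i, j) = of_int z" by (elim Ints_cases)
      have "M $$ (i, j) = \<lfloor>Re (of_nat D * ?A $$ (i, j))\<rfloor>" using ij' by (simp add: M_def)
      also have "\<dots> = z" unfolding z by simp
      finally have Mz: "M $$ (i, j) = z" .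
      have "map_mat of_int M $$ (i, j) = of_int (M $$ (i, j))" using ij' M by simp
      also have "\<dots> = (of_nat D \<cdot>\<^sub>m ?A) $$ (i, j)" using ij z by (simp add: Mz)
      finally show "map_mat of_int M $$ (i, j) = (of_nat D \<cdot>\<^sub>m ?A) $$ (i, j)" .
    qed (use A M in auto)
    then have "char_poly (map_mat of_int M) = (\<Prod>l\<leftarrow>map (\<lambda>l. real D * l) (eigs S). [:- complex_of_real l, 1:])"
      using char_poly_mat_poly[OF A cp, of "[0, of_nat D]"] unfolding mp by (simp add: o_def mult.commute)
    moreover have "set (map (\<lambda>l. real D * l) (eigs S)) \<subseteq> {0..real D * Bnorm}"
    proof -
      have "real D * l \<in> {0..real D * Bnorm}" if "l \<in> set (eigs S)" for l
        using subsetD[OF eigs(2)[OF S] that] by (simp add: mult_left_mono)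
      then show ?thesis by auto
    qed
    ultimately have "real (length (filter (\<lambda>l. l \<noteq> real D * x \<and> \<bar>l - real D * x\<bar> < \<epsilon>) (map (\<lambda>l. real D * l) (eigs S))))
      \<le> \<eta> * real (length (map (\<lambda>l. real D * l) (eigs S)))"
      by (rule gap[rule_format, OF M])
    moreover have "(real D * l \<noteq> real D * x \<and> \<bar>real D * l - real D * x\<bar> < \<epsilon>) \<longleftrightarrow> (l \<noteq> x \<and> \<bar>l - x\<bar> < \<epsilon> / real D)" for l
    proof -
      have "\<bar>real D * l - real D * x\<bar> = \<bar>l - x\<bar> * real D"
      proof -
        have "real D * l - real D * x = (l - x) * real D" by (simp add: algebra_simps)
        then show ?thesis by (simp add: abs_mult)
      qed
      then show ?thesis using D(1) by (simp add: pos_less_divide_eq)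
    qed
    ultimately show ?thesis by (simp add: filter_map o_def)
  qed
  then show ?thesis using \<epsilon> D(1) by (intro exI[of _ "\<epsilon> / real D"]) auto
qed

theorem spectral_distribution_uniform_limit:
  assumes rat: "\<And>x y. B x y \<in> \<rat>" and Q: "folner_seq E Q"
  shows "uniform_limit {0..} (\<lambda>n. spectral_distribution B (Q n)) (spectral_function E B) sequentially"
proof -
  have fin: "finite (Q n)" "Q n \<noteq> {}" for n using Q by (auto simp: folner_seq_def)
  obtain \<mu> :: "real measure" where \<mu>: "finite_measure \<mu>" "sets \<mu> = sets borel" "AE t in \<mu>. t \<in> {0..Bnorm}"
    and sf: "\<And>t. spectral_function E B t = measure \<mu> {0..t}"
    and mom: "\<And>k Q. folner_seq E Q \<Longrightarrow> (\<lambda>n. (\<Sum>x\<in>Q n. Re (Bpow k x x)) / real (card (Q n))) \<longlonglongrightarrow> (\<integral>t. t ^ k \<partial>\<mu>)"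
    by (rule ids_measure) blast
  interpret mc: moment_convergence "\<lambda>n. eigs (Q n)" \<mu> Bnorm
  proof (rule moment_convergence.intro)
    show "set (eigs (Q n)) \<subseteq> {0..Bnorm}" for n by (rule eigs(2)[OF fin(1)])
    show "eigs (Q n) \<noteq> []" for n using eigs(3)[OF fin(1)[of n]] fin[of n] by auto
    show "(\<lambda>n. list_avg (eigs (Q n)) (\<lambda>l. l ^ k)) \<longlonglongrightarrow> (\<integral>t. t ^ k \<partial>\<mu>)" for k
      by (rule moments_tendsto[OF Q mom[OF Q]])
    fix \<eta> x :: real assume "0 < \<eta>"
    from eigs_gap[OF rat this, of x] fin(1)
    show "\<exists>\<epsilon>>0. \<forall>n. real (length (filter (\<lambda>l. l \<noteq> x \<and> \<bar>l - x\<bar> < \<epsilon>) (eigs (Q n)))) \<le> \<eta> * real (length (eigs (Q n)))"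
      by blast
  qed (fact \<mu>)+
  have "measure \<mu> {..t} = spectral_function E B t" for t
    unfolding sf
  proof (rule finite_measure.finite_measure_eq_AE[OF \<mu>(1)])
    show "AE s in \<mu>. (s \<in> {..t}) = (s \<in> {0..t})" using \<mu>(3) by eventually_elim auto
  qed (auto simp: \<mu>(2))
  moreover have "spectral_distribution B (Q n) = list_cdf (eigs (Q n))" for n
    by (rule ext) (rule spectral_distribution_eq[OF fin(1)])
  ultimately show ?thesis using mc.cdf_uniform_limit by presburger
qed

end

theorem theorem1:
  fixes E :: "'v rel" and B :: "'v kernel" and Q :: "nat \<Rightarrow> 'v set"
  assumes "AQ_graph E"
    and "B \<in> pattern_invariant E"
    and "l2_self_adjoint B" and "l2_positive B"
    and "\<And>x y. B x y \<in> \<rat>"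
    and "folner_seq E Q"
  shows "left_mult_op E B \<in> graph_vN_algebra E \<and>
         self_adjoint_op (graph_hilbert E) (left_mult_op E B) \<and>
         positive_op (graph_hilbert E) (left_mult_op E B) \<and>
         uniform_limit {0..} (\<lambda>n. spectral_distribution B (Q n)) (spectral_function E B) sequentially"
proof -
  interpret aq_positive E B
    using assms(1-4) by unfold_locales
  show ?thesis
    using left_mult_in_vN left_mult_sa left_mult_pos spectral_distribution_uniform_limit[OF assms(5,6)] by blast
qed

end
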